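(* Let $A$ be an algebra in an abelian monoidal category $(\mathcal{M},\otimes,\mathbf{1})$. Then the following conditions are equivalent: (a) The universal Hochschild extension $E_A/e_A^2\to A$ of $A$ is trivial. (b) If $\pi:E\to B$ is an algebra homomorphism in $\mathcal{M}$ that splits in $\mathcal{M}$ and $(\mathrm{Ker}\,\pi)^2=0$, then any algebra homomorphism $f:A\to B$ can be lifted to an algebra homomorphism $g:A\to E$ (i.e. $\pi g=f$). (c) Given an algebra homomorphism $f:A\to B$ in $\mathcal M$ which admits a section that is an algebra homomorphism, any Hochschild extension of $B$ is trivial. (d) Any Hochschild extension of $A$ is trivial. (e) $\mathbf{H}^2(A,M)=0$ for all $M\in{}_A\mathcal{M}_A$. (f) Given an algebra homomorphism $f:A\to B$ in $\mathcal M$ which admits a section that is an algebra homomorphism, the universal Hochschild extension of $B$ is trivial.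
   Context: $(\mathcal{M},\otimes,\mathbf{1})$ is a monoidal category with $\mathcal{M}$ abelian. Constraints are suppressed. ${}_A\mathcal{M}_A$ is the category of $(A,A)$-bimodules in $\mathcal{M}$. Hochschild cohomology: $\mathbf{H}^\bullet(A,M)=\mathbf{Ext}^\bullet_{\mathcal{E}}(A,M)$, the relative Ext in ${}_A\mathcal{M}_A$ with respect to the class $\mathcal{E}$ of bimodule epimorphisms having a section in $\mathcal{M}$ (computed with $\mathcal{E}$-projective resolutions whose maps are $\mathcal{E}$-admissible). Concretely $\mathbf{H}^2(A,M)=\mathrm{Ker}\,b^2/\mathrm{Im}\,b^1$ with $b^1(f)=\mu_l(A\otimes f)-fm+\mu_r(f\otimes A)$ for $f:A\to M$ and $b^2(f)=\mu_l(A\otimes f)-f(m\otimes A)+f(A\otimes m)-\mu_r(f\otimes A)$ for $f:A\otimes A\to M$, where $m$ is the multiplication of $A$ and $\mu_l,\mu_r$ are the actions on $M$. An ideal of an algebra $E$ is an $(E,E)$-bimodule $I$ with a bimodule monomorphism $i:I\to E$; $I^2$ is the image of $m_E(i\otimes i)$, and $I^2=0$ means $m_E(i\otimes i)=0$. A Hochschild extension of $B$ with kernel a bimodule $M\in{}_B\mathcal{M}_B$ is an algebra homomorphism $\pi:E\to B$ having a section $\sigma$ in $\mathcal{M}$, together with $i:M\to E$ which is a kernel of $\pi$ in $\mathcal M$, such that $m_E(i\otimes i)=0$ and the $B$-actions $\mu_l,\mu_r$ on $M$ satisfy $i\mu_l=m_E(\sigma\otimes i)$, $i\mu_r=m_E(i\otimes\sigma)$.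 An extension $\pi:E\to B$ is trivial if it admits a section that is an algebra homomorphism. Universal Hochschild extension of $A$: let $T(A)=\bigoplus_{n\ge0}T_n(A)$, with $T_0(A)=\mathbf{1}$ and $T_n(A)=A^{\otimes n}$, be the tensor algebra of the object $A$, with unit $u_{T(A)}:\mathbf{1}\to T(A)$ and canonical morphism $i_A:A\to T(A)$. Let $I$ be the two-sided ideal of $T(A)$ generated by $h:=u_{T(A)}-i_Au_A:\mathbf{1}\to T(A)$ ($u_A$ the unit of $A$), i.e. the image of $T(A)\otimes\mathbf{1}\otimes T(A)\xrightarrow{T(A)\otimes h\otimes T(A)}T(A)^{\otimes3}\to T(A)$, where the last map is multiplication. Put $E_A=T(A)/I$ and let $\rho_A:A\to E_A$ be the composite of $i_A$ with the projection; it is unital ($\rho_A u_A=u_{E_A}$), and every unital morphism $\rho:A\to B$ to an algebra $B$ factors as $\rho=v\rho_A$ for a unique algebra morphism $v:E_A\to B$. Let $\pi_A:E_A\to A$ be the unique algebra map with $\pi_A\rho_A=\mathrm{Id}_A$, and $e_A=\mathrm{Ker}\,\pi_A$. The universal Hochschild extension of $A$ is the induced map $E_A/e_A^2\to A$, with kernel $e_A/e_A^2$.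
   Formalization: The formal theorem assumes that tensoring with an object on either side is additive and right exact, and that denumerable coproducts exist and are preserved by the tensor product, so that T(A), E_A, E_A/e_A^2 and H^2 are defined. *)

theory Defs
  imports "HOL-Algebra.Elementary_Groups"
begin

section \<open>Categories\<close>

record ('o, 'a) cat =
  Obj :: "'o set"
  Arr :: "'a set"
  Dom :: "'a \<Rightarrow> 'o"
  Cod :: "'a \<Rightarrow> 'o"
  Ident :: "'o \<Rightarrow> 'a"  (\<open>\<i>\<d>\<index>\<close>)
  Comp :: "'a \<Rightarrow> 'a \<Rightarrow> 'a"  (infixr \<open>\<cdot>\<index>\<close> 75)

definition Hom :: "('o, 'a, 'z) cat_scheme \<Rightarrow> 'o \<Rightarrow> 'o \<Rightarrow> 'a set" where
  "Hom C X Y = {f \<in> Arr C. Dom C f = X \<and> Cod C f = Y}"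

locale category =
  fixes C :: "('o, 'a, 'z) cat_scheme" (structure)
  assumes Dom_Obj: "f \<in> Arr C \<Longrightarrow> Dom C f \<in> Obj C"
    and Cod_Obj: "f \<in> Arr C \<Longrightarrow> Cod C f \<in> Obj C"
    and id_Hom: "X \<in> Obj C \<Longrightarrow> \<i>\<d> X \<in> Hom C X X"
    and comp_Hom: "\<lbrakk>g \<in> Hom C Y Z; f \<in> Hom C X Y\<rbrakk> \<Longrightarrow> g \<cdot> f \<in> Hom C X Z"
    and id_comp: "f \<in> Hom C X Y \<Longrightarrow> \<i>\<d> Y \<cdot> f = f"
    and comp_id: "f \<in> Hom C X Y \<Longrightarrow> f \<cdot> \<i>\<d> X = f"
    and comp_assoc:
      "\<lbrakk>h \<in> Hom C Y Z; g \<in> Hom C X Y; f \<in> Hom C W X\<rbrakk> \<Longrightarrow> (h \<cdot> g) \<cdot> f = h \<cdot> (g \<cdot> f)"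

definition is_mono :: "('o, 'a, 'z) cat_scheme \<Rightarrow> 'a \<Rightarrow> bool" where
  "is_mono C f \<longleftrightarrow> f \<in> Arr C \<and>
    (\<forall>W. \<forall>g \<in> Hom C W (Dom C f). \<forall>h \<in> Hom C W (Dom C f). f \<cdot> g = f \<cdot> h \<longrightarrow> g = h)"
  for C (structure)

definition is_epi :: "('o, 'a, 'z) cat_scheme \<Rightarrow> 'a \<Rightarrow> bool" where
  "is_epi C f \<longleftrightarrow> f \<in> Arr C \<and>
    (\<forall>W. \<forall>g \<in> Hom C (Cod C f) W. \<forall>h \<in> Hom C (Cod C f) W. g \<cdot> f = h \<cdot> f \<longrightarrow> g = h)"
  for C (structure)

definition inverse_arrows :: "('o, 'a, 'z) cat_scheme \<Rightarrow> 'a \<Rightarrow> 'a \<Rightarrow> bool" where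
  "inverse_arrows C f g \<longleftrightarrow> f \<in> Arr C \<and> g \<in> Hom C (Cod C f) (Dom C f) \<and>
    g \<cdot> f = \<i>\<d> (Dom C f) \<and> f \<cdot> g = \<i>\<d> (Cod C f)"
  for C (structure)

definition is_iso :: "('o, 'a, 'z) cat_scheme \<Rightarrow> 'a \<Rightarrow> bool" where
  "is_iso C f \<longleftrightarrow> (\<exists>g. inverse_arrows C f g)"

definition arr_inv :: "('o, 'a, 'z) cat_scheme \<Rightarrow> 'a \<Rightarrow> 'a" where
  "arr_inv C f = (THE g. inverse_arrows C f g)"

definition is_product ::
  "('o, 'a, 'z) cat_scheme \<Rightarrow> 'o \<Rightarrow> 'o \<Rightarrow> 'o \<Rightarrow> 'a \<Rightarrow> 'a \<Rightarrow> bool" where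
  "is_product C X Y P p q \<longleftrightarrow> P \<in> Obj C \<and> p \<in> Hom C P X \<and> q \<in> Hom C P Y \<and>
    (\<forall>W. \<forall>f \<in> Hom C W X. \<forall>g \<in> Hom C W Y. \<exists>!h. h \<in> Hom C W P \<and> p \<cdot> h = f \<and> q \<cdot> h = g)"
  for C (structure)

definition is_seq_coproduct ::
  "('o, 'a, 'z) cat_scheme \<Rightarrow> (nat \<Rightarrow> 'o) \<Rightarrow> 'o \<Rightarrow> (nat \<Rightarrow> 'a) \<Rightarrow> bool" where
  "is_seq_coproduct C F S j \<longleftrightarrow> S \<in> Obj C \<and> (\<forall>n. j n \<in> Hom C (F n) S) \<and>
    (\<forall>W \<in> Obj C. \<forall>f. (\<forall>n. f n \<in> Hom C (F n) W) \<longrightarrow>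
      (\<exists>!h. h \<in> Hom C S W \<and> (\<forall>n. h \<cdot> j n = f n)))"
  for C (structure)

section \<open>Abelian categories\<close>

record ('o, 'a) add_cat = "('o, 'a) cat" +
  Plus :: "'a \<Rightarrow> 'a \<Rightarrow> 'a"  (infixl \<open>\<oplus>\<^sub>a\<index>\<close> 65)
  Zero :: "'o \<Rightarrow> 'o \<Rightarrow> 'a"  (\<open>\<zero>\<^sub>a\<index>\<close>)

definition hom_group :: "('o, 'a, 'z) add_cat_scheme \<Rightarrow> 'o \<Rightarrow> 'o \<Rightarrow> 'a monoid" where
  "hom_group C X Y = \<lparr>carrier = Hom C X Y, mult = Plus C, one = Zero C X Y\<rparr>"

definition arr_diff :: "('o, 'a, 'z) add_cat_scheme \<Rightarrow> 'a \<Rightarrow> 'a \<Rightarrow> 'a"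
    (infixl \<open>\<ominus>\<^sub>a\<index>\<close> 65) where
  "arr_diff C f g = f \<oplus>\<^sub>a m_inv (hom_group C (Dom C g) (Cod C g)) g"
  for C (structure)

locale preadditive_category = category C
  for C :: "('o, 'a, 'z) add_cat_scheme" (structure) +
  assumes hom_comm_group: "\<lbrakk>X \<in> Obj C; Y \<in> Obj C\<rbrakk> \<Longrightarrow> comm_group (hom_group C X Y)"
    and comp_add_left: "\<lbrakk>g \<in> Hom C Y Z; g' \<in> Hom C Y Z; f \<in> Hom C X Y\<rbrakk>
      \<Longrightarrow> (g \<oplus>\<^sub>a g') \<cdot> f = g \<cdot> f \<oplus>\<^sub>a g' \<cdot> f"
    and comp_add_right: "\<lbrakk>g \<in> Hom C Y Z; f \<in> Hom C X Y; f' \<in> Hom C X Y\<rbrakk>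
      \<Longrightarrow> g \<cdot> (f \<oplus>\<^sub>a f') = g \<cdot> f \<oplus>\<^sub>a g \<cdot> f'"

definition is_kernel :: "('o, 'a, 'z) add_cat_scheme \<Rightarrow> 'a \<Rightarrow> 'a \<Rightarrow> bool" where
  "is_kernel C k f \<longleftrightarrow> f \<in> Arr C \<and> k \<in> Arr C \<and> Cod C k = Dom C f \<and>
    f \<cdot> k = \<zero>\<^sub>a (Dom C k) (Cod C f) \<and>
    (\<forall>W. \<forall>g \<in> Hom C W (Dom C f). f \<cdot> g = \<zero>\<^sub>a W (Cod C f) \<longrightarrow>
      (\<exists>!h. h \<in> Hom C W (Dom C k) \<and> k \<cdot> h = g))"
  for C (structure)

definition is_cokernel :: "('o, 'a, 'z) add_cat_scheme \<Rightarrow> 'a \<Rightarrow> 'a \<Rightarrow> bool" where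
  "is_cokernel C c f \<longleftrightarrow> f \<in> Arr C \<and> c \<in> Arr C \<and> Dom C c = Cod C f \<and>
    c \<cdot> f = \<zero>\<^sub>a (Dom C f) (Cod C c) \<and>
    (\<forall>W. \<forall>g \<in> Hom C (Cod C f) W. g \<cdot> f = \<zero>\<^sub>a (Dom C f) W \<longrightarrow>
      (\<exists>!h. h \<in> Hom C (Cod C c) W \<and> h \<cdot> c = g))"
  for C (structure)

text \<open>Binary products and a zero object give all finite biproducts in the preadditive setting.\<close>

locale abelian_category = preadditive_category C
  for C :: "('o, 'a, 'z) add_cat_scheme" (structure) +
  assumes ex_zero_object: "\<exists>Z \<in> Obj C. \<i>\<d> Z = \<zero>\<^sub>a Z Z"
    and ex_product: "\<lbrakk>X \<in> Obj C; Y \<in> Obj C\<rbrakk> \<Longrightarrow> \<exists>P p q. is_product C X Y P p q"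
    and ex_kernel: "f \<in> Arr C \<Longrightarrow> \<exists>k. is_kernel C k f"
    and ex_cokernel: "f \<in> Arr C \<Longrightarrow> \<exists>c. is_cokernel C c f"
    and mono_normal: "is_mono C f \<Longrightarrow> \<exists>g. is_kernel C f g"
    and epi_normal: "is_epi C f \<Longrightarrow> \<exists>g. is_cokernel C f g"

text \<open>Kernels, cokernels and images are represented by arrows; the corresponding objects are
  \<^term>\<open>Dom C (ker_arr C f)\<close>, \<^term>\<open>Cod C (coker_arr C f)\<close>, \<^term>\<open>Dom C (image_arr C f)\<close>.\<close>

definition ker_arr :: "('o, 'a, 'z) add_cat_scheme \<Rightarrow> 'a \<Rightarrow> 'a" where
  "ker_arr C f = (SOME k. is_kernel C k f)"

definition coker_arr :: "('o, 'a, 'z) add_cat_scheme \<Rightarrow> 'a \<Rightarrow> 'a" where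
  "coker_arr C f = (SOME c. is_cokernel C c f)"

definition image_arr :: "('o, 'a, 'z) add_cat_scheme \<Rightarrow> 'a \<Rightarrow> 'a" where
  "image_arr C f = ker_arr C (coker_arr C f)"

section \<open>Abelian monoidal categories\<close>

record ('o, 'a) mon_cat = "('o, 'a) add_cat" +
  TensO :: "'o \<Rightarrow> 'o \<Rightarrow> 'o"  (infixr \<open>\<otimes>\<^sub>o\<index>\<close> 80)
  TensA :: "'a \<Rightarrow> 'a \<Rightarrow> 'a"  (infixr \<open>\<otimes>\<^sub>a\<index>\<close> 80)
  UnitO :: "'o"  (\<open>\<I>\<index>\<close>)
  Assoc :: "'o \<Rightarrow> 'o \<Rightarrow> 'o \<Rightarrow> 'a"  (\<open>\<alpha>\<index>\<close>)
  LUnit :: "'o \<Rightarrow> 'a"  (\<open>\<l>\<index>\<close>)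
  RUnit :: "'o \<Rightarrow> 'a"  (\<open>\<r>\<index>\<close>)

locale monoidal_category = category C
  for C :: "('o, 'a, 'z) mon_cat_scheme" (structure) +
  assumes unit_Obj: "\<I> \<in> Obj C"
    and tens_Obj: "\<lbrakk>X \<in> Obj C; Y \<in> Obj C\<rbrakk> \<Longrightarrow> X \<otimes>\<^sub>o Y \<in> Obj C"
    and tens_Hom: "\<lbrakk>f \<in> Hom C X Y; g \<in> Hom C X' Y'\<rbrakk>
      \<Longrightarrow> f \<otimes>\<^sub>a g \<in> Hom C (X \<otimes>\<^sub>o X') (Y \<otimes>\<^sub>o Y')"
    and tens_id: "\<lbrakk>X \<in> Obj C; Y \<in> Obj C\<rbrakk> \<Longrightarrow> \<i>\<d> X \<otimes>\<^sub>a \<i>\<d> Y = \<i>\<d> (X \<otimes>\<^sub>o Y)"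
    and tens_comp:
      "\<lbrakk>g \<in> Hom C Y Z; f \<in> Hom C X Y; g' \<in> Hom C Y' Z'; f' \<in> Hom C X' Y'\<rbrakk>
      \<Longrightarrow> (g \<cdot> f) \<otimes>\<^sub>a (g' \<cdot> f') = (g \<otimes>\<^sub>a g') \<cdot> (f \<otimes>\<^sub>a f')"
    and assoc_Hom: "\<lbrakk>X \<in> Obj C; Y \<in> Obj C; Z \<in> Obj C\<rbrakk>
      \<Longrightarrow> \<alpha> X Y Z \<in> Hom C ((X \<otimes>\<^sub>o Y) \<otimes>\<^sub>o Z) (X \<otimes>\<^sub>o (Y \<otimes>\<^sub>o Z))"
    and assoc_iso: "\<lbrakk>X \<in> Obj C; Y \<in> Obj C; Z \<in> Obj C\<rbrakk> \<Longrightarrow> is_iso C (\<alpha> X Y Z)"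
    and assoc_natural: "\<lbrakk>f \<in> Hom C X X'; g \<in> Hom C Y Y'; h \<in> Hom C Z Z'\<rbrakk>
      \<Longrightarrow> \<alpha> X' Y' Z' \<cdot> ((f \<otimes>\<^sub>a g) \<otimes>\<^sub>a h) = (f \<otimes>\<^sub>a (g \<otimes>\<^sub>a h)) \<cdot> \<alpha> X Y Z"
    and lunit_Hom: "X \<in> Obj C \<Longrightarrow> \<l> X \<in> Hom C (\<I> \<otimes>\<^sub>o X) X"
    and lunit_iso: "X \<in> Obj C \<Longrightarrow> is_iso C (\<l> X)"
    and lunit_natural: "f \<in> Hom C X Y \<Longrightarrow> \<l> Y \<cdot> (\<i>\<d> \<I> \<otimes>\<^sub>a f) = f \<cdot> \<l> X"
    and runit_Hom: "X \<in> Obj C \<Longrightarrow> \<r> X \<in> Hom C (X \<otimes>\<^sub>o \<I>) X"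
    and runit_iso: "X \<in> Obj C \<Longrightarrow> is_iso C (\<r> X)"
    and runit_natural: "f \<in> Hom C X Y \<Longrightarrow> \<r> Y \<cdot> (f \<otimes>\<^sub>a \<i>\<d> \<I>) = f \<cdot> \<r> X"
    and pentagon: "\<lbrakk>W \<in> Obj C; X \<in> Obj C; Y \<in> Obj C; Z \<in> Obj C\<rbrakk>
      \<Longrightarrow> \<alpha> W X (Y \<otimes>\<^sub>o Z) \<cdot> \<alpha> (W \<otimes>\<^sub>o X) Y Z
        = (\<i>\<d> W \<otimes>\<^sub>a \<alpha> X Y Z) \<cdot> \<alpha> W (X \<otimes>\<^sub>o Y) Z \<cdot> (\<alpha> W X Y \<otimes>\<^sub>a \<i>\<d> Z)"
    and triangle: "\<lbrakk>X \<in> Obj C; Y \<in> Obj C\<rbrakk>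
      \<Longrightarrow> (\<i>\<d> X \<otimes>\<^sub>a \<l> Y) \<cdot> \<alpha> X \<I> Y = \<r> X \<otimes>\<^sub>a \<i>\<d> Y"

text \<open>As usual for abelian monoidal categories, the endofunctors given by tensoring with a fixed
  object on either side are additive and right exact (they preserve cokernels). This is what makes
  the quotient of an algebra by a two-sided ideal an algebra.\<close>

locale abelian_monoidal_category = abelian_category C + monoidal_category C
  for C :: "('o, 'a, 'z) mon_cat_scheme" (structure) +
  assumes tens_add_right: "\<lbrakk>X \<in> Obj C; f \<in> Hom C Y Z; g \<in> Hom C Y Z\<rbrakk>
      \<Longrightarrow> \<i>\<d> X \<otimes>\<^sub>a (f \<oplus>\<^sub>a g) = (\<i>\<d> X \<otimes>\<^sub>a f) \<oplus>\<^sub>a (\<i>\<d> X \<otimes>\<^sub>a g)"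
    and tens_add_left: "\<lbrakk>X \<in> Obj C; f \<in> Hom C Y Z; g \<in> Hom C Y Z\<rbrakk>
      \<Longrightarrow> (f \<oplus>\<^sub>a g) \<otimes>\<^sub>a \<i>\<d> X = (f \<otimes>\<^sub>a \<i>\<d> X) \<oplus>\<^sub>a (g \<otimes>\<^sub>a \<i>\<d> X)"
    and tens_cokernel_right: "\<lbrakk>X \<in> Obj C; is_cokernel C c f\<rbrakk>
      \<Longrightarrow> is_cokernel C (\<i>\<d> X \<otimes>\<^sub>a c) (\<i>\<d> X \<otimes>\<^sub>a f)"
    and tens_cokernel_left: "\<lbrakk>X \<in> Obj C; is_cokernel C c f\<rbrakk>
      \<Longrightarrow> is_cokernel C (c \<otimes>\<^sub>a \<i>\<d> X) (f \<otimes>\<^sub>a \<i>\<d> X)"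

text \<open>The condition under which the tensor algebra of every object is defined: denumerable
  coproducts exist and are preserved by the tensor product on either side.\<close>

definition tensor_denumerable_coproducts :: "('o, 'a, 'z) mon_cat_scheme \<Rightarrow> bool" where
  "tensor_denumerable_coproducts C \<longleftrightarrow>
    (\<forall>F. (\<forall>n. F n \<in> Obj C) \<longrightarrow> (\<exists>S j. is_seq_coproduct C F S j)) \<and>
    (\<forall>F S j. \<forall>X \<in> Obj C. (\<forall>n. F n \<in> Obj C) \<and> is_seq_coproduct C F S j \<longrightarrow>
      is_seq_coproduct C (\<lambda>n. X \<otimes>\<^sub>o F n) (X \<otimes>\<^sub>o S) (\<lambda>n. \<i>\<d> X \<otimes>\<^sub>a j n) \<and>
      is_seq_coproduct C (\<lambda>n. F n \<otimes>\<^sub>o X) (S \<otimes>\<^sub>o X) (\<lambda>n. j n \<otimes>\<^sub>a \<i>\<d> X))"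
  for C (structure)

section \<open>Algebras and bimodules\<close>

record ('o, 'a) alg =
  alg_obj :: 'o
  alg_mult :: 'a
  alg_unit :: 'a

definition is_algebra :: "('o, 'a, 'z) mon_cat_scheme \<Rightarrow> ('o, 'a) alg \<Rightarrow> bool" where
  "is_algebra C A \<longleftrightarrow> (let X = alg_obj A; m = alg_mult A; u = alg_unit A in
    X \<in> Obj C \<and> m \<in> Hom C (X \<otimes>\<^sub>o X) X \<and> u \<in> Hom C \<I> X \<and>
    m \<cdot> (m \<otimes>\<^sub>a \<i>\<d> X) = m \<cdot> (\<i>\<d> X \<otimes>\<^sub>a m) \<cdot> \<alpha> X X X \<and>
    m \<cdot> (u \<otimes>\<^sub>a \<i>\<d> X) = \<l> X \<and>
    m \<cdot> (\<i>\<d> X \<otimes>\<^sub>a u) = \<r> X)"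
  for C (structure)

definition alg_hom ::
  "('o, 'a, 'z) mon_cat_scheme \<Rightarrow> ('o, 'a) alg \<Rightarrow> ('o, 'a) alg \<Rightarrow> 'a \<Rightarrow> bool" where
  "alg_hom C A B f \<longleftrightarrow> f \<in> Hom C (alg_obj A) (alg_obj B) \<and>
    f \<cdot> alg_mult A = alg_mult B \<cdot> (f \<otimes>\<^sub>a f) \<and> f \<cdot> alg_unit A = alg_unit B"
  for C (structure)

record ('o, 'a) bimod =
  bim_obj :: 'o
  bim_left :: 'a
  bim_right :: 'a

definition is_bimodule ::
  "('o, 'a, 'z) mon_cat_scheme \<Rightarrow> ('o, 'a) alg \<Rightarrow> ('o, 'a) bimod \<Rightarrow> bool" where
  "is_bimodule C A M \<longleftrightarrow>
    (let X = alg_obj A; m = alg_mult A; u = alg_unit A;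
         Y = bim_obj M; l = bim_left M; r = bim_right M in
    Y \<in> Obj C \<and> l \<in> Hom C (X \<otimes>\<^sub>o Y) Y \<and> r \<in> Hom C (Y \<otimes>\<^sub>o X) Y \<and>
    l \<cdot> (m \<otimes>\<^sub>a \<i>\<d> Y) = l \<cdot> (\<i>\<d> X \<otimes>\<^sub>a l) \<cdot> \<alpha> X X Y \<and>
    l \<cdot> (u \<otimes>\<^sub>a \<i>\<d> Y) = \<l> Y \<and>
    r \<cdot> (r \<otimes>\<^sub>a \<i>\<d> X) = r \<cdot> (\<i>\<d> Y \<otimes>\<^sub>a m) \<cdot> \<alpha> Y X X \<and>
    r \<cdot> (\<i>\<d> Y \<otimes>\<^sub>a u) = \<r> Y \<and>
    r \<cdot> (l \<otimes>\<^sub>a \<i>\<d> X) = l \<cdot> (\<i>\<d> X \<otimes>\<^sub>a r) \<cdot> \<alpha> X Y X)"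
  for C (structure)

section \<open>Hochschild cohomology in degree two\<close>

definition hoch_b1 ::
  "('o, 'a, 'z) mon_cat_scheme \<Rightarrow> ('o, 'a) alg \<Rightarrow> ('o, 'a) bimod \<Rightarrow> 'a \<Rightarrow> 'a" where
  "hoch_b1 C A M f =
    bim_left M \<cdot> (\<i>\<d> (alg_obj A) \<otimes>\<^sub>a f)
    \<ominus>\<^sub>a f \<cdot> alg_mult A
    \<oplus>\<^sub>a bim_right M \<cdot> (f \<otimes>\<^sub>a \<i>\<d> (alg_obj A))"
  for C (structure)

text \<open>The source of the 3-cochain \<^term>\<open>hoch_b2 C A M f\<close> is bracketed as
  \<open>(A \<otimes> A) \<otimes> A\<close>.\<close>

definition hoch_b2 ::
  "('o, 'a, 'z) mon_cat_scheme \<Rightarrow> ('o, 'a) alg \<Rightarrow> ('o, 'a) bimod \<Rightarrow> 'a \<Rightarrow> 'a" where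
  "hoch_b2 C A M f = (let X = alg_obj A in
    bim_left M \<cdot> (\<i>\<d> X \<otimes>\<^sub>a f) \<cdot> \<alpha> X X X
    \<ominus>\<^sub>a f \<cdot> (alg_mult A \<otimes>\<^sub>a \<i>\<d> X)
    \<oplus>\<^sub>a f \<cdot> (\<i>\<d> X \<otimes>\<^sub>a alg_mult A) \<cdot> \<alpha> X X X
    \<ominus>\<^sub>a bim_right M \<cdot> (f \<otimes>\<^sub>a \<i>\<d> X))"
  for C (structure)

definition hoch_H2 ::
  "('o, 'a, 'z) mon_cat_scheme \<Rightarrow> ('o, 'a) alg \<Rightarrow> ('o, 'a) bimod \<Rightarrow> 'a set monoid" where
  "hoch_H2 C A M =
    (let X = alg_obj A; Y = bim_obj M;
         C1 = hom_group C X Y;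
         C2 = hom_group C (X \<otimes>\<^sub>o X) Y;
         C3 = hom_group C ((X \<otimes>\<^sub>o X) \<otimes>\<^sub>o X) Y
     in C2\<lparr>carrier := kernel C2 C3 (hoch_b2 C A M)\<rparr> Mod (hoch_b1 C A M ` carrier C1))"
  for C (structure)

section \<open>Hochschild extensions\<close>

definition hochschild_extension ::
  "('o, 'a, 'z) mon_cat_scheme \<Rightarrow> ('o, 'a) alg \<Rightarrow> ('o, 'a) bimod \<Rightarrow> ('o, 'a) alg \<Rightarrow> 'a \<Rightarrow> 'a \<Rightarrow> bool"
  where
  "hochschild_extension C B M E p i \<longleftrightarrow>
    is_bimodule C B M \<and> is_algebra C E \<and> alg_hom C E B p \<and>
    i \<in> Hom C (bim_obj M) (alg_obj E) \<and> is_kernel C i p \<and>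
    alg_mult E \<cdot> (i \<otimes>\<^sub>a i) = \<zero>\<^sub>a (bim_obj M \<otimes>\<^sub>o bim_obj M) (alg_obj E) \<and>
    (\<exists>s \<in> Hom C (alg_obj B) (alg_obj E). p \<cdot> s = \<i>\<d> (alg_obj B) \<and>
      i \<cdot> bim_left M = alg_mult E \<cdot> (s \<otimes>\<^sub>a i) \<and>
      i \<cdot> bim_right M = alg_mult E \<cdot> (i \<otimes>\<^sub>a s))"
  for C (structure)

definition trivial_extension ::
  "('o, 'a, 'z) mon_cat_scheme \<Rightarrow> ('o, 'a) alg \<Rightarrow> ('o, 'a) alg \<Rightarrow> 'a \<Rightarrow> bool" where
  "trivial_extension C E B p \<longleftrightarrow> (\<exists>s. alg_hom C B E s \<and> p \<cdot> s = \<i>\<d> (alg_obj B))"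
  for C (structure)

section \<open>The tensor algebra\<close>

text \<open>Tensor powers are bracketed to the right and end in the unit object, so that the first
  tensor power is \<open>X \<otimes> \<I>\<close>, identified with \<open>X\<close> through the right unit constraint.\<close>

primrec tens_pow :: "('o, 'a, 'z) mon_cat_scheme \<Rightarrow> 'o \<Rightarrow> nat \<Rightarrow> 'o" where
  "tens_pow C X 0 = UnitO C"
| "tens_pow C X (Suc n) = TensO C X (tens_pow C X n)"

text \<open>The canonical isomorphism from \<open>T_p(X) \<otimes> T_q(X)\<close> to \<open>T_(p+q)(X)\<close>.\<close>

primrec tens_pow_cat :: "('o, 'a, 'z) mon_cat_scheme \<Rightarrow> 'o \<Rightarrow> nat \<Rightarrow> nat \<Rightarrow> 'a" where
  "tens_pow_cat C X 0 q = LUnit C (tens_pow C X q)"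
| "tens_pow_cat C X (Suc p) q =
    Comp C (TensA C (Ident C X) (tens_pow_cat C X p q))
      (Assoc C X (tens_pow C X p) (tens_pow C X q))"

definition tens_alg_coprod :: "('o, 'a, 'z) mon_cat_scheme \<Rightarrow> 'o \<Rightarrow> 'o \<times> (nat \<Rightarrow> 'a)" where
  "tens_alg_coprod C X = (SOME (S, j). is_seq_coproduct C (tens_pow C X) S j)"

definition tens_alg_inj :: "('o, 'a, 'z) mon_cat_scheme \<Rightarrow> 'o \<Rightarrow> nat \<Rightarrow> 'a" where
  "tens_alg_inj C X = snd (tens_alg_coprod C X)"

definition tens_alg :: "('o, 'a, 'z) mon_cat_scheme \<Rightarrow> 'o \<Rightarrow> ('o, 'a) alg" where
  "tens_alg C X = (let T = fst (tens_alg_coprod C X); j = tens_alg_inj C X in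
    \<lparr>alg_obj = T,
     alg_mult = (THE m. m \<in> Hom C (T \<otimes>\<^sub>o T) T \<and>
       (\<forall>p q. m \<cdot> (j p \<otimes>\<^sub>a j q) = j (p + q) \<cdot> tens_pow_cat C X p q)),
     alg_unit = j 0\<rparr>)"
  for C (structure)

definition tens_alg_gen :: "('o, 'a, 'z) mon_cat_scheme \<Rightarrow> 'o \<Rightarrow> 'a" where
  "tens_alg_gen C X = tens_alg_inj C X 1 \<cdot> arr_inv C (\<r> X)"
  for C (structure)

section \<open>The universal Hochschild extension\<close>

text \<open>Quotient of the algebra \<open>E\<close> by an ideal given by a monomorphism \<open>i\<close> into \<open>E\<close>; the
  projection is \<^term>\<open>coker_arr C i\<close>.\<close>

definition quot_alg :: "('o, 'a, 'z) mon_cat_scheme \<Rightarrow> ('o, 'a) alg \<Rightarrow> 'a \<Rightarrow> ('o, 'a) alg" where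
  "quot_alg C E i = (let p = coker_arr C i; Q = Cod C p in
    \<lparr>alg_obj = Q,
     alg_mult = (THE m. m \<in> Hom C (Q \<otimes>\<^sub>o Q) Q \<and> m \<cdot> (p \<otimes>\<^sub>a p) = p \<cdot> alg_mult E),
     alg_unit = p \<cdot> alg_unit E\<rparr>)"
  for C (structure)

text \<open>The inclusion of the two-sided ideal of \<open>E\<close> generated by \<open>h : \<I> \<rightarrow> E\<close>.\<close>

definition gen_ideal :: "('o, 'a, 'z) mon_cat_scheme \<Rightarrow> ('o, 'a) alg \<Rightarrow> 'a \<Rightarrow> 'a" where
  "gen_ideal C E h = (let X = alg_obj E; m = alg_mult E in
    image_arr C (m \<cdot> (m \<otimes>\<^sub>a \<i>\<d> X) \<cdot> ((\<i>\<d> X \<otimes>\<^sub>a h) \<otimes>\<^sub>a \<i>\<d> X)))"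
  for C (structure)

text \<open>The inclusion of the square of the ideal given by \<open>i\<close>.\<close>

definition ideal_square :: "('o, 'a, 'z) mon_cat_scheme \<Rightarrow> ('o, 'a) alg \<Rightarrow> 'a \<Rightarrow> 'a" where
  "ideal_square C E i = image_arr C (alg_mult E \<cdot> (i \<otimes>\<^sub>a i))"
  for C (structure)

definition univ_ideal :: "('o, 'a, 'z) mon_cat_scheme \<Rightarrow> ('o, 'a) alg \<Rightarrow> 'a" where
  "univ_ideal C A = (let T = tens_alg C (alg_obj A) in
    gen_ideal C T (alg_unit T \<ominus>\<^sub>a tens_alg_gen C (alg_obj A) \<cdot> alg_unit A))"
  for C (structure)

text \<open>\<open>E\<^sub>A\<close>, \<open>\<rho>\<^sub>A\<close>, \<open>\<pi>\<^sub>A\<close> and the inclusion of \<open>e\<^sub>A\<close> into \<open>E\<^sub>A\<close>:\<close>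

definition univ_E :: "('o, 'a, 'z) mon_cat_scheme \<Rightarrow> ('o, 'a) alg \<Rightarrow> ('o, 'a) alg" where
  "univ_E C A = quot_alg C (tens_alg C (alg_obj A)) (univ_ideal C A)"

definition univ_rho :: "('o, 'a, 'z) mon_cat_scheme \<Rightarrow> ('o, 'a) alg \<Rightarrow> 'a" where
  "univ_rho C A = coker_arr C (univ_ideal C A) \<cdot> tens_alg_gen C (alg_obj A)"
  for C (structure)

definition univ_pi :: "('o, 'a, 'z) mon_cat_scheme \<Rightarrow> ('o, 'a) alg \<Rightarrow> 'a" where
  "univ_pi C A = (THE v. alg_hom C (univ_E C A) A v \<and> v \<cdot> univ_rho C A = \<i>\<d> (alg_obj A))"
  for C (structure)

definition univ_e :: "('o, 'a, 'z) mon_cat_scheme \<Rightarrow> ('o, 'a) alg \<Rightarrow> 'a" where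
  "univ_e C A = ker_arr C (univ_pi C A)"

text \<open>The algebra \<open>E\<^sub>A / e\<^sub>A\<^sup>2\<close> and its projection onto \<open>A\<close>:\<close>

definition univ_hoch_alg :: "('o, 'a, 'z) mon_cat_scheme \<Rightarrow> ('o, 'a) alg \<Rightarrow> ('o, 'a) alg" where
  "univ_hoch_alg C A = quot_alg C (univ_E C A) (ideal_square C (univ_E C A) (univ_e C A))"

definition univ_hoch_map :: "('o, 'a, 'z) mon_cat_scheme \<Rightarrow> ('o, 'a) alg \<Rightarrow> 'a" where
  "univ_hoch_map C A = (THE q. q \<in> Hom C (alg_obj (univ_hoch_alg C A)) (alg_obj A) \<and>
    q \<cdot> coker_arr C (ideal_square C (univ_E C A) (univ_e C A)) = univ_pi C A)"
  for C (structure)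

end

theory Submission
  imports Defs
begin

text \<open>
  A lift along a square-zero extension \<open>p : E \<rightarrow> B\<close> split in \<open>C\<close> is obtained from the universal
  property of \<open>E\<^sub>A\<close>: the section can be made unital, so \<open>f : A \<rightarrow> B\<close> lifts to an algebra map
  \<open>E\<^sub>A \<rightarrow> E\<close> over \<open>f \<pi>\<^sub>A\<close>; it sends \<open>e\<^sub>A\<close> into the kernel of \<open>p\<close>, hence kills \<open>e\<^sub>A\<^sup>2\<close>, and composing
  with an algebra section of \<open>E\<^sub>A / e\<^sub>A\<^sup>2 \<rightarrow> A\<close> gives (a) \<open>\<Longrightarrow>\<close> (b). Lifting the retraction gives
  (b) \<open>\<Longrightarrow>\<close> (c), and (c) \<open>\<Longrightarrow>\<close> (d) is the case of the identity. The kernel of any square-zero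
  extension is a bimodule, so the universal extension is a Hochschild extension; this yields
  (d) \<open>\<Longrightarrow>\<close> (a) and (c) \<open>\<Longrightarrow>\<close> (f), while (f) \<open>\<Longrightarrow>\<close> (a) is again the identity.
  Finally (d) \<open>\<Longleftrightarrow>\<close> (e): the failure of a section to be multiplicative is a 2-cocycle, which is a
  coboundary iff the section can be corrected; conversely a cocycle \<open>w\<close> defines an algebra structure
  on \<open>M \<oplus> A\<close> with unit \<open>(- w(1, 1), 1)\<close>.
\<close>

section \<open>Preadditive and abelian categories\<close>

text \<open>Two obstacles shape the details. The first is the unit. Sections in \<open>C\<close>
  need not be unital and cocycles need not be normalized, while \<open>E_A\<close> classifies only
  unital arrows and lifts must be unital. So the unit is repaired at three places: for an arbitrary
  section, for a multiplicative section, and for the algebra of a cocycle. The second is exactness.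
  Tensoring preserves cokernels but need not preserve kernels, so an ideal is not handled through
  its inclusion. A quotient is treated as the cokernel of an arrow generating the ideal, and the
  square of the kernel of \<open>E_A/e_A^2\<close> is computed with a projection onto that kernel
  rather than by tensoring an inclusion. What makes the kernel of a square-zero extension a bimodule
  although \<open>s\<close> is not multiplicative is that a product with a kernel element depends on
  the other factor only through its image under \<open>p\<close>. The same fact drives every
  correction of a section or of a unit.\<close>

lemma Hom_iff: "f \<in> Hom C X Y \<longleftrightarrow> f \<in> Arr C \<and> Dom C f = X \<and> Cod C f = Y"
  by (auto simp: Hom_def)

section \<open>Categories: typing of arrows, isomorphisms, epimorphisms\<close>

context category
begin

lemmas dom_cod_Obj [simp] = Dom_Obj Cod_Obj

lemma ident_typing [simp]:
  assumes "X \<in> Obj C"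
  shows "\<i>\<d> X \<in> Arr C" "Dom C (\<i>\<d> X) = X" "Cod C (\<i>\<d> X) = X"
  using id_Hom[OF assms] by (auto simp: Hom_iff)

lemma comp_typing [simp]:
  assumes "f \<in> Arr C" "g \<in> Arr C" "Cod C f = Dom C g"
  shows "g \<cdot> f \<in> Arr C" "Dom C (g \<cdot> f) = Dom C f" "Cod C (g \<cdot> f) = Cod C g"
  using comp_Hom[of g "Dom C g" "Cod C g" f "Dom C f"] assms by (auto simp: Hom_iff)

lemma ident_comp [simp]: "\<lbrakk>f \<in> Arr C; Cod C f = Y\<rbrakk> \<Longrightarrow> \<i>\<d> Y \<cdot> f = f"
  using id_comp by (auto simp: Hom_iff)

lemma comp_ident [simp]: "\<lbrakk>f \<in> Arr C; Dom C f = X\<rbrakk> \<Longrightarrow> f \<cdot> \<i>\<d> X = f"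
  using comp_id by (auto simp: Hom_iff)

lemma comp_assoc_arr [simp]:
  "\<lbrakk>f \<in> Arr C; g \<in> Arr C; h \<in> Arr C; Cod C f = Dom C g; Cod C g = Dom C h\<rbrakk>
    \<Longrightarrow> (h \<cdot> g) \<cdot> f = h \<cdot> g \<cdot> f"
  using comp_assoc[of h "Dom C h" "Cod C h" g "Dom C g" f "Dom C f"] by (auto simp: Hom_iff)

text \<open>Composites are normalized to right-nested form, where a known equation
  \<open>g \<cdot> f = k\<close> no longer matches once something follows \<open>f\<close>. This
  version rewrites with it in front of a tail \<open>w\<close>.\<close>

lemma comp_reassoc:
  "\<lbrakk>g \<cdot> f = k; f \<in> Arr C; g \<in> Arr C; w \<in> Arr C; Cod C f = Dom C g; Cod C w = Dom C f\<rbrakk>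
    \<Longrightarrow> g \<cdot> f \<cdot> w = k \<cdot> w"
  by auto

lemma iso_inverse:
  assumes "is_iso C f"
  shows "inverse_arrows C f (arr_inv C f)"
proof -
  obtain g where g: "inverse_arrows C f g"
    using assms by (auto simp: is_iso_def)
  have "h = g" if "inverse_arrows C f h" for h
  proof -
    have "h \<cdot> f \<cdot> g = (h \<cdot> f) \<cdot> g"
      using g that by (intro comp_assoc_arr[symmetric]) (simp_all add: inverse_arrows_def Hom_iff)
    then show ?thesis
      using g that by (simp add: inverse_arrows_def Hom_iff)
  qed
  with g show ?thesis
    unfolding arr_inv_def by (rule theI2) auto
qed

lemma iso_inv_arr [simp]:
  assumes "is_iso C f"
  shows "f \<in> Arr C" "arr_inv C f \<in> Arr C" "Dom C (arr_inv C f) = Cod C f"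
    "Cod C (arr_inv C f) = Dom C f" "arr_inv C f \<cdot> f = \<i>\<d> (Dom C f)"
    "f \<cdot> arr_inv C f = \<i>\<d> (Cod C f)"
  using iso_inverse[OF assms] by (auto simp: inverse_arrows_def Hom_iff)

lemma iso_inv_comp [simp]:
  assumes "is_iso C f" "w \<in> Arr C"
  shows "Cod C w = Dom C f \<Longrightarrow> arr_inv C f \<cdot> f \<cdot> w = w"
    "Cod C w = Cod C f \<Longrightarrow> f \<cdot> arr_inv C f \<cdot> w = w"
  using assms by (simp_all add: comp_reassoc)

lemma iso_cancel_right:
  assumes "is_iso C f" "g \<cdot> f = h \<cdot> f" "g \<in> Arr C" "h \<in> Arr C" "Dom C g = Cod C f" "Dom C h = Cod C f"
  shows "g = h"
proof -
  have "g = (g \<cdot> f) \<cdot> arr_inv C f" "h = (h \<cdot> f) \<cdot> arr_inv C f"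
    using assms(1,3-) by simp_all
  then show ?thesis
    using assms(2) by simp
qed

lemma iso_cancel_left:
  assumes "is_iso C f" "f \<cdot> g = f \<cdot> h" "g \<in> Arr C" "h \<in> Arr C" "Cod C g = Dom C f" "Cod C h = Dom C f"
  shows "g = h"
proof -
  have "g = arr_inv C f \<cdot> f \<cdot> g" "h = arr_inv C f \<cdot> f \<cdot> h"
    using assms(1,3-) by simp_all
  then show ?thesis
    using assms(2) by simp
qed

lemma epi_cancel:
  "\<lbrakk>is_epi C f; g \<cdot> f = h \<cdot> f; g \<in> Arr C; h \<in> Arr C; Dom C g = Cod C f; Dom C h = Cod C f;
    Cod C g = Cod C h\<rbrakk> \<Longrightarrow> g = h"
  by (auto simp: is_epi_def Hom_iff)

lemma epi_comp:
  assumes "is_epi C f" "is_epi C g" "Cod C f = Dom C g"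
  shows "is_epi C (g \<cdot> f)"
  unfolding is_epi_def
proof (intro conjI allI ballI impI)
  have [simp]: "f \<in> Arr C" "g \<in> Arr C"
    using assms by (auto simp: is_epi_def)
  show "g \<cdot> f \<in> Arr C"
    using assms by simp
  fix W h k
  assume "h \<in> Hom C (Cod C (g \<cdot> f)) W" "k \<in> Hom C (Cod C (g \<cdot> f)) W" "h \<cdot> g \<cdot> f = k \<cdot> g \<cdot> f"
  then show "h = k"
    using assms epi_cancel[of f "h \<cdot> g" "k \<cdot> g"] epi_cancel[of g h k] by (simp add: Hom_iff)
qed

end

section \<open>Arithmetic of arrows in a preadditive category, kernels and cokernels\<close>

context preadditive_category
begin

text \<open>Naming the inverse turns each difference into a sum, so that associative-commutative
  rewriting applies; the hom-group is recovered from the arrow itself.\<close>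

definition neg :: "'a \<Rightarrow> 'a" where
  "neg f = m_inv (hom_group C (Dom C f) (Cod C f)) f"

lemma arr_diff_eq: "f \<ominus>\<^sub>a g = f \<oplus>\<^sub>a neg g"
  by (simp add: arr_diff_def neg_def)

lemma comm_group_hom [simp]:
  "\<lbrakk>X \<in> Obj C; Y \<in> Obj C\<rbrakk> \<Longrightarrow> comm_group (hom_group C X Y)"
  by (rule hom_comm_group)

lemma plus_typing [simp]:
  assumes "f \<in> Arr C" "g \<in> Arr C" "Dom C f = Dom C g" "Cod C f = Cod C g"
  shows "f \<oplus>\<^sub>a g \<in> Arr C" "Dom C (f \<oplus>\<^sub>a g) = Dom C g" "Cod C (f \<oplus>\<^sub>a g) = Cod C g"
proof -
  interpret G: comm_group "hom_group C (Dom C f) (Cod C f)"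
    using assms by simp
  have "f \<oplus>\<^sub>a g \<in> Hom C (Dom C f) (Cod C f)"
    using G.m_closed[of f g] assms by (simp add: hom_group_def Hom_iff)
  then show "f \<oplus>\<^sub>a g \<in> Arr C" "Dom C (f \<oplus>\<^sub>a g) = Dom C g" "Cod C (f \<oplus>\<^sub>a g) = Cod C g"
    using assms by (auto simp: Hom_iff)
qed

lemma zero_typing [simp]:
  assumes "X \<in> Obj C" "Y \<in> Obj C"
  shows "\<zero>\<^sub>a X Y \<in> Arr C" "Dom C (\<zero>\<^sub>a X Y) = X" "Cod C (\<zero>\<^sub>a X Y) = Y"
proof -
  interpret G: comm_group "hom_group C X Y"
    using assms by simp
  have "\<zero>\<^sub>a X Y \<in> Hom C X Y"
    using G.one_closed by (simp add: hom_group_def)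
  then show "\<zero>\<^sub>a X Y \<in> Arr C" "Dom C (\<zero>\<^sub>a X Y) = X" "Cod C (\<zero>\<^sub>a X Y) = Y"
    by (auto simp: Hom_iff)
qed

lemma neg_typing [simp]:
  assumes "f \<in> Arr C"
  shows "neg f \<in> Arr C" "Dom C (neg f) = Dom C f" "Cod C (neg f) = Cod C f"
proof -
  interpret G: comm_group "hom_group C (Dom C f) (Cod C f)"
    using assms by simp
  have "neg f \<in> Hom C (Dom C f) (Cod C f)"
    using G.inv_closed[of f] assms by (simp add: neg_def hom_group_def Hom_iff)
  then show "neg f \<in> Arr C" "Dom C (neg f) = Dom C f" "Cod C (neg f) = Cod C f"
    by (auto simp: Hom_iff)
qed

lemma plus_assoc:
  assumes "f \<in> Arr C" "g \<in> Arr C" "h \<in> Arr C" "Dom C f = Dom C g" "Cod C f = Cod C g"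
    "Dom C g = Dom C h" "Cod C g = Cod C h"
  shows "(f \<oplus>\<^sub>a g) \<oplus>\<^sub>a h = f \<oplus>\<^sub>a (g \<oplus>\<^sub>a h)"
proof -
  interpret G: comm_group "hom_group C (Dom C f) (Cod C f)"
    using assms by simp
  show ?thesis
    using G.m_assoc[of f g h] assms by (simp add: hom_group_def Hom_iff)
qed

lemma plus_comm:
  assumes "f \<in> Arr C" "g \<in> Arr C" "Dom C f = Dom C g" "Cod C f = Cod C g"
  shows "f \<oplus>\<^sub>a g = g \<oplus>\<^sub>a f"
proof -
  interpret G: comm_group "hom_group C (Dom C f) (Cod C f)"
    using assms by simp
  show ?thesis
    using G.m_comm[of f g] assms by (simp add: hom_group_def Hom_iff)
qed

lemma plus_lcomm:
  assumes "f \<in> Arr C" "g \<in> Arr C" "h \<in> Arr C" "Dom C f = Dom C g" "Cod C f = Cod C g"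
    "Dom C g = Dom C h" "Cod C g = Cod C h"
  shows "f \<oplus>\<^sub>a (g \<oplus>\<^sub>a h) = g \<oplus>\<^sub>a (f \<oplus>\<^sub>a h)"
  using assms plus_assoc[of f g h] plus_assoc[of g f h] plus_comm[of f g] by simp

lemmas plus_ac = plus_assoc plus_comm plus_lcomm

lemma plus_cancel [simp]:
  assumes "f \<in> Arr C" "g \<in> Arr C" "h \<in> Arr C" "Dom C f = Dom C g" "Cod C f = Cod C g"
    "Dom C h = Dom C g" "Cod C h = Cod C g"
  shows "f \<oplus>\<^sub>a g = f \<oplus>\<^sub>a h \<longleftrightarrow> g = h" "g \<oplus>\<^sub>a f = h \<oplus>\<^sub>a f \<longleftrightarrow> g = h"
proof -
  interpret G: comm_group "hom_group C (Dom C f) (Cod C f)"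
    using assms by simp
  show "f \<oplus>\<^sub>a g = f \<oplus>\<^sub>a h \<longleftrightarrow> g = h" "g \<oplus>\<^sub>a f = h \<oplus>\<^sub>a f \<longleftrightarrow> g = h"
    using G.right_cancel[of f g h] G.m_comm[of f g] G.m_comm[of f h] assms
    by (auto simp: hom_group_def Hom_iff)
qed

lemma plus_zero [simp]:
  assumes "f \<in> Arr C" "Dom C f = X" "Cod C f = Y"
  shows "f \<oplus>\<^sub>a \<zero>\<^sub>a X Y = f" "\<zero>\<^sub>a X Y \<oplus>\<^sub>a f = f"
proof -
  interpret G: comm_group "hom_group C X Y"
    using assms by auto
  show "f \<oplus>\<^sub>a \<zero>\<^sub>a X Y = f" "\<zero>\<^sub>a X Y \<oplus>\<^sub>a f = f"
    using G.l_one[of f] G.r_one[of f] assms by (simp_all add: hom_group_def Hom_iff)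
qed

lemma plus_neg [simp]:
  assumes "f \<in> Arr C"
  shows "f \<oplus>\<^sub>a neg f = \<zero>\<^sub>a (Dom C f) (Cod C f)" "neg f \<oplus>\<^sub>a f = \<zero>\<^sub>a (Dom C f) (Cod C f)"
proof -
  interpret G: comm_group "hom_group C (Dom C f) (Cod C f)"
    using assms by simp
  show "f \<oplus>\<^sub>a neg f = \<zero>\<^sub>a (Dom C f) (Cod C f)" "neg f \<oplus>\<^sub>a f = \<zero>\<^sub>a (Dom C f) (Cod C f)"
    using G.l_inv[of f] G.r_inv[of f] assms by (simp_all add: neg_def hom_group_def Hom_iff)
qed

lemma diff_eq_iff:
  assumes "f \<in> Arr C" "g \<in> Arr C" "h \<in> Arr C" "Dom C f = Dom C g" "Cod C f = Cod C g"
    "Dom C h = Dom C g" "Cod C h = Cod C g"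
  shows "f \<oplus>\<^sub>a neg g = h \<longleftrightarrow> f = h \<oplus>\<^sub>a g"
proof -
  have "(f \<oplus>\<^sub>a neg g) \<oplus>\<^sub>a g = f"
    using assms by (simp add: plus_assoc)
  then show ?thesis
    using plus_cancel(2)[of g "f \<oplus>\<^sub>a neg g" h] assms by (metis neg_typing plus_typing)
qed

lemma diff_zero_iff:
  assumes "f \<in> Arr C" "g \<in> Arr C" "Dom C f = Dom C g" "Cod C f = Cod C g"
    "X = Dom C g" "Y = Cod C g"
  shows "f \<oplus>\<^sub>a neg g = \<zero>\<^sub>a X Y \<longleftrightarrow> f = g"
  using diff_eq_iff[of f g "\<zero>\<^sub>a (Dom C g) (Cod C g)"] assms by simp

lemma comp_plus [simp]:
  assumes "f \<in> Arr C" "g \<in> Arr C" "h \<in> Arr C" "Dom C f = Dom C g" "Cod C f = Cod C g"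
  shows "Cod C g = Dom C h \<Longrightarrow> h \<cdot> (f \<oplus>\<^sub>a g) = h \<cdot> f \<oplus>\<^sub>a h \<cdot> g"
    "Cod C h = Dom C g \<Longrightarrow> (f \<oplus>\<^sub>a g) \<cdot> h = f \<cdot> h \<oplus>\<^sub>a g \<cdot> h"
  using assms comp_add_right[of h "Dom C h" "Cod C h" f "Dom C f" g]
    comp_add_left[of f "Dom C f" "Cod C f" g h "Dom C h"] by (simp_all add: Hom_iff)

text \<open>The only idempotent of a group is its neutral element. Hence an additive operation
  preserves zero; this is applied to composition, to the tensor product and to
  \<open>hoch_b1\<close>.\<close>

lemma eq_zero_if_double:
  assumes "f \<in> Arr C" "f \<oplus>\<^sub>a f = f" "Dom C f = X" "Cod C f = Y"
  shows "f = \<zero>\<^sub>a X Y"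
proof -
  have "f \<oplus>\<^sub>a f = f \<oplus>\<^sub>a \<zero>\<^sub>a X Y"
    using assms by simp
  then show ?thesis
    using plus_cancel(1)[of f f "\<zero>\<^sub>a X Y"] assms(1,3,4) by auto
qed

lemma comp_zero [simp]:
  assumes "f \<in> Arr C" "W \<in> Obj C"
  shows "Dom C f = X \<Longrightarrow> f \<cdot> \<zero>\<^sub>a W X = \<zero>\<^sub>a W (Cod C f)"
    "Cod C f = X \<Longrightarrow> \<zero>\<^sub>a X W \<cdot> f = \<zero>\<^sub>a (Dom C f) W"
proof -
  have *: "\<zero>\<^sub>a U V \<oplus>\<^sub>a \<zero>\<^sub>a U V = \<zero>\<^sub>a U V" if "U \<in> Obj C" "V \<in> Obj C" for U V
    using that by simp
  show "f \<cdot> \<zero>\<^sub>a W X = \<zero>\<^sub>a W (Cod C f)" if "Dom C f = X"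
    using comp_plus(1)[of "\<zero>\<^sub>a W X" "\<zero>\<^sub>a W X" f] that assms
    by (auto intro!: eq_zero_if_double simp: * simp del: comp_plus)
  show "\<zero>\<^sub>a X W \<cdot> f = \<zero>\<^sub>a (Dom C f) W" if "Cod C f = X"
    using comp_plus(2)[of "\<zero>\<^sub>a X W" "\<zero>\<^sub>a X W" f] that assms
    by (auto intro!: eq_zero_if_double simp: * simp del: comp_plus)
qed

lemma eq_negI:
  assumes "f \<in> Arr C" "g \<in> Arr C" "Dom C f = Dom C g" "Cod C f = Cod C g"
    "f \<oplus>\<^sub>a g = \<zero>\<^sub>a (Dom C g) (Cod C g)"
  shows "f = neg g"
  using plus_cancel(2)[of g f "neg g"] assms by simp

lemma comp_neg [simp]:
  assumes "f \<in> Arr C" "g \<in> Arr C" "Cod C f = Dom C g"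
  shows "g \<cdot> neg f = neg (g \<cdot> f)" "neg g \<cdot> f = neg (g \<cdot> f)"
proof -
  show "g \<cdot> neg f = neg (g \<cdot> f)"
    using assms comp_plus(1)[of "neg f" f g] by (intro eq_negI) (simp_all del: comp_plus)
  show "neg g \<cdot> f = neg (g \<cdot> f)"
    using assms comp_plus(2)[of "neg g" g f] by (intro eq_negI) (simp_all del: comp_plus)
qed

lemma neg_zero [simp]: "\<lbrakk>X \<in> Obj C; Y \<in> Obj C\<rbrakk> \<Longrightarrow> neg (\<zero>\<^sub>a X Y) = \<zero>\<^sub>a X Y"
  using eq_negI[of "\<zero>\<^sub>a X Y" "\<zero>\<^sub>a X Y"] by simp

lemma neg_neg [simp]: "f \<in> Arr C \<Longrightarrow> neg (neg f) = f"
  using eq_negI[of f "neg f"] by simp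

lemma neg_plus [simp]:
  assumes "f \<in> Arr C" "g \<in> Arr C" "Dom C f = Dom C g" "Cod C f = Cod C g"
  shows "neg (f \<oplus>\<^sub>a g) = neg f \<oplus>\<^sub>a neg g"
proof -
  have "(neg f \<oplus>\<^sub>a neg g) \<oplus>\<^sub>a (f \<oplus>\<^sub>a g) = (neg f \<oplus>\<^sub>a f) \<oplus>\<^sub>a (neg g \<oplus>\<^sub>a g)"
    using assms by (simp add: plus_ac del: plus_neg)
  then show ?thesis
    using assms by (intro eq_negI[symmetric]) simp_all
qed

lemma kernel_typing:
  assumes "is_kernel C i p"
  shows "i \<in> Arr C" "p \<in> Arr C" "Cod C i = Dom C p" "p \<cdot> i = \<zero>\<^sub>a (Dom C i) (Cod C p)"
  using assms by (auto simp: is_kernel_def)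

lemma kernel_factor:
  assumes "is_kernel C i p" "p \<cdot> f = \<zero>\<^sub>a (Dom C f) (Cod C p)" "f \<in> Arr C" "Cod C f = Dom C p"
  obtains h where "h \<in> Arr C" "Dom C h = Dom C f" "Cod C h = Dom C i" "i \<cdot> h = f"
proof -
  have "f \<in> Hom C (Dom C f) (Dom C p)"
    using assms by (simp add: Hom_iff)
  then have "\<exists>!h. h \<in> Hom C (Dom C f) (Dom C i) \<and> i \<cdot> h = f"
    using assms(1,2) unfolding is_kernel_def by blast
  then show ?thesis
    using that by (auto simp: Hom_iff)
qed

lemma kernel_cancel:
  assumes "is_kernel C i p" "i \<cdot> f = i \<cdot> g" "f \<in> Arr C" "g \<in> Arr C"
    "Cod C f = Dom C i" "Cod C g = Dom C i" "Dom C f = Dom C g"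
  shows "f = g"
proof -
  note [simp] = kernel_typing[OF assms(1)]
  have "i \<cdot> f \<in> Hom C (Dom C f) (Dom C p)" "p \<cdot> i \<cdot> f = \<zero>\<^sub>a (Dom C f) (Cod C p)"
    using assms by (simp_all add: Hom_iff comp_reassoc)
  then have "\<exists>!h. h \<in> Hom C (Dom C f) (Dom C i) \<and> i \<cdot> h = i \<cdot> f"
    using assms(1) unfolding is_kernel_def by blast
  then show ?thesis
    using assms by (auto simp: Hom_iff)
qed

lemma cokernel_typing:
  assumes "is_cokernel C c f"
  shows "c \<in> Arr C" "f \<in> Arr C" "Dom C c = Cod C f" "c \<cdot> f = \<zero>\<^sub>a (Dom C f) (Cod C c)"
  using assms by (auto simp: is_cokernel_def)

lemma cokernel_factor:
  assumes "is_cokernel C c f" "g \<cdot> f = \<zero>\<^sub>a (Dom C f) (Cod C g)" "g \<in> Arr C" "Dom C g = Cod C f"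
  obtains h where "h \<in> Arr C" "Dom C h = Cod C c" "Cod C h = Cod C g" "h \<cdot> c = g"
proof -
  have "g \<in> Hom C (Cod C f) (Cod C g)"
    using assms by (simp add: Hom_iff)
  then have "\<exists>!h. h \<in> Hom C (Cod C c) (Cod C g) \<and> h \<cdot> c = g"
    using assms(1,2) unfolding is_cokernel_def by blast
  then show ?thesis
    using that by (auto simp: Hom_iff)
qed

lemma cokernel_epi:
  assumes "is_cokernel C c f"
  shows "is_epi C c"
  unfolding is_epi_def
proof (intro conjI allI ballI impI)
  note [simp] = cokernel_typing[OF assms]
  show "c \<in> Arr C" by simp
  fix W g h
  assume gh: "g \<in> Hom C (Cod C c) W" "h \<in> Hom C (Cod C c) W" "g \<cdot> c = h \<cdot> c"
  then have "g \<cdot> c \<in> Hom C (Cod C f) W" "(g \<cdot> c) \<cdot> f = \<zero>\<^sub>a (Dom C f) W"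
    by (auto simp: Hom_iff)
  then have "\<exists>!k. k \<in> Hom C (Cod C c) W \<and> k \<cdot> c = g \<cdot> c"
    using assms unfolding is_cokernel_def by blast
  then show "g = h"
    using gh by (auto simp: Hom_iff)
qed

end

section \<open>Images and cokernels in an abelian category\<close>

context abelian_category
begin

lemma ker_arr_kernel: "f \<in> Arr C \<Longrightarrow> is_kernel C (ker_arr C f) f"
  unfolding ker_arr_def by (rule someI_ex) (rule ex_kernel)

lemma coker_arr_cokernel: "f \<in> Arr C \<Longrightarrow> is_cokernel C (coker_arr C f) f"
  unfolding coker_arr_def by (rule someI_ex) (rule ex_cokernel)

text \<open>An arrow kills \<open>f\<close> iff it factors through the cokernel of \<open>f\<close>,
  iff it kills the kernel of that cokernel, which is the image. So vanishing on an ideal presented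
  as an image can be tested on the arrow \<open>f\<close> that generates it.\<close>

lemma coker_image_cokernel:
  assumes "f \<in> Arr C"
  shows "is_cokernel C (coker_arr C (image_arr C f)) f"
proof -
  define c where "c = coker_arr C f"
  have c: "is_cokernel C c f"
    unfolding c_def using assms by (rule coker_arr_cokernel)
  note [simp] = cokernel_typing[OF c]
  define i where "i = ker_arr C c"
  have i: "is_kernel C i c"
    unfolding i_def by (rule ker_arr_kernel) simp
  note [simp] = kernel_typing[OF i]
  define p where "p = coker_arr C i"
  have p: "is_cokernel C p i"
    unfolding p_def by (rule coker_arr_cokernel) simp
  note [simp] = cokernel_typing[OF p]
  obtain f' where [simp]: "f' \<in> Arr C" "Dom C f' = Dom C f" "Cod C f' = Dom C i" and f': "i \<cdot> f' = f"
    using kernel_factor[OF i, of f] by auto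
  have "p \<cdot> i \<cdot> f' = \<zero>\<^sub>a (Dom C f) (Cod C p)"
    by (simp add: comp_reassoc)
  then have pf: "p \<cdot> f = \<zero>\<^sub>a (Dom C f) (Cod C p)"
    by (simp add: f')
  have "\<exists>!h. h \<in> Hom C (Cod C p) W \<and> h \<cdot> p = g"
    if g: "g \<in> Hom C (Cod C f) W" "g \<cdot> f = \<zero>\<^sub>a (Dom C f) W" for g W
  proof -
    have [simp]: "g \<in> Arr C" "Dom C g = Cod C f" "Cod C g = W"
      using g by (auto simp: Hom_iff)
    have [simp]: "W \<in> Obj C"
      using dom_cod_Obj(2)[of g] by simp
    obtain g' where [simp]: "g' \<in> Arr C" "Dom C g' = Cod C c" "Cod C g' = W" and g': "g' \<cdot> c = g"
      using cokernel_factor[OF c, of g] g by auto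
    have "g \<cdot> i = \<zero>\<^sub>a (Dom C i) W"
      unfolding g'[symmetric] by simp
    then obtain h where h: "h \<in> Arr C" "Dom C h = Cod C p" "Cod C h = W" "h \<cdot> p = g"
      using cokernel_factor[OF p, of g] by auto
    show ?thesis
    proof (rule ex1I[of _ h])
      show "h \<in> Hom C (Cod C p) W \<and> h \<cdot> p = g"
        using h by (simp add: Hom_iff)
      show "k = h" if "k \<in> Hom C (Cod C p) W \<and> k \<cdot> p = g" for k
        using epi_cancel[OF cokernel_epi[OF p], of k h] h that by (simp add: Hom_iff)
    qed
  qed
  then have "is_cokernel C p f"
    unfolding is_cokernel_def by (simp add: pf)
  then show ?thesis
    by (simp add: p_def i_def c_def image_arr_def)
qed

end

section \<open>Monoidal categories\<close>

context monoidal_category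
begin

declare unit_Obj [simp] tens_Obj [simp] assoc_iso [simp] lunit_iso [simp] runit_iso [simp]
  tens_id [simp]

lemma tens_typing [simp]:
  assumes "f \<in> Arr C" "g \<in> Arr C"
  shows "f \<otimes>\<^sub>a g \<in> Arr C" "Dom C (f \<otimes>\<^sub>a g) = Dom C f \<otimes>\<^sub>o Dom C g"
    "Cod C (f \<otimes>\<^sub>a g) = Cod C f \<otimes>\<^sub>o Cod C g"
  using tens_Hom[of f "Dom C f" "Cod C f" g "Dom C g" "Cod C g"] assms by (auto simp: Hom_iff)

lemma assoc_typing [simp]:
  assumes "X \<in> Obj C" "Y \<in> Obj C" "Z \<in> Obj C"
  shows "\<alpha> X Y Z \<in> Arr C" "Dom C (\<alpha> X Y Z) = (X \<otimes>\<^sub>o Y) \<otimes>\<^sub>o Z"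
    "Cod C (\<alpha> X Y Z) = X \<otimes>\<^sub>o (Y \<otimes>\<^sub>o Z)"
  using assoc_Hom[OF assms] by (auto simp: Hom_iff)

lemma lunit_typing [simp]:
  assumes "X \<in> Obj C"
  shows "\<l> X \<in> Arr C" "Dom C (\<l> X) = \<I> \<otimes>\<^sub>o X" "Cod C (\<l> X) = X"
  using lunit_Hom[OF assms] by (auto simp: Hom_iff)

lemma runit_typing [simp]:
  assumes "X \<in> Obj C"
  shows "\<r> X \<in> Arr C" "Dom C (\<r> X) = X \<otimes>\<^sub>o \<I>" "Cod C (\<r> X) = X"
  using runit_Hom[OF assms] by (auto simp: Hom_iff)

lemma tens_merge [simp]:
  assumes "f \<in> Arr C" "g \<in> Arr C" "f' \<in> Arr C" "g' \<in> Arr C" "Cod C f = Dom C g" "Cod C f' = Dom C g'"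
  shows "(g \<otimes>\<^sub>a g') \<cdot> (f \<otimes>\<^sub>a f') = (g \<cdot> f) \<otimes>\<^sub>a (g' \<cdot> f')"
    "\<lbrakk>w \<in> Arr C; Cod C w = Dom C f \<otimes>\<^sub>o Dom C f'\<rbrakk>
      \<Longrightarrow> (g \<otimes>\<^sub>a g') \<cdot> (f \<otimes>\<^sub>a f') \<cdot> w = ((g \<cdot> f) \<otimes>\<^sub>a (g' \<cdot> f')) \<cdot> w"
proof -
  show *: "(g \<otimes>\<^sub>a g') \<cdot> (f \<otimes>\<^sub>a f') = (g \<cdot> f) \<otimes>\<^sub>a (g' \<cdot> f')"
    using tens_comp[of g "Dom C g" "Cod C g" f "Dom C f" g' "Dom C g'" "Cod C g'" f' "Dom C f'"] assms
    by (simp add: Hom_iff)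
  show "(g \<otimes>\<^sub>a g') \<cdot> (f \<otimes>\<^sub>a f') \<cdot> w = ((g \<cdot> f) \<otimes>\<^sub>a (g' \<cdot> f')) \<cdot> w"
    if "w \<in> Arr C" "Cod C w = Dom C f \<otimes>\<^sub>o Dom C f'"
    using * that assms by (intro comp_reassoc) simp_all
qed

lemma assoc_nat [simp]:
  assumes "f \<in> Arr C" "g \<in> Arr C" "h \<in> Arr C" "Cod C f = X" "Cod C g = Y" "Cod C h = Z"
  shows "\<alpha> X Y Z \<cdot> ((f \<otimes>\<^sub>a g) \<otimes>\<^sub>a h) = (f \<otimes>\<^sub>a (g \<otimes>\<^sub>a h)) \<cdot> \<alpha> (Dom C f) (Dom C g) (Dom C h)"
    "\<lbrakk>w \<in> Arr C; Cod C w = (Dom C f \<otimes>\<^sub>o Dom C g) \<otimes>\<^sub>o Dom C h\<rbrakk>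
      \<Longrightarrow> \<alpha> X Y Z \<cdot> ((f \<otimes>\<^sub>a g) \<otimes>\<^sub>a h) \<cdot> w
        = (f \<otimes>\<^sub>a (g \<otimes>\<^sub>a h)) \<cdot> \<alpha> (Dom C f) (Dom C g) (Dom C h) \<cdot> w"
proof -
  have [simp]: "X \<in> Obj C" "Y \<in> Obj C" "Z \<in> Obj C"
    using assms by auto
  show *: "\<alpha> X Y Z \<cdot> ((f \<otimes>\<^sub>a g) \<otimes>\<^sub>a h)
      = (f \<otimes>\<^sub>a (g \<otimes>\<^sub>a h)) \<cdot> \<alpha> (Dom C f) (Dom C g) (Dom C h)"
    using assms by (intro assoc_natural) (simp_all add: Hom_iff)
  show "\<alpha> X Y Z \<cdot> ((f \<otimes>\<^sub>a g) \<otimes>\<^sub>a h) \<cdot> w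
        = (f \<otimes>\<^sub>a (g \<otimes>\<^sub>a h)) \<cdot> \<alpha> (Dom C f) (Dom C g) (Dom C h) \<cdot> w"
    if "w \<in> Arr C" "Cod C w = (Dom C f \<otimes>\<^sub>o Dom C g) \<otimes>\<^sub>o Dom C h"
    using comp_reassoc[OF *] that assms by simp
qed

text \<open>Since \<open>tens_id\<close> fuses two tensored identities into one, the pattern of
  \<open>assoc_nat\<close> gets lost; this instance restores it.\<close>

lemma assoc_nat_ident [simp]:
  assumes "h \<in> Arr C" "X \<in> Obj C" "Y \<in> Obj C" "Cod C h = Z"
  shows "\<alpha> X Y Z \<cdot> (\<i>\<d> (X \<otimes>\<^sub>o Y) \<otimes>\<^sub>a h) = (\<i>\<d> X \<otimes>\<^sub>a (\<i>\<d> Y \<otimes>\<^sub>a h)) \<cdot> \<alpha> X Y (Dom C h)"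
  using assoc_nat(1)[of "\<i>\<d> X" "\<i>\<d> Y" h X Y Z] assms by simp

lemma lunit_nat [simp]:
  assumes "f \<in> Arr C" "Cod C f = Y"
  shows "\<l> Y \<cdot> (\<i>\<d> \<I> \<otimes>\<^sub>a f) = f \<cdot> \<l> (Dom C f)"
    "\<lbrakk>w \<in> Arr C; Cod C w = \<I> \<otimes>\<^sub>o Dom C f\<rbrakk> \<Longrightarrow> \<l> Y \<cdot> (\<i>\<d> \<I> \<otimes>\<^sub>a f) \<cdot> w = f \<cdot> \<l> (Dom C f) \<cdot> w"
proof -
  have [simp]: "Y \<in> Obj C"
    using assms by auto
  show *: "\<l> Y \<cdot> (\<i>\<d> \<I> \<otimes>\<^sub>a f) = f \<cdot> \<l> (Dom C f)"
    using assms by (intro lunit_natural) (simp add: Hom_iff)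
  show "\<l> Y \<cdot> (\<i>\<d> \<I> \<otimes>\<^sub>a f) \<cdot> w = f \<cdot> \<l> (Dom C f) \<cdot> w"
    if "w \<in> Arr C" "Cod C w = \<I> \<otimes>\<^sub>o Dom C f"
    using comp_reassoc[OF *] that assms by simp
qed

lemma runit_nat [simp]:
  assumes "f \<in> Arr C" "Cod C f = Y"
  shows "\<r> Y \<cdot> (f \<otimes>\<^sub>a \<i>\<d> \<I>) = f \<cdot> \<r> (Dom C f)"
    "\<lbrakk>w \<in> Arr C; Cod C w = Dom C f \<otimes>\<^sub>o \<I>\<rbrakk> \<Longrightarrow> \<r> Y \<cdot> (f \<otimes>\<^sub>a \<i>\<d> \<I>) \<cdot> w = f \<cdot> \<r> (Dom C f) \<cdot> w"
proof -
  have [simp]: "Y \<in> Obj C"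
    using assms by auto
  show *: "\<r> Y \<cdot> (f \<otimes>\<^sub>a \<i>\<d> \<I>) = f \<cdot> \<r> (Dom C f)"
    using assms by (intro runit_natural) (simp add: Hom_iff)
  show "\<r> Y \<cdot> (f \<otimes>\<^sub>a \<i>\<d> \<I>) \<cdot> w = f \<cdot> \<r> (Dom C f) \<cdot> w"
    if "w \<in> Arr C" "Cod C w = Dom C f \<otimes>\<^sub>o \<I>"
    using comp_reassoc[OF *] that assms by simp
qed

text \<open>The unit constraints are natural isomorphisms from tensoring with \<open>\<I>\<close> to
  the identity functor. Kelly's argument obtains its equations only after tensoring with
  \<open>\<I>\<close>, and this removes that factor.\<close>

lemma unit_tens_faithful:
  assumes "f \<in> Arr C" "g \<in> Arr C" "Dom C f = Dom C g" "Cod C f = Cod C g"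
  shows "\<i>\<d> \<I> \<otimes>\<^sub>a f = \<i>\<d> \<I> \<otimes>\<^sub>a g \<Longrightarrow> f = g" "f \<otimes>\<^sub>a \<i>\<d> \<I> = g \<otimes>\<^sub>a \<i>\<d> \<I> \<Longrightarrow> f = g"
proof -
  assume "\<i>\<d> \<I> \<otimes>\<^sub>a f = \<i>\<d> \<I> \<otimes>\<^sub>a g"
  then have "f \<cdot> \<l> (Dom C f) = g \<cdot> \<l> (Dom C f)"
    using lunit_nat(1)[of f "Cod C f"] lunit_nat(1)[of g "Cod C g"] assms by simp
  then show "f = g"
    by (rule iso_cancel_right[rotated]) (use assms in simp_all)
next
  assume "f \<otimes>\<^sub>a \<i>\<d> \<I> = g \<otimes>\<^sub>a \<i>\<d> \<I>"
  then have "f \<cdot> \<r> (Dom C f) = g \<cdot> \<r> (Dom C f)"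
    using runit_nat(1)[of f "Cod C f"] runit_nat(1)[of g "Cod C g"] assms by simp
  then show "f = g"
    by (rule iso_cancel_right[rotated]) (use assms in simp_all)
qed

lemma tens_iso:
  assumes "is_iso C f" "X \<in> Obj C"
  shows "is_iso C (f \<otimes>\<^sub>a \<i>\<d> X)" "is_iso C (\<i>\<d> X \<otimes>\<^sub>a f)"
proof -
  have "inverse_arrows C (f \<otimes>\<^sub>a \<i>\<d> X) (arr_inv C f \<otimes>\<^sub>a \<i>\<d> X)"
    "inverse_arrows C (\<i>\<d> X \<otimes>\<^sub>a f) (\<i>\<d> X \<otimes>\<^sub>a arr_inv C f)"
    using assms by (simp_all add: inverse_arrows_def Hom_iff)
  then show "is_iso C (f \<otimes>\<^sub>a \<i>\<d> X)" "is_iso C (\<i>\<d> X \<otimes>\<^sub>a f)"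
    by (auto simp: is_iso_def)
qed

lemma iso_comp:
  assumes "is_iso C f" "is_iso C g" "Cod C f = Dom C g"
  shows "is_iso C (g \<cdot> f)"
proof -
  have "inverse_arrows C (g \<cdot> f) (arr_inv C f \<cdot> arr_inv C g)"
    using assms by (simp add: inverse_arrows_def Hom_iff)
  then show ?thesis
    by (auto simp: is_iso_def)
qed

text \<open>The next three lemmas are Kelly's: the remaining unit coherence laws follow from the
  pentagon and the triangle.\<close>

lemma lunit_tens:
  assumes [simp]: "X \<in> Obj C" "Y \<in> Obj C"
  shows "\<l> (X \<otimes>\<^sub>o Y) \<cdot> \<alpha> \<I> X Y = \<l> X \<otimes>\<^sub>a \<i>\<d> Y"
proof (rule unit_tens_faithful(1))
  \<comment> \<open>The two innermost arrows of the longer side of the pentagon at \<I>, \<I>,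
    \<open>X\<close>, \<open>Y\<close>. Their composite is invertible, so it can be cancelled at the
    end.\<close>
  let ?w = "\<alpha> \<I> (\<I> \<otimes>\<^sub>o X) Y \<cdot> (\<alpha> \<I> \<I> X \<otimes>\<^sub>a \<i>\<d> Y)"
  have "(\<i>\<d> \<I> \<otimes>\<^sub>a (\<l> (X \<otimes>\<^sub>o Y) \<cdot> \<alpha> \<I> X Y)) \<cdot> ?w
      = (\<i>\<d> \<I> \<otimes>\<^sub>a \<l> (X \<otimes>\<^sub>o Y)) \<cdot> (\<i>\<d> \<I> \<otimes>\<^sub>a \<alpha> \<I> X Y) \<cdot> ?w"
    by simp
  also have "\<dots> = (\<i>\<d> \<I> \<otimes>\<^sub>a \<l> (X \<otimes>\<^sub>o Y)) \<cdot> \<alpha> \<I> \<I> (X \<otimes>\<^sub>o Y) \<cdot> \<alpha> (\<I> \<otimes>\<^sub>o \<I>) X Y"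
    by (simp only: pentagon[symmetric] assms unit_Obj)
  also have "\<dots> = (\<r> \<I> \<otimes>\<^sub>a \<i>\<d> (X \<otimes>\<^sub>o Y)) \<cdot> \<alpha> (\<I> \<otimes>\<^sub>o \<I>) X Y"
    by (rule comp_reassoc[OF triangle]) simp_all
  also have "\<dots> = \<alpha> \<I> X Y \<cdot> ((\<r> \<I> \<otimes>\<^sub>a \<i>\<d> X) \<otimes>\<^sub>a \<i>\<d> Y)"
    by simp
  also have "\<dots> = \<alpha> \<I> X Y \<cdot> (((\<i>\<d> \<I> \<otimes>\<^sub>a \<l> X) \<cdot> \<alpha> \<I> \<I> X) \<otimes>\<^sub>a (\<i>\<d> Y \<cdot> \<i>\<d> Y))"
    by (simp add: triangle)
  also have "\<dots> = \<alpha> \<I> X Y \<cdot> ((\<i>\<d> \<I> \<otimes>\<^sub>a \<l> X) \<otimes>\<^sub>a \<i>\<d> Y) \<cdot> (\<alpha> \<I> \<I> X \<otimes>\<^sub>a \<i>\<d> Y)"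
    by (simp only: tens_merge(1)[symmetric] tens_typing assoc_typing ident_typing lunit_typing
        assms unit_Obj tens_Obj)
  also have "\<dots> = (\<i>\<d> \<I> \<otimes>\<^sub>a (\<l> X \<otimes>\<^sub>a \<i>\<d> Y)) \<cdot> ?w"
    by (subst assoc_nat(2)) simp_all
  finally show "\<i>\<d> \<I> \<otimes>\<^sub>a (\<l> (X \<otimes>\<^sub>o Y) \<cdot> \<alpha> \<I> X Y) = \<i>\<d> \<I> \<otimes>\<^sub>a (\<l> X \<otimes>\<^sub>a \<i>\<d> Y)"
    by (rule iso_cancel_right[rotated]) (simp_all add: iso_comp tens_iso)
qed simp_all

lemma runit_tens:
  assumes [simp]: "X \<in> Obj C" "Y \<in> Obj C"
  shows "(\<i>\<d> X \<otimes>\<^sub>a \<r> Y) \<cdot> \<alpha> X Y \<I> = \<r> (X \<otimes>\<^sub>o Y)"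
proof (rule unit_tens_faithful(2))
  have "\<alpha> X Y \<I> \<cdot> (((\<i>\<d> X \<otimes>\<^sub>a \<r> Y) \<cdot> \<alpha> X Y \<I>) \<otimes>\<^sub>a \<i>\<d> \<I>)
      = \<alpha> X Y \<I> \<cdot> ((\<i>\<d> X \<otimes>\<^sub>a \<r> Y) \<otimes>\<^sub>a \<i>\<d> \<I>) \<cdot> (\<alpha> X Y \<I> \<otimes>\<^sub>a \<i>\<d> \<I>)"
    by (subst tens_merge(1)) simp_all
  also have "\<dots> = (\<i>\<d> X \<otimes>\<^sub>a (\<r> Y \<otimes>\<^sub>a \<i>\<d> \<I>)) \<cdot> \<alpha> X (Y \<otimes>\<^sub>o \<I>) \<I> \<cdot> (\<alpha> X Y \<I> \<otimes>\<^sub>a \<i>\<d> \<I>)"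
    by (subst assoc_nat(2)) simp_all
  also have "\<dots> = (\<i>\<d> X \<otimes>\<^sub>a (\<i>\<d> Y \<otimes>\<^sub>a \<l> \<I>)) \<cdot> (\<i>\<d> X \<otimes>\<^sub>a \<alpha> Y \<I> \<I>) \<cdot> \<alpha> X (Y \<otimes>\<^sub>o \<I>) \<I>
      \<cdot> (\<alpha> X Y \<I> \<otimes>\<^sub>a \<i>\<d> \<I>)"
    by (simp add: triangle)
  also have "\<dots> = (\<i>\<d> X \<otimes>\<^sub>a (\<i>\<d> Y \<otimes>\<^sub>a \<l> \<I>)) \<cdot> \<alpha> X Y (\<I> \<otimes>\<^sub>o \<I>) \<cdot> \<alpha> (X \<otimes>\<^sub>o Y) \<I> \<I>"
    by (simp only: pentagon[symmetric] assms unit_Obj)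
  also have "\<dots> = ((\<i>\<d> X \<otimes>\<^sub>a (\<i>\<d> Y \<otimes>\<^sub>a \<l> \<I>)) \<cdot> \<alpha> X Y (\<I> \<otimes>\<^sub>o \<I>)) \<cdot> \<alpha> (X \<otimes>\<^sub>o Y) \<I> \<I>"
    by simp
  also have "\<dots> = (\<alpha> X Y \<I> \<cdot> (\<i>\<d> (X \<otimes>\<^sub>o Y) \<otimes>\<^sub>a \<l> \<I>)) \<cdot> \<alpha> (X \<otimes>\<^sub>o Y) \<I> \<I>"
    by simp
  also have "\<dots> = \<alpha> X Y \<I> \<cdot> (\<i>\<d> (X \<otimes>\<^sub>o Y) \<otimes>\<^sub>a \<l> \<I>) \<cdot> \<alpha> (X \<otimes>\<^sub>o Y) \<I> \<I>"
    by (rule comp_assoc_arr) simp_all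
  also have "\<dots> = \<alpha> X Y \<I> \<cdot> (\<r> (X \<otimes>\<^sub>o Y) \<otimes>\<^sub>a \<i>\<d> \<I>)"
    by (simp add: triangle)
  finally show "((\<i>\<d> X \<otimes>\<^sub>a \<r> Y) \<cdot> \<alpha> X Y \<I>) \<otimes>\<^sub>a \<i>\<d> \<I> = \<r> (X \<otimes>\<^sub>o Y) \<otimes>\<^sub>a \<i>\<d> \<I>"
    by (rule iso_cancel_left[rotated]) simp_all
qed simp_all

lemma lunit_unit: "\<l> \<I> = \<r> \<I>"
proof (rule unit_tens_faithful(2))
  \<comment> \<open>Naturality of \<open>\<l>\<close> at the arrow \<open>\<l> \<I>\<close> itself;
    cancelling \<open>\<l> \<I>\<close> lets \<open>lunit_tens\<close> be compared with the
    triangle.\<close>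
  have "\<l> \<I> \<cdot> \<l> (\<I> \<otimes>\<^sub>o \<I>) = \<l> \<I> \<cdot> (\<i>\<d> \<I> \<otimes>\<^sub>a \<l> \<I>)"
    by simp
  then have "\<l> (\<I> \<otimes>\<^sub>o \<I>) = \<i>\<d> \<I> \<otimes>\<^sub>a \<l> \<I>"
    by (rule iso_cancel_left[rotated]) simp_all
  then show "\<l> \<I> \<otimes>\<^sub>a \<i>\<d> \<I> = \<r> \<I> \<otimes>\<^sub>a \<i>\<d> \<I>"
    using lunit_tens[of \<I> \<I>] triangle[of \<I> \<I>] by simp
qed simp_all

text \<open>Arrows into an object are treated as generalized elements; \<open>bil t a b\<close> is the value of the
  pairing \<open>t\<close> at \<open>a\<close> and \<open>b\<close>. In this form (bi)module and algebra axioms hold for arbitrary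
  elements and the constraint \<open>\<alpha>\<close> only ever appears on the far right.\<close>

definition bil :: "'a \<Rightarrow> 'a \<Rightarrow> 'a \<Rightarrow> 'a" where
  "bil t a b = t \<cdot> (a \<otimes>\<^sub>a b)"

lemma bil_typing [simp]:
  assumes "t \<in> Arr C" "a \<in> Arr C" "b \<in> Arr C" "Dom C t = Cod C a \<otimes>\<^sub>o Cod C b"
  shows "bil t a b \<in> Arr C" "Dom C (bil t a b) = Dom C a \<otimes>\<^sub>o Dom C b" "Cod C (bil t a b) = Cod C t"
  using assms by (simp_all add: bil_def)

lemma bil_comp:
  assumes "t \<in> Arr C" "a \<in> Arr C" "b \<in> Arr C" "Dom C t = Cod C a \<otimes>\<^sub>o Cod C b"
    "x \<in> Arr C" "y \<in> Arr C" "Cod C x = Dom C a" "Cod C y = Dom C b"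
  shows "bil t a b \<cdot> (x \<otimes>\<^sub>a y) = bil t (a \<cdot> x) (b \<cdot> y)"
    "\<lbrakk>w \<in> Arr C; Cod C w = Dom C x \<otimes>\<^sub>o Dom C y\<rbrakk>
      \<Longrightarrow> bil t a b \<cdot> (x \<otimes>\<^sub>a y) \<cdot> w = bil t (a \<cdot> x) (b \<cdot> y) \<cdot> w"
  using assms by (simp_all add: bil_def)

lemma bil_bil:
  assumes "t \<in> Arr C" "a \<in> Arr C" "b \<in> Arr C" "Dom C t = Cod C a \<otimes>\<^sub>o Cod C b"
    "x \<in> Arr C" "y \<in> Arr C" "Cod C x = Dom C a" "Cod C y = Dom C b"
  shows "bil (bil t a b) x y = bil t (a \<cdot> x) (b \<cdot> y)"
  using assms by (simp add: bil_def)

lemma comp_bil: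
  assumes "t \<in> Arr C" "a \<in> Arr C" "b \<in> Arr C" "f \<in> Arr C" "Dom C t = Cod C a \<otimes>\<^sub>o Cod C b"
    "Dom C f = Cod C t"
  shows "f \<cdot> bil t a b = bil (f \<cdot> t) a b"
  using assms by (simp add: bil_def)

lemma bil_ident:
  assumes "t \<in> Arr C" "X \<in> Obj C" "Y \<in> Obj C" "Dom C t = X \<otimes>\<^sub>o Y"
  shows "bil t (\<i>\<d> X) (\<i>\<d> Y) = t"
  using assms by (simp add: bil_def)

text \<open>Four independent pairings are allowed so that the associativity of an algebra and the
  three associativity laws of a bimodule are all instances.\<close>

lemma bil_assoc:
  assumes "t1 \<cdot> (t2 \<otimes>\<^sub>a \<i>\<d> Z) = t3 \<cdot> (\<i>\<d> X \<otimes>\<^sub>a t4) \<cdot> \<alpha> X Y Z"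
    and "t1 \<in> Arr C" "t2 \<in> Arr C" "t3 \<in> Arr C" "t4 \<in> Arr C" "a \<in> Arr C" "b \<in> Arr C" "c \<in> Arr C"
    and "Cod C a = X" "Cod C b = Y" "Cod C c = Z" "Dom C t2 = X \<otimes>\<^sub>o Y" "Dom C t4 = Y \<otimes>\<^sub>o Z"
    and "Dom C t1 = Cod C t2 \<otimes>\<^sub>o Z" "Dom C t3 = X \<otimes>\<^sub>o Cod C t4"
  shows "bil t1 (bil t2 a b) c = bil t3 a (bil t4 b c) \<cdot> \<alpha> (Dom C a) (Dom C b) (Dom C c)"
proof -
  have [simp]: "X \<in> Obj C" "Y \<in> Obj C" "Z \<in> Obj C"
    using assms by auto
  have "bil t1 (bil t2 a b) c = (t1 \<cdot> (t2 \<otimes>\<^sub>a \<i>\<d> Z)) \<cdot> ((a \<otimes>\<^sub>a b) \<otimes>\<^sub>a c)"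
    using assms(2-) by (simp add: bil_def)
  also have "\<dots> = (t3 \<cdot> (\<i>\<d> X \<otimes>\<^sub>a t4) \<cdot> \<alpha> X Y Z) \<cdot> ((a \<otimes>\<^sub>a b) \<otimes>\<^sub>a c)"
    by (simp only: assms(1))
  also have "\<dots> = bil t3 a (bil t4 b c) \<cdot> \<alpha> (Dom C a) (Dom C b) (Dom C c)"
    using assms(2-) by (simp add: bil_def)
  finally show ?thesis .
qed

lemma bil_lunit:
  assumes "t \<cdot> (u \<otimes>\<^sub>a \<i>\<d> Y) = \<l> Y" "t \<in> Arr C" "u \<in> Arr C" "a \<in> Arr C" "Cod C a = Y"
    "Dom C u = \<I>" "Dom C t = Cod C u \<otimes>\<^sub>o Y"
  shows "bil t u a = a \<cdot> \<l> (Dom C a)"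
proof -
  have [simp]: "Y \<in> Obj C"
    using assms by auto
  have "bil t u a = (t \<cdot> (u \<otimes>\<^sub>a \<i>\<d> Y)) \<cdot> (\<i>\<d> \<I> \<otimes>\<^sub>a a)"
    using assms(2-) by (simp add: bil_def)
  then show ?thesis
    using assms by simp
qed

lemma bil_runit:
  assumes "t \<cdot> (\<i>\<d> Y \<otimes>\<^sub>a u) = \<r> Y" "t \<in> Arr C" "u \<in> Arr C" "a \<in> Arr C" "Cod C a = Y"
    "Dom C u = \<I>" "Dom C t = Y \<otimes>\<^sub>o Cod C u"
  shows "bil t a u = a \<cdot> \<r> (Dom C a)"
proof -
  have [simp]: "Y \<in> Obj C"
    using assms by auto
  have "bil t a u = (t \<cdot> (\<i>\<d> Y \<otimes>\<^sub>a u)) \<cdot> (a \<otimes>\<^sub>a \<i>\<d> \<I>)"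
    using assms(2-) by (simp add: bil_def)
  then show ?thesis
    using assms by simp
qed

section \<open>Algebras and their homomorphisms, on generalized elements\<close>

lemma is_algebra_typing:
  assumes "is_algebra C A"
  shows "alg_obj A \<in> Obj C" "alg_mult A \<in> Arr C" "alg_unit A \<in> Arr C"
    "Dom C (alg_mult A) = alg_obj A \<otimes>\<^sub>o alg_obj A" "Cod C (alg_mult A) = alg_obj A"
    "Dom C (alg_unit A) = \<I>" "Cod C (alg_unit A) = alg_obj A"
  using assms by (auto simp: is_algebra_def Hom_iff Let_def)

lemma alg_assoc:
  assumes "is_algebra C A" "a \<in> Arr C" "b \<in> Arr C" "c \<in> Arr C"
    "Cod C a = alg_obj A" "Cod C b = alg_obj A" "Cod C c = alg_obj A"
  shows "bil (alg_mult A) (bil (alg_mult A) a b) c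
    = bil (alg_mult A) a (bil (alg_mult A) b c) \<cdot> \<alpha> (Dom C a) (Dom C b) (Dom C c)"
proof (rule bil_assoc)
  show "alg_mult A \<cdot> (alg_mult A \<otimes>\<^sub>a \<i>\<d> (alg_obj A))
      = alg_mult A \<cdot> (\<i>\<d> (alg_obj A) \<otimes>\<^sub>a alg_mult A) \<cdot> \<alpha> (alg_obj A) (alg_obj A) (alg_obj A)"
    using assms(1) by (simp add: is_algebra_def Let_def)
qed (use assms in \<open>simp_all add: is_algebra_typing\<close>)

lemma alg_lunit:
  assumes "is_algebra C A" "a \<in> Arr C" "Cod C a = alg_obj A"
  shows "bil (alg_mult A) (alg_unit A) a = a \<cdot> \<l> (Dom C a)"
proof (rule bil_lunit)
  show "alg_mult A \<cdot> (alg_unit A \<otimes>\<^sub>a \<i>\<d> (alg_obj A)) = \<l> (alg_obj A)"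
    using assms(1) by (simp add: is_algebra_def Let_def)
qed (use assms in \<open>simp_all add: is_algebra_typing\<close>)

lemma alg_runit:
  assumes "is_algebra C A" "a \<in> Arr C" "Cod C a = alg_obj A"
  shows "bil (alg_mult A) a (alg_unit A) = a \<cdot> \<r> (Dom C a)"
proof (rule bil_runit)
  show "alg_mult A \<cdot> (\<i>\<d> (alg_obj A) \<otimes>\<^sub>a alg_unit A) = \<r> (alg_obj A)"
    using assms(1) by (simp add: is_algebra_def Let_def)
qed (use assms in \<open>simp_all add: is_algebra_typing\<close>)

lemma alg_hom_typing:
  assumes "alg_hom C A B f"
  shows "f \<in> Arr C" "Dom C f = alg_obj A" "Cod C f = alg_obj B"
    "f \<cdot> alg_unit A = alg_unit B"
  using assms by (auto simp: alg_hom_def Hom_iff)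

lemma alg_hom_bil:
  assumes "alg_hom C A B f" "is_algebra C A" "is_algebra C B" "a \<in> Arr C" "b \<in> Arr C"
    "Cod C a = alg_obj A" "Cod C b = alg_obj A"
  shows "f \<cdot> bil (alg_mult A) a b = bil (alg_mult B) (f \<cdot> a) (f \<cdot> b)"
proof -
  have "f \<cdot> alg_mult A = alg_mult B \<cdot> (f \<otimes>\<^sub>a f)"
    using assms(1) by (simp add: alg_hom_def)
  then have "(f \<cdot> alg_mult A) \<cdot> (a \<otimes>\<^sub>a b) = (alg_mult B \<cdot> (f \<otimes>\<^sub>a f)) \<cdot> (a \<otimes>\<^sub>a b)"
    by simp
  then show ?thesis
    using assms(2-) alg_hom_typing[OF assms(1)] by (simp add: bil_def is_algebra_typing)
qed

lemma alg_hom_comp: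
  assumes "alg_hom C A B f" "alg_hom C B D g" "is_algebra C A" "is_algebra C B" "is_algebra C D"
  shows "alg_hom C A D (g \<cdot> f)"
proof -
  note [simp] = alg_hom_typing[OF assms(1)] alg_hom_typing[OF assms(2)] is_algebra_typing[OF assms(3)]
    is_algebra_typing[OF assms(4)] is_algebra_typing[OF assms(5)]
  have "f \<cdot> alg_mult A = alg_mult B \<cdot> (f \<otimes>\<^sub>a f)"
    using assms(1) by (simp add: alg_hom_def)
  then have "g \<cdot> f \<cdot> alg_mult A = bil (alg_mult D) (g \<cdot> f) (g \<cdot> f)"
    using alg_hom_bil[OF assms(2,4,5), of f f] by (simp add: bil_def)
  then show ?thesis
    by (simp add: alg_hom_def Hom_iff bil_def)
qed

end

section \<open>Additivity and right exactness of the tensor product\<close>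

context abelian_monoidal_category
begin

text \<open>The axioms give additivity only against identities; by interchange, tensoring with
  \<open>h\<close> is tensoring with an identity followed by a fixed arrow.\<close>

lemma tens_plus [simp]:
  assumes "f \<in> Arr C" "g \<in> Arr C" "h \<in> Arr C" "Dom C f = Dom C g" "Cod C f = Cod C g"
  shows "h \<otimes>\<^sub>a (f \<oplus>\<^sub>a g) = (h \<otimes>\<^sub>a f) \<oplus>\<^sub>a (h \<otimes>\<^sub>a g)"
    "(f \<oplus>\<^sub>a g) \<otimes>\<^sub>a h = (f \<otimes>\<^sub>a h) \<oplus>\<^sub>a (g \<otimes>\<^sub>a h)"
proof -
  have "h \<otimes>\<^sub>a (f \<oplus>\<^sub>a g) = (h \<otimes>\<^sub>a \<i>\<d> (Cod C f)) \<cdot> (\<i>\<d> (Dom C h) \<otimes>\<^sub>a (f \<oplus>\<^sub>a g))"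
    using assms by simp
  also have "\<dots> = (h \<otimes>\<^sub>a \<i>\<d> (Cod C f)) \<cdot> ((\<i>\<d> (Dom C h) \<otimes>\<^sub>a f) \<oplus>\<^sub>a (\<i>\<d> (Dom C h) \<otimes>\<^sub>a g))"
    using assms tens_add_right[of "Dom C h" f "Dom C f" "Cod C f" g] by (simp add: Hom_iff)
  also have "\<dots> = (h \<otimes>\<^sub>a f) \<oplus>\<^sub>a (h \<otimes>\<^sub>a g)"
    using assms by simp
  finally show "h \<otimes>\<^sub>a (f \<oplus>\<^sub>a g) = (h \<otimes>\<^sub>a f) \<oplus>\<^sub>a (h \<otimes>\<^sub>a g)" .
  have "(f \<oplus>\<^sub>a g) \<otimes>\<^sub>a h = (\<i>\<d> (Cod C f) \<otimes>\<^sub>a h) \<cdot> ((f \<oplus>\<^sub>a g) \<otimes>\<^sub>a \<i>\<d> (Dom C h))"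
    using assms by simp
  also have "\<dots> = (\<i>\<d> (Cod C f) \<otimes>\<^sub>a h) \<cdot> ((f \<otimes>\<^sub>a \<i>\<d> (Dom C h)) \<oplus>\<^sub>a (g \<otimes>\<^sub>a \<i>\<d> (Dom C h)))"
    using assms tens_add_left[of "Dom C h" f "Dom C f" "Cod C f" g] by (simp add: Hom_iff)
  also have "\<dots> = (f \<otimes>\<^sub>a h) \<oplus>\<^sub>a (g \<otimes>\<^sub>a h)"
    using assms by simp
  finally show "(f \<oplus>\<^sub>a g) \<otimes>\<^sub>a h = (f \<otimes>\<^sub>a h) \<oplus>\<^sub>a (g \<otimes>\<^sub>a h)" .
qed

lemma tens_zero [simp]:
  assumes "f \<in> Arr C" "X \<in> Obj C" "Y \<in> Obj C"
  shows "f \<otimes>\<^sub>a \<zero>\<^sub>a X Y = \<zero>\<^sub>a (Dom C f \<otimes>\<^sub>o X) (Cod C f \<otimes>\<^sub>o Y)"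
    "\<zero>\<^sub>a X Y \<otimes>\<^sub>a f = \<zero>\<^sub>a (X \<otimes>\<^sub>o Dom C f) (Y \<otimes>\<^sub>o Cod C f)"
proof -
  have *: "\<zero>\<^sub>a X Y \<oplus>\<^sub>a \<zero>\<^sub>a X Y = \<zero>\<^sub>a X Y"
    using assms by simp
  show "f \<otimes>\<^sub>a \<zero>\<^sub>a X Y = \<zero>\<^sub>a (Dom C f \<otimes>\<^sub>o X) (Cod C f \<otimes>\<^sub>o Y)"
    "\<zero>\<^sub>a X Y \<otimes>\<^sub>a f = \<zero>\<^sub>a (X \<otimes>\<^sub>o Dom C f) (Y \<otimes>\<^sub>o Cod C f)"
    using tens_plus[of "\<zero>\<^sub>a X Y" "\<zero>\<^sub>a X Y" f] assms
    by (auto intro!: eq_zero_if_double simp: * simp del: tens_plus)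
qed

lemma tens_neg [simp]:
  assumes "f \<in> Arr C" "g \<in> Arr C"
  shows "f \<otimes>\<^sub>a neg g = neg (f \<otimes>\<^sub>a g)" "neg f \<otimes>\<^sub>a g = neg (f \<otimes>\<^sub>a g)"
proof -
  show "f \<otimes>\<^sub>a neg g = neg (f \<otimes>\<^sub>a g)"
    using assms tens_plus(1)[of "neg g" g f] by (intro eq_negI) (simp_all del: tens_plus)
  show "neg f \<otimes>\<^sub>a g = neg (f \<otimes>\<^sub>a g)"
    using assms tens_plus(2)[of "neg f" f g] by (intro eq_negI) (simp_all del: tens_plus)
qed

lemma bil_plus:
  assumes "t \<in> Arr C" "a \<in> Arr C" "b \<in> Arr C" "c \<in> Arr C" "Dom C a = Dom C b" "Cod C a = Cod C b"
  shows "Dom C t = Cod C b \<otimes>\<^sub>o Cod C c \<Longrightarrow> bil t (a \<oplus>\<^sub>a b) c = bil t a c \<oplus>\<^sub>a bil t b c"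
    "Dom C t = Cod C c \<otimes>\<^sub>o Cod C b \<Longrightarrow> bil t c (a \<oplus>\<^sub>a b) = bil t c a \<oplus>\<^sub>a bil t c b"
  using assms by (simp_all add: bil_def)

lemma bil_zero:
  assumes "t \<in> Arr C" "a \<in> Arr C" "X \<in> Obj C" "Y \<in> Obj C"
  shows "Dom C t = Cod C a \<otimes>\<^sub>o Y \<Longrightarrow> bil t a (\<zero>\<^sub>a X Y) = \<zero>\<^sub>a (Dom C a \<otimes>\<^sub>o X) (Cod C t)"
    "Dom C t = Y \<otimes>\<^sub>o Cod C a \<Longrightarrow> bil t (\<zero>\<^sub>a X Y) a = \<zero>\<^sub>a (X \<otimes>\<^sub>o Dom C a) (Cod C t)"
  using assms by (simp_all add: bil_def)

lemma bil_neg: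
  assumes "t \<in> Arr C" "a \<in> Arr C" "b \<in> Arr C" "Dom C t = Cod C a \<otimes>\<^sub>o Cod C b"
  shows "bil t (neg a) b = neg (bil t a b)" "bil t a (neg b) = neg (bil t a b)"
  using assms by (simp_all add: bil_def)

text \<open>This is where right exactness enters: a cokernel tensored with an object is a cokernel
  again, hence epi, and \<open>p \<otimes>\<^sub>a p\<close> is a composite of two such arrows. Thus
  a multiplication on a quotient is determined by representatives.\<close>

lemma cokernel_tens_epi:
  assumes "is_cokernel C p f"
  shows "X \<in> Obj C \<Longrightarrow> is_epi C (p \<otimes>\<^sub>a \<i>\<d> X)" "X \<in> Obj C \<Longrightarrow> is_epi C (\<i>\<d> X \<otimes>\<^sub>a p)"
    "is_epi C (p \<otimes>\<^sub>a p)"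
proof -
  note [simp] = cokernel_typing[OF assms]
  show *: "is_epi C (p \<otimes>\<^sub>a \<i>\<d> X)" "is_epi C (\<i>\<d> X \<otimes>\<^sub>a p)" if "X \<in> Obj C" for X
    using that assms by (auto intro: cokernel_epi tens_cokernel_left tens_cokernel_right)
  have "is_epi C ((p \<otimes>\<^sub>a \<i>\<d> (Cod C p)) \<cdot> (\<i>\<d> (Dom C p) \<otimes>\<^sub>a p))"
    by (rule epi_comp) (simp_all add: *)
  then show "is_epi C (p \<otimes>\<^sub>a p)"
    by simp
qed

lemma cokernel_tens3_epi:
  assumes "is_cokernel C p f"
  shows "is_epi C ((p \<otimes>\<^sub>a p) \<otimes>\<^sub>a p)"
proof -
  note [simp] = cokernel_typing[OF assms]
  let ?X = "Dom C p" and ?Y = "Cod C p"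
  have 1: "is_epi C ((p \<otimes>\<^sub>a \<i>\<d> ?Y) \<otimes>\<^sub>a \<i>\<d> ?Y)"
    by (rule cokernel_tens_epi[OF tens_cokernel_left[OF _ assms]]) simp_all
  have 2: "is_epi C ((\<i>\<d> ?X \<otimes>\<^sub>a p) \<otimes>\<^sub>a \<i>\<d> ?Y)"
    by (rule cokernel_tens_epi[OF tens_cokernel_right[OF _ assms]]) simp_all
  have 3: "is_epi C (\<i>\<d> (?X \<otimes>\<^sub>o ?X) \<otimes>\<^sub>a p)"
    by (rule cokernel_tens_epi[OF assms]) simp_all
  have "is_epi C (((p \<otimes>\<^sub>a \<i>\<d> ?Y) \<otimes>\<^sub>a \<i>\<d> ?Y) \<cdot> ((\<i>\<d> ?X \<otimes>\<^sub>a p) \<otimes>\<^sub>a \<i>\<d> ?Y) \<cdot> (\<i>\<d> (?X \<otimes>\<^sub>o ?X) \<otimes>\<^sub>a p))"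
    by (intro epi_comp 1 2 3) simp_all
  then show ?thesis
    by simp
qed

end

section \<open>Square-zero extensions\<close>

context abelian_monoidal_category
begin

section \<open>Degree-two cohomology: cocycles, coboundaries and vanishing\<close>

lemma is_bimodule_typing:
  assumes "is_bimodule C A M"
  shows "bim_obj M \<in> Obj C" "bim_left M \<in> Arr C" "bim_right M \<in> Arr C"
    "Dom C (bim_left M) = alg_obj A \<otimes>\<^sub>o bim_obj M" "Cod C (bim_left M) = bim_obj M"
    "Dom C (bim_right M) = bim_obj M \<otimes>\<^sub>o alg_obj A" "Cod C (bim_right M) = bim_obj M"
  using assms by (auto simp: is_bimodule_def Hom_iff Let_def)

lemma hoch_b1_eq:
  "hoch_b1 C A M t = (bil (bim_left M) (\<i>\<d> (alg_obj A)) t \<oplus>\<^sub>a neg (t \<cdot> alg_mult A))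
    \<oplus>\<^sub>a bil (bim_right M) t (\<i>\<d> (alg_obj A))"
  by (simp add: hoch_b1_def arr_diff_eq bil_def)

text \<open>The two terms with a negative sign are moved across, so that the cocycle condition can
  be proved and used without subtraction.\<close>

lemma hoch_b2_zero_iff:
  assumes "is_algebra C A" "is_bimodule C A M" "w \<in> Hom C (alg_obj A \<otimes>\<^sub>o alg_obj A) (bim_obj M)"
  shows "hoch_b2 C A M w = \<zero>\<^sub>a ((alg_obj A \<otimes>\<^sub>o alg_obj A) \<otimes>\<^sub>o alg_obj A) (bim_obj M) \<longleftrightarrow>
    bil (bim_left M) (\<i>\<d> (alg_obj A)) w \<cdot> \<alpha> (alg_obj A) (alg_obj A) (alg_obj A)
      \<oplus>\<^sub>a bil w (\<i>\<d> (alg_obj A)) (alg_mult A) \<cdot> \<alpha> (alg_obj A) (alg_obj A) (alg_obj A)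
    = bil w (alg_mult A) (\<i>\<d> (alg_obj A)) \<oplus>\<^sub>a bil (bim_right M) w (\<i>\<d> (alg_obj A))"
proof -
  note [simp] = is_algebra_typing[OF assms(1)] is_bimodule_typing[OF assms(2)]
  have [simp]: "w \<in> Arr C" "Dom C w = alg_obj A \<otimes>\<^sub>o alg_obj A" "Cod C w = bim_obj M"
    using assms(3) by (auto simp: Hom_iff)
  define a where "a = bil (bim_left M) (\<i>\<d> (alg_obj A)) w \<cdot> \<alpha> (alg_obj A) (alg_obj A) (alg_obj A)"
  define b where "b = bil w (alg_mult A) (\<i>\<d> (alg_obj A))"
  define c where "c = bil w (\<i>\<d> (alg_obj A)) (alg_mult A) \<cdot> \<alpha> (alg_obj A) (alg_obj A) (alg_obj A)"
  define d where "d = bil (bim_right M) w (\<i>\<d> (alg_obj A))"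
  let ?X = "(alg_obj A \<otimes>\<^sub>o alg_obj A) \<otimes>\<^sub>o alg_obj A"
  have [simp]: "a \<in> Arr C" "b \<in> Arr C" "c \<in> Arr C" "d \<in> Arr C"
    "Dom C a = ?X" "Dom C b = ?X" "Dom C c = ?X" "Dom C d = ?X"
    "Cod C a = bim_obj M" "Cod C b = bim_obj M" "Cod C c = bim_obj M" "Cod C d = bim_obj M"
    by (simp_all add: a_def b_def c_def d_def)
  have "hoch_b2 C A M w = ((a \<oplus>\<^sub>a neg b) \<oplus>\<^sub>a c) \<oplus>\<^sub>a neg d"
    by (simp add: hoch_b2_def Let_def arr_diff_eq a_def b_def c_def d_def bil_def)
  moreover have "((a \<oplus>\<^sub>a neg b) \<oplus>\<^sub>a c) = (a \<oplus>\<^sub>a c) \<oplus>\<^sub>a neg b"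
    by (simp add: plus_ac)
  ultimately have "hoch_b2 C A M w = \<zero>\<^sub>a ?X (bim_obj M) \<longleftrightarrow> (a \<oplus>\<^sub>a c) \<oplus>\<^sub>a neg b = d"
    by (simp add: diff_zero_iff)
  also have "\<dots> \<longleftrightarrow> a \<oplus>\<^sub>a c = d \<oplus>\<^sub>a b"
    by (rule diff_eq_iff) simp_all
  also have "d \<oplus>\<^sub>a b = b \<oplus>\<^sub>a d"
    by (rule plus_comm) simp_all
  finally show ?thesis
    by (simp add: a_def b_def c_def d_def)
qed

text \<open>The class of a cocycle \<open>a\<close> is its coset modulo the group \<open>H\<close>
  of coboundaries, and this coset equals \<open>H\<close> iff \<open>a \<in> H\<close>. So there is
  a single class exactly when every cocycle is a coboundary. Most of the work is that
  \<open>hoch_b1\<close> is additive, which makes \<open>H\<close> a subgroup.\<close>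

lemma trivial_hoch_H2_iff:
  assumes "is_algebra C A" "is_bimodule C A M"
  shows "trivial_group (hoch_H2 C A M) \<longleftrightarrow>
    (\<forall>w \<in> Hom C (alg_obj A \<otimes>\<^sub>o alg_obj A) (bim_obj M).
      hoch_b2 C A M w = \<zero>\<^sub>a ((alg_obj A \<otimes>\<^sub>o alg_obj A) \<otimes>\<^sub>o alg_obj A) (bim_obj M) \<longrightarrow>
      (\<exists>t \<in> Hom C (alg_obj A) (bim_obj M). w = hoch_b1 C A M t))" (is "_ \<longleftrightarrow> ?R")
proof -
  note [simp] = is_algebra_typing[OF assms(1)] is_bimodule_typing[OF assms(2)]
  let ?X = "alg_obj A" and ?Y = "bim_obj M"
  define G where "G = hom_group C (?X \<otimes>\<^sub>o ?X) ?Y"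
  define Z where "Z = {w \<in> Hom C (?X \<otimes>\<^sub>o ?X) ?Y. hoch_b2 C A M w = \<zero>\<^sub>a ((?X \<otimes>\<^sub>o ?X) \<otimes>\<^sub>o ?X) ?Y}"
  define H where "H = hoch_b1 C A M ` Hom C ?X ?Y"
  interpret G: comm_group G
    unfolding G_def by simp
  have mult_G: "mult G = Plus C" and one_G: "one G = \<zero>\<^sub>a (?X \<otimes>\<^sub>o ?X) ?Y"
    and carrier_G: "carrier G = Hom C (?X \<otimes>\<^sub>o ?X) ?Y"
    by (simp_all add: G_def hom_group_def)
  have H2: "hoch_H2 C A M = G\<lparr>carrier := Z\<rparr> Mod H"
    by (simp add: hoch_H2_def Let_def G_def Z_def H_def kernel_def hom_group_def)
  have add_b1: "hoch_b1 C A M (f \<oplus>\<^sub>a g) = hoch_b1 C A M f \<oplus>\<^sub>a hoch_b1 C A M g"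
    if "f \<in> Hom C ?X ?Y" "g \<in> Hom C ?X ?Y" for f g
    using that by (simp add: hoch_b1_eq Hom_iff bil_plus plus_ac)
  have H_sub: "H \<subseteq> carrier G"
    unfolding H_def carrier_G by (auto simp: hoch_b1_eq Hom_iff)
  have zero_b1: "hoch_b1 C A M (\<zero>\<^sub>a ?X ?Y) = \<zero>\<^sub>a (?X \<otimes>\<^sub>o ?X) ?Y"
    using add_b1[of "\<zero>\<^sub>a ?X ?Y" "\<zero>\<^sub>a ?X ?Y"] H_sub
    by (intro eq_zero_if_double) (auto simp: Hom_iff hoch_b1_eq)
  then have one_H: "\<zero>\<^sub>a (?X \<otimes>\<^sub>o ?X) ?Y \<in> H"
    unfolding H_def by (metis Hom_iff assms image_eqI is_algebra_typing(1) is_bimodule_typing(1) zero_typing)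
  have "subgroup H G"
  proof (rule G.subgroupI)
    show "H \<subseteq> carrier G" "H \<noteq> {}"
      using H_sub one_H by auto
    fix a assume "a \<in> H"
    then obtain f where f: "f \<in> Hom C ?X ?Y" "a = hoch_b1 C A M f"
      by (auto simp: H_def)
    have nf: "neg f \<in> Hom C ?X ?Y"
      using f by (simp add: Hom_iff)
    have "hoch_b1 C A M (neg f) \<oplus>\<^sub>a a = hoch_b1 C A M (neg f \<oplus>\<^sub>a f)"
      using f nf by (simp add: add_b1)
    also have "\<dots> = \<zero>\<^sub>a (?X \<otimes>\<^sub>o ?X) ?Y"
      using f zero_b1 by (simp add: Hom_iff)
    finally have "inv\<^bsub>G\<^esub> a = hoch_b1 C A M (neg f)"
      using H_sub nf f(1) unfolding mult_G[symmetric] one_G[symmetric] f(2)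
      by (intro G.inv_equality) (auto simp: H_def)
    then show "inv\<^bsub>G\<^esub> a \<in> H"
      using nf by (auto simp: H_def)
    fix b assume "b \<in> H"
    then obtain g where g: "g \<in> Hom C ?X ?Y" "b = hoch_b1 C A M g"
      by (auto simp: H_def)
    then show "a \<otimes>\<^bsub>G\<^esub> b \<in> H"
      using f add_b1[of f g] unfolding mult_G H_def
      by (intro image_eqI[of _ _ "f \<oplus>\<^sub>a g"]) (auto simp: Hom_iff)
  qed
  then interpret H: subgroup H G .
  have coset: "H #>\<^bsub>G\<lparr>carrier := Z\<rparr>\<^esub> a = H #>\<^bsub>G\<^esub> a" for a
    by (simp add: r_coset_def)
  have "Z \<subseteq> carrier G"
    by (auto simp: Z_def carrier_G)
  have zero_Z: "\<zero>\<^sub>a (?X \<otimes>\<^sub>o ?X) ?Y \<in> Z"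
  proof -
    have "\<zero>\<^sub>a (?X \<otimes>\<^sub>o ?X) ?Y \<in> Hom C (?X \<otimes>\<^sub>o ?X) ?Y"
      by (simp add: Hom_iff)
    moreover from this have "hoch_b2 C A M (\<zero>\<^sub>a (?X \<otimes>\<^sub>o ?X) ?Y) = \<zero>\<^sub>a ((?X \<otimes>\<^sub>o ?X) \<otimes>\<^sub>o ?X) ?Y"
      by (subst hoch_b2_zero_iff[OF assms]) (simp_all add: bil_zero, simp add: bil_def)
    ultimately show ?thesis
      by (simp add: Z_def)
  qed
  have "trivial_group (hoch_H2 C A M) \<longleftrightarrow> Z \<subseteq> H"
  proof
    assume "trivial_group (hoch_H2 C A M)"
    then have *: "(\<Union>a\<in>Z. {H #>\<^bsub>G\<^esub> a}) = {H}"
      by (simp add: H2 trivial_group_def FactGroup_def RCOSETS_def coset)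
    show "Z \<subseteq> H"
    proof
      fix a assume "a \<in> Z"
      with * have "H #>\<^bsub>G\<^esub> a = H"
        by auto
      moreover have "a \<in> H #>\<^bsub>G\<^esub> a"
        using \<open>a \<in> Z\<close> \<open>Z \<subseteq> carrier G\<close> H.subgroup_axioms by (intro G.rcos_self) auto
      ultimately show "a \<in> H"
        by simp
    qed
  next
    assume "Z \<subseteq> H"
    then have "H #>\<^bsub>G\<^esub> a = H" if "a \<in> Z" for a
      using that \<open>Z \<subseteq> carrier G\<close> H.subgroup_axioms by (intro G.coset_join2) auto
    then have "carrier (hoch_H2 C A M) = {H}"
      using zero_Z by (auto simp: H2 FactGroup_def RCOSETS_def coset)
    moreover have "one (hoch_H2 C A M) = H"
      by (simp add: H2 FactGroup_def)
    moreover have "mult (hoch_H2 C A M) H H = H"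
      using G.subgroup_mult_id[OF H.subgroup_axioms]
      by (simp add: H2 FactGroup_def set_mult_def)
    ultimately show "trivial_group (hoch_H2 C A M)"
      unfolding trivial_group_def by (auto intro!: groupI)
  qed
  then show ?thesis
    by (auto simp: Z_def H_def)
qed

end

text \<open>No bimodule is fixed, only a kernel and a section in \<open>C\<close>. This covers the
  maps in condition (b), Hochschild extensions, and the universal extension before its kernel is
  known to be a bimodule.\<close>

locale square_zero_extension = abelian_monoidal_category C
  for C :: "('o, 'a, 'z) mon_cat_scheme" (structure) +
  fixes E B :: "('o, 'a) alg" and p s i :: 'a
  assumes E_alg: "is_algebra C E" and B_alg: "is_algebra C B" and p_hom: "alg_hom C E B p"
    and s_Hom: "s \<in> Hom C (alg_obj B) (alg_obj E)" and p_s [simp]: "p \<cdot> s = \<i>\<d> (alg_obj B)"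
    and i_ker: "is_kernel C i p"
    and i_sq: "alg_mult E \<cdot> (i \<otimes>\<^sub>a i) = \<zero>\<^sub>a (Dom C i \<otimes>\<^sub>o Dom C i) (alg_obj E)"
begin

lemmas typing [simp] = is_algebra_typing[OF E_alg] is_algebra_typing[OF B_alg]
  alg_hom_typing[OF p_hom] kernel_typing[OF i_ker, simplified alg_hom_typing[OF p_hom]]

lemma s_typing [simp]: "s \<in> Arr C" "Dom C s = alg_obj B" "Cod C s = alg_obj E"
  using s_Hom by (auto simp: Hom_iff)

lemma p_i_comp [simp]:
  "\<lbrakk>x \<in> Arr C; Cod C x = Dom C i\<rbrakk> \<Longrightarrow> p \<cdot> i \<cdot> x = \<zero>\<^sub>a (Dom C x) (alg_obj B)"
  by (simp add: comp_reassoc)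

lemma p_s_comp [simp]: "\<lbrakk>x \<in> Arr C; Cod C x = alg_obj B\<rbrakk> \<Longrightarrow> p \<cdot> s \<cdot> x = x"
  by (simp add: comp_reassoc)

abbreviation mul :: "'a \<Rightarrow> 'a \<Rightarrow> 'a"  (infixl \<open>\<star>\<close> 70) where
  "a \<star> b \<equiv> bil (alg_mult E) a b"

lemmas p_mul = alg_hom_bil[OF p_hom E_alg B_alg]

lemma kernel_lift:
  assumes "a \<in> Arr C" "Cod C a = alg_obj E" "p \<cdot> a = \<zero>\<^sub>a (Dom C a) (alg_obj B)"
  obtains x where "x \<in> Arr C" "Dom C x = Dom C a" "Cod C x = Dom C i" "i \<cdot> x = a"
  using kernel_factor[OF i_ker, of a] assms by auto

text \<open>Arrows killed by \<open>p\<close> factor through \<open>i\<close>, so their product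
  factors through the vanishing product of \<open>i\<close> with itself.\<close>

lemma kernel_mul_zero:
  assumes a: "a \<in> Arr C" "Cod C a = alg_obj E" "p \<cdot> a = \<zero>\<^sub>a (Dom C a) (alg_obj B)"
    and b: "b \<in> Arr C" "Cod C b = alg_obj E" "p \<cdot> b = \<zero>\<^sub>a (Dom C b) (alg_obj B)"
  shows "a \<star> b = \<zero>\<^sub>a (Dom C a \<otimes>\<^sub>o Dom C b) (alg_obj E)"
proof -
  obtain x where x: "x \<in> Arr C" "Dom C x = Dom C a" "Cod C x = Dom C i" "i \<cdot> x = a"
    using kernel_lift[OF a] .
  obtain y where y: "y \<in> Arr C" "Dom C y = Dom C b" "Cod C y = Dom C i" "i \<cdot> y = b"
    using kernel_lift[OF b] .
  have "a \<star> b = (alg_mult E \<cdot> (i \<otimes>\<^sub>a i)) \<cdot> (x \<otimes>\<^sub>a y)"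
    using x y by (simp add: bil_def)
  also have "\<dots> = \<zero>\<^sub>a (Dom C a \<otimes>\<^sub>o Dom C b) (alg_obj E)"
    unfolding i_sq using x y by simp
  finally show ?thesis .
qed

text \<open>The difference of \<open>x\<close> and \<open>y\<close> is killed by \<open>p\<close>,
  so its product with \<open>k\<close> vanishes. Next to a kernel element one lift may thus replace
  another: \<open>s a s b\<close> for \<open>s (a b)\<close>, or the unit of \<open>E\<close> for
  \<open>s 1\<close>.\<close>

lemma mul_kernel_cong:
  assumes "x \<in> Arr C" "y \<in> Arr C" "Cod C x = alg_obj E" "Cod C y = alg_obj E" "Dom C x = Dom C y"
    "p \<cdot> x = p \<cdot> y" and k: "k \<in> Arr C" "Cod C k = alg_obj E" "p \<cdot> k = \<zero>\<^sub>a (Dom C k) (alg_obj B)"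
  shows "x \<star> k = y \<star> k" "k \<star> x = k \<star> y"
proof -
  have *: "p \<cdot> (x \<oplus>\<^sub>a neg y) = \<zero>\<^sub>a (Dom C (x \<oplus>\<^sub>a neg y)) (alg_obj B)"
    using assms by simp
  have "(x \<oplus>\<^sub>a neg y) \<star> k = \<zero>\<^sub>a (Dom C y \<otimes>\<^sub>o Dom C k) (alg_obj E)"
    using kernel_mul_zero[OF _ _ * k] assms by simp
  then show "x \<star> k = y \<star> k"
    using assms by (simp add: bil_plus bil_neg diff_zero_iff)
  have "k \<star> (x \<oplus>\<^sub>a neg y) = \<zero>\<^sub>a (Dom C k \<otimes>\<^sub>o Dom C y) (alg_obj E)"
    using kernel_mul_zero[OF k _ _ *] assms by simp
  then show "k \<star> x = k \<star> y"
    using assms by (simp add: bil_plus bil_neg diff_zero_iff)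
qed

text \<open>With \<open>x = 1 - s 1\<close> in the kernel, \<open>s b + s b x\<close> is a section and
  \<open>s 1 + s 1 x = 1 - x\<^sup>2 = 1\<close>.\<close>

lemma ex_unital_section:
  obtains r where "r \<in> Hom C (alg_obj B) (alg_obj E)" "p \<cdot> r = \<i>\<d> (alg_obj B)"
    "r \<cdot> alg_unit B = alg_unit E"
proof -
  define x where "x = alg_unit E \<oplus>\<^sub>a neg (s \<cdot> alg_unit B)"
  have [simp]: "x \<in> Arr C" "Dom C x = \<I>" "Cod C x = alg_obj E"
    by (simp_all add: x_def)
  have px: "p \<cdot> x = \<zero>\<^sub>a \<I> (alg_obj B)"
    by (simp add: x_def)
  define r where "r = s \<oplus>\<^sub>a (s \<star> x) \<cdot> arr_inv C (\<r> (alg_obj B))"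
  have "p \<cdot> r = \<i>\<d> (alg_obj B) \<oplus>\<^sub>a (p \<cdot> (s \<star> x)) \<cdot> arr_inv C (\<r> (alg_obj B))"
    by (simp add: r_def)
  also have "\<dots> = \<i>\<d> (alg_obj B)"
    by (simp add: p_mul px bil_zero)
  finally have 1: "p \<cdot> r = \<i>\<d> (alg_obj B)" .
  have "\<r> (alg_obj B) \<cdot> arr_inv C (\<r> (alg_obj B)) \<cdot> alg_unit B
      = \<r> (alg_obj B) \<cdot> (alg_unit B \<otimes>\<^sub>a \<i>\<d> \<I>) \<cdot> arr_inv C (\<r> \<I>)"
    by simp
  then have inv: "arr_inv C (\<r> (alg_obj B)) \<cdot> alg_unit B = (alg_unit B \<otimes>\<^sub>a \<i>\<d> \<I>) \<cdot> arr_inv C (\<r> \<I>)"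
    by (rule iso_cancel_left[rotated]) simp_all
  have "(s \<cdot> alg_unit B) \<star> x = alg_unit E \<star> x"
    by (rule mul_kernel_cong) (simp_all add: px)
  also have "\<dots> = x \<cdot> \<r> \<I>"
    by (simp add: alg_lunit[OF E_alg] lunit_unit)
  finally have "r \<cdot> alg_unit B = s \<cdot> alg_unit B \<oplus>\<^sub>a x"
    by (simp add: r_def inv bil_comp)
  also have "\<dots> = alg_unit E"
    by (simp add: x_def plus_ac plus_lcomm[of "s \<cdot> alg_unit B"])
  finally show thesis
    using that[of r] 1 by (simp add: r_def Hom_iff)
qed

text \<open>The element \<open>x = 1 - g 1\<close> is an idempotent of square zero.\<close>

lemma multiplicative_section_hom:
  assumes "g \<in> Hom C (alg_obj B) (alg_obj E)" and pg: "p \<cdot> g = \<i>\<d> (alg_obj B)"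
    and gm: "g \<cdot> alg_mult B = g \<star> g"
  shows "alg_hom C B E g"
proof -
  have [simp]: "g \<in> Arr C" "Dom C g = alg_obj B" "Cod C g = alg_obj E"
    using assms by (auto simp: Hom_iff)
  define e where "e = g \<cdot> alg_unit B"
  have [simp]: "e \<in> Arr C" "Dom C e = \<I>" "Cod C e = alg_obj E"
    by (simp_all add: e_def)
  have pe: "p \<cdot> e = alg_unit B"
    using comp_reassoc[OF pg, of "alg_unit B"] by (simp add: e_def)
  have "e \<star> e = (g \<cdot> alg_mult B) \<cdot> (alg_unit B \<otimes>\<^sub>a alg_unit B)"
    by (simp add: gm bil_comp e_def)
  also have "\<dots> = g \<cdot> bil (alg_mult B) (alg_unit B) (alg_unit B)"
    by (simp add: bil_def)
  also have "\<dots> = e \<cdot> \<r> \<I>"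
    by (simp add: alg_runit[OF B_alg] e_def)
  finally have ee: "e \<star> e = e \<cdot> \<r> \<I>" .
  define x where "x = alg_unit E \<oplus>\<^sub>a neg e"
  have [simp]: "x \<in> Arr C" "Dom C x = \<I>" "Cod C x = alg_obj E"
    by (simp_all add: x_def)
  have px: "p \<cdot> x = \<zero>\<^sub>a \<I> (alg_obj B)"
    by (simp add: x_def pe)
  \<comment> \<open>Here \<open>1 x = e x\<close>, because \<open>1\<close> and \<open>e\<close>
    have the same image under \<open>p\<close> and \<open>x\<close> lies in the kernel; and
    \<open>e x = e 1 - e e = 0\<close>.\<close>
  have "x \<cdot> \<r> \<I> = alg_unit E \<star> x"
    by (simp add: alg_lunit[OF E_alg] lunit_unit)
  also have "\<dots> = e \<star> x"
    by (rule mul_kernel_cong) (simp_all add: px pe)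
  also have "\<dots> = \<zero>\<^sub>a (\<I> \<otimes>\<^sub>o \<I>) (alg_obj E)"
    by (simp add: x_def bil_plus bil_neg ee alg_runit[OF E_alg])
  also have "\<dots> = \<zero>\<^sub>a \<I> (alg_obj E) \<cdot> \<r> \<I>"
    by simp
  finally have "x = \<zero>\<^sub>a \<I> (alg_obj E)"
    by (rule iso_cancel_right[rotated]) simp_all
  then have "e = alg_unit E"
    by (simp add: x_def diff_zero_iff)
  then show ?thesis
    by (simp add: alg_hom_def Hom_iff gm[unfolded bil_def] e_def)
qed

text \<open>The products \<open>s i\<close> and \<open>i s\<close> are killed by \<open>p\<close>,
  so they factor through the kernel, which defines the two actions. As \<open>i\<close> is mono, the
  bimodule laws may be checked inside \<open>E\<close>, where they become associativity and unit
  laws; \<open>mul_kernel_cong\<close> absorbs the failure of \<open>s\<close> to be multiplicative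
  and unital.\<close>

lemma ex_kernel_bimodule:
  "\<exists>M. hochschild_extension C B M E p i"
proof -
  let ?X = "alg_obj B" and ?Y = "Dom C i"
  have "p \<cdot> (s \<star> i) = \<zero>\<^sub>a (Dom C (s \<star> i)) (alg_obj B)" "p \<cdot> (i \<star> s) = \<zero>\<^sub>a (Dom C (i \<star> s)) (alg_obj B)"
    by (simp_all add: p_mul bil_zero)
  then obtain l r where [simp]: "l \<in> Arr C" "Dom C l = ?X \<otimes>\<^sub>o ?Y" "Cod C l = ?Y"
    "r \<in> Arr C" "Dom C r = ?Y \<otimes>\<^sub>o ?X" "Cod C r = ?Y" and l: "i \<cdot> l = s \<star> i" and r: "i \<cdot> r = i \<star> s"
    using kernel_lift[of "s \<star> i"] kernel_lift[of "i \<star> s"] by (metis bil_typing s_typing typing)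
  have l': "i \<cdot> l \<cdot> w = (s \<star> i) \<cdot> w" if "w \<in> Arr C" "Cod C w = ?X \<otimes>\<^sub>o ?Y" for w
    using that by (intro comp_reassoc[OF l]) simp_all
  have r': "i \<cdot> r \<cdot> w = (i \<star> s) \<cdot> w" if "w \<in> Arr C" "Cod C w = ?Y \<otimes>\<^sub>o ?X" for w
    using that by (intro comp_reassoc[OF r]) simp_all
  have "is_bimodule C B \<lparr>bim_obj = ?Y, bim_left = l, bim_right = r\<rparr>"
    unfolding is_bimodule_def Let_def bimod.simps
  proof (intro conjI)
    show "l \<cdot> (alg_mult B \<otimes>\<^sub>a \<i>\<d> ?Y) = l \<cdot> (\<i>\<d> ?X \<otimes>\<^sub>a l) \<cdot> \<alpha> ?X ?X ?Y"
    proof (rule kernel_cancel[OF i_ker])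
      have "i \<cdot> l \<cdot> (alg_mult B \<otimes>\<^sub>a \<i>\<d> ?Y) = (s \<cdot> alg_mult B) \<star> i"
        by (simp add: l' bil_comp)
      also have "\<dots> = (s \<star> s) \<star> i"
        by (rule mul_kernel_cong) (simp_all add: p_mul bil_ident)
      also have "\<dots> = i \<cdot> l \<cdot> (\<i>\<d> ?X \<otimes>\<^sub>a l) \<cdot> \<alpha> ?X ?X ?Y"
        by (simp add: l' bil_comp l alg_assoc[OF E_alg])
      finally show "i \<cdot> l \<cdot> (alg_mult B \<otimes>\<^sub>a \<i>\<d> ?Y) = i \<cdot> l \<cdot> (\<i>\<d> ?X \<otimes>\<^sub>a l) \<cdot> \<alpha> ?X ?X ?Y" .
    qed simp_all
    show "l \<cdot> (alg_unit B \<otimes>\<^sub>a \<i>\<d> ?Y) = \<l> ?Y"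
    proof (rule kernel_cancel[OF i_ker])
      have "i \<cdot> l \<cdot> (alg_unit B \<otimes>\<^sub>a \<i>\<d> ?Y) = (s \<cdot> alg_unit B) \<star> i"
        by (simp add: l' bil_comp)
      also have "\<dots> = alg_unit E \<star> i"
        by (rule mul_kernel_cong) simp_all
      also have "\<dots> = i \<cdot> \<l> ?Y"
        by (simp add: alg_lunit[OF E_alg])
      finally show "i \<cdot> l \<cdot> (alg_unit B \<otimes>\<^sub>a \<i>\<d> ?Y) = i \<cdot> \<l> ?Y" .
    qed simp_all
    show "r \<cdot> (r \<otimes>\<^sub>a \<i>\<d> ?X) = r \<cdot> (\<i>\<d> ?Y \<otimes>\<^sub>a alg_mult B) \<cdot> \<alpha> ?Y ?X ?X"
    proof (rule kernel_cancel[OF i_ker])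
      have "i \<cdot> r \<cdot> (r \<otimes>\<^sub>a \<i>\<d> ?X) = (i \<star> (s \<star> s)) \<cdot> \<alpha> ?Y ?X ?X"
        by (simp add: r' bil_comp r alg_assoc[OF E_alg])
      also have "i \<star> (s \<star> s) = i \<star> (s \<cdot> alg_mult B)"
        by (rule mul_kernel_cong) (simp_all add: p_mul bil_ident)
      also have "\<dots> \<cdot> \<alpha> ?Y ?X ?X = i \<cdot> r \<cdot> (\<i>\<d> ?Y \<otimes>\<^sub>a alg_mult B) \<cdot> \<alpha> ?Y ?X ?X"
        by (simp add: r' bil_comp)
      finally show "i \<cdot> r \<cdot> (r \<otimes>\<^sub>a \<i>\<d> ?X) = i \<cdot> r \<cdot> (\<i>\<d> ?Y \<otimes>\<^sub>a alg_mult B) \<cdot> \<alpha> ?Y ?X ?X" .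
    qed simp_all
    show "r \<cdot> (\<i>\<d> ?Y \<otimes>\<^sub>a alg_unit B) = \<r> ?Y"
    proof (rule kernel_cancel[OF i_ker])
      have "i \<cdot> r \<cdot> (\<i>\<d> ?Y \<otimes>\<^sub>a alg_unit B) = i \<star> (s \<cdot> alg_unit B)"
        by (simp add: r' bil_comp)
      also have "\<dots> = i \<star> alg_unit E"
        by (rule mul_kernel_cong) simp_all
      also have "\<dots> = i \<cdot> \<r> ?Y"
        by (simp add: alg_runit[OF E_alg])
      finally show "i \<cdot> r \<cdot> (\<i>\<d> ?Y \<otimes>\<^sub>a alg_unit B) = i \<cdot> \<r> ?Y" .
    qed simp_all
    show "r \<cdot> (l \<otimes>\<^sub>a \<i>\<d> ?X) = l \<cdot> (\<i>\<d> ?X \<otimes>\<^sub>a r) \<cdot> \<alpha> ?X ?Y ?X"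
    proof (rule kernel_cancel[OF i_ker])
      show "i \<cdot> r \<cdot> (l \<otimes>\<^sub>a \<i>\<d> ?X) = i \<cdot> l \<cdot> (\<i>\<d> ?X \<otimes>\<^sub>a r) \<cdot> \<alpha> ?X ?Y ?X"
        by (simp add: r' l' bil_comp l r alg_assoc[OF E_alg])
    qed simp_all
  qed (simp_all add: Hom_iff)
  then have "hochschild_extension C B \<lparr>bim_obj = ?Y, bim_left = l, bim_right = r\<rparr> E p i"
    unfolding hochschild_extension_def using E_alg p_hom i_ker i_sq s_Hom
    by (auto simp: Hom_iff l r bil_def intro!: bexI[of _ s])
  then show ?thesis ..
qed

text \<open>The defect \<open>s a s b - s (a b)\<close> of multiplicativity of \<open>s\<close> is a cocycle \<open>w\<close>, and
  \<open>w = b\<^sup>1 t\<close> makes \<open>s - t\<close> multiplicative.\<close>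

lemma trivial_if_trivial_H2:
  assumes M: "is_bimodule C B M" and [simp]: "Dom C i = bim_obj M"
    and l: "i \<cdot> bim_left M = s \<star> i" and r: "i \<cdot> bim_right M = i \<star> s"
    and H2: "trivial_group (hoch_H2 C B M)"
  shows "trivial_extension C E B p"
proof -
  note [simp] = is_bimodule_typing[OF M]
  let ?X = "alg_obj B" and ?Y = "bim_obj M"
  define d where "d = s \<star> s \<oplus>\<^sub>a neg (s \<cdot> alg_mult B)"
  have [simp]: "d \<in> Arr C" "Dom C d = ?X \<otimes>\<^sub>o ?X" "Cod C d = alg_obj E"
    by (simp_all add: d_def)
  have "p \<cdot> d = \<zero>\<^sub>a (?X \<otimes>\<^sub>o ?X) (alg_obj B)"
    by (simp add: d_def p_mul bil_ident)
  then obtain w where [simp]: "w \<in> Arr C" "Dom C w = ?X \<otimes>\<^sub>o ?X" "Cod C w = ?Y" and w: "i \<cdot> w = d"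
    using kernel_lift[of d] by auto
  have d: "s \<star> s = d \<oplus>\<^sub>a s \<cdot> alg_mult B"
    by (rule iffD1[OF diff_eq_iff]) (simp_all add: d_def)
  have il: "i \<cdot> bil (bim_left M) a b = (s \<cdot> a) \<star> (i \<cdot> b)"
    if "a \<in> Arr C" "b \<in> Arr C" "Cod C a = ?X" "Cod C b = ?Y" for a b
    using that by (simp add: comp_bil l bil_bil)
  have ir: "i \<cdot> bil (bim_right M) b a = (i \<cdot> b) \<star> (s \<cdot> a)"
    if "a \<in> Arr C" "b \<in> Arr C" "Cod C a = ?X" "Cod C b = ?Y" for a b
    using that by (simp add: comp_bil r bil_bil)
  have iw: "i \<cdot> bil w a b = bil d a b"
    if "a \<in> Arr C" "b \<in> Arr C" "Cod C a = ?X" "Cod C b = ?X" for a b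
    using that by (simp add: comp_bil w)
  have bd: "(s \<cdot> a) \<star> (s \<cdot> b) = bil d a b \<oplus>\<^sub>a s \<cdot> bil (alg_mult B) a b"
    if "a \<in> Arr C" "b \<in> Arr C" "Cod C a = ?X" "Cod C b = ?X" for a b
  proof -
    have "(s \<star> s) \<cdot> (a \<otimes>\<^sub>a b) = bil d a b \<oplus>\<^sub>a s \<cdot> bil (alg_mult B) a b"
      unfolding d using that by (simp add: bil_def)
    then show ?thesis
      using that by (simp add: bil_comp)
  qed
  have "i \<cdot> (bil (bim_left M) (\<i>\<d> ?X) w \<cdot> \<alpha> ?X ?X ?X \<oplus>\<^sub>a bil w (\<i>\<d> ?X) (alg_mult B) \<cdot> \<alpha> ?X ?X ?X)
      = i \<cdot> (bil w (alg_mult B) (\<i>\<d> ?X) \<oplus>\<^sub>a bil (bim_right M) w (\<i>\<d> ?X))" (is "?L = ?R")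
  proof -
    let ?c = "s \<cdot> bil (alg_mult B) (alg_mult B) (\<i>\<d> ?X)"
    have c: "?c = (s \<cdot> bil (alg_mult B) (\<i>\<d> ?X) (alg_mult B)) \<cdot> \<alpha> ?X ?X ?X"
      using alg_assoc[OF B_alg, of "\<i>\<d> ?X" "\<i>\<d> ?X" "\<i>\<d> ?X"] by (simp add: bil_ident)
    have L: "?L = (s \<star> d) \<cdot> \<alpha> ?X ?X ?X \<oplus>\<^sub>a bil d (\<i>\<d> ?X) (alg_mult B) \<cdot> \<alpha> ?X ?X ?X"
      by (simp add: comp_reassoc[OF il] comp_reassoc[OF iw] w)
    have R: "?R = bil d (alg_mult B) (\<i>\<d> ?X) \<oplus>\<^sub>a d \<star> s"
      by (simp add: iw ir w)
    \<comment> \<open>The associativity of \<open>E\<close> on three values of \<open>s\<close> is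
      expanded on both sides by \<open>s a s b = d(a, b) + s (a b)\<close>. Each expansion ends in
      the value \<open>?c\<close> of \<open>s\<close> on the triple product, which is then
      cancelled.\<close>
    have "?L \<oplus>\<^sub>a ?c = (s \<star> d \<oplus>\<^sub>a (bil d (\<i>\<d> ?X) (alg_mult B)
        \<oplus>\<^sub>a s \<cdot> bil (alg_mult B) (\<i>\<d> ?X) (alg_mult B))) \<cdot> \<alpha> ?X ?X ?X"
      unfolding L c by (simp add: plus_assoc)
    also have "\<dots> = (s \<star> (s \<star> s)) \<cdot> \<alpha> ?X ?X ?X"
      unfolding d using bd[of "\<i>\<d> ?X" "alg_mult B"] by (simp add: bil_plus)
    also have "\<dots> = (s \<star> s) \<star> s"
      by (simp add: alg_assoc[OF E_alg])
    also have "\<dots> = d \<star> s \<oplus>\<^sub>a (bil d (alg_mult B) (\<i>\<d> ?X) \<oplus>\<^sub>a ?c)"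
      unfolding d using bd[of "alg_mult B" "\<i>\<d> ?X"] by (simp add: bil_plus)
    also have "\<dots> = ?R \<oplus>\<^sub>a ?c"
      unfolding R by (simp add: plus_ac)
    finally show ?thesis
      by (rule iffD1[OF plus_cancel(2), rotated 7]) simp_all
  qed
  then have "bil (bim_left M) (\<i>\<d> ?X) w \<cdot> \<alpha> ?X ?X ?X \<oplus>\<^sub>a bil w (\<i>\<d> ?X) (alg_mult B) \<cdot> \<alpha> ?X ?X ?X
      = bil w (alg_mult B) (\<i>\<d> ?X) \<oplus>\<^sub>a bil (bim_right M) w (\<i>\<d> ?X)"
    by (rule kernel_cancel[OF i_ker]) simp_all
  then have "hoch_b2 C B M w = \<zero>\<^sub>a ((?X \<otimes>\<^sub>o ?X) \<otimes>\<^sub>o ?X) ?Y"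
    by (subst hoch_b2_zero_iff[OF B_alg M]) (simp_all add: Hom_iff)
  then obtain t where t: "t \<in> Hom C ?X ?Y" "w = hoch_b1 C B M t"
    using H2 trivial_hoch_H2_iff[OF B_alg M] by (auto simp: Hom_iff)
  have [simp]: "t \<in> Arr C" "Dom C t = ?X" "Cod C t = ?Y"
    using t by (auto simp: Hom_iff)
  have "d = (s \<star> (i \<cdot> t) \<oplus>\<^sub>a neg (i \<cdot> t \<cdot> alg_mult B)) \<oplus>\<^sub>a (i \<cdot> t) \<star> s"
    unfolding w[symmetric] t(2) hoch_b1_eq by (simp add: il ir)
  also have "\<dots> = (s \<star> (i \<cdot> t) \<oplus>\<^sub>a (i \<cdot> t) \<star> s) \<oplus>\<^sub>a neg (i \<cdot> t \<cdot> alg_mult B)"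
    by (simp add: plus_ac)
  finally have dt: "s \<star> (i \<cdot> t) \<oplus>\<^sub>a (i \<cdot> t) \<star> s = d \<oplus>\<^sub>a i \<cdot> t \<cdot> alg_mult B"
    by (intro iffD1[OF diff_eq_iff]) simp_all
  define g where "g = s \<oplus>\<^sub>a neg (i \<cdot> t)"
  have [simp]: "g \<in> Arr C" "Dom C g = ?X" "Cod C g = alg_obj E"
    by (simp_all add: g_def)
  have pg: "p \<cdot> g = \<i>\<d> ?X"
    by (simp add: g_def)
  have sg: "s = g \<oplus>\<^sub>a i \<cdot> t"
    by (rule iffD1[OF diff_eq_iff]) (simp_all add: g_def)
  have zero: "(i \<cdot> t) \<star> (i \<cdot> t) = \<zero>\<^sub>a (?X \<otimes>\<^sub>o ?X) (alg_obj E)"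
    using kernel_mul_zero[of "i \<cdot> t" "i \<cdot> t"] by simp
  \<comment> \<open>Expand \<open>s \<star> s\<close> with \<open>s = g + i t\<close>: the product
    of \<open>i t\<close> with itself vanishes, and next to the kernel element \<open>i t\<close>
    the sections \<open>g\<close> and \<open>s\<close> are interchangeable.\<close>
  have "g \<star> g \<oplus>\<^sub>a (s \<star> (i \<cdot> t) \<oplus>\<^sub>a (i \<cdot> t) \<star> s) = s \<star> s"
  proof -
    have "s \<star> (i \<cdot> t) = g \<star> (i \<cdot> t)" "(i \<cdot> t) \<star> s = (i \<cdot> t) \<star> g"
      by (rule mul_kernel_cong; simp add: pg)+
    then have "g \<star> g \<oplus>\<^sub>a (s \<star> (i \<cdot> t) \<oplus>\<^sub>a (i \<cdot> t) \<star> s)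
        = (g \<oplus>\<^sub>a i \<cdot> t) \<star> (g \<oplus>\<^sub>a i \<cdot> t)"
      by (simp add: bil_plus zero plus_ac)
    then show ?thesis
      by (simp only: sg[symmetric])
  qed
  then have "d \<oplus>\<^sub>a (g \<star> g \<oplus>\<^sub>a i \<cdot> t \<cdot> alg_mult B) = d \<oplus>\<^sub>a s \<cdot> alg_mult B"
    unfolding dt d by (simp add: plus_lcomm)
  then have "g \<star> g \<oplus>\<^sub>a i \<cdot> t \<cdot> alg_mult B = s \<cdot> alg_mult B"
    by simp
  also have "\<dots> = (g \<oplus>\<^sub>a i \<cdot> t) \<cdot> alg_mult B"
    by (simp only: sg[symmetric])
  finally have "g \<cdot> alg_mult B = g \<star> g"
    by simp
  then have "alg_hom C B E g"
    by (intro multiplicative_section_hom) (simp_all add: Hom_iff pg)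
  then show ?thesis
    using pg by (auto simp: trivial_extension_def)
qed

end

section \<open>The extension of a cocycle\<close>

text \<open>\<open>P\<close> plays the role of M \<oplus> A, with projections \<open>q\<close> to M
  and \<open>p\<close> to A. It is given by its product property alone; the injections are obtained
  from \<open>pair\<close>.\<close>

locale hochschild_cocycle = abelian_monoidal_category C
  for C :: "('o, 'a, 'z) mon_cat_scheme" (structure) +
  fixes A :: "('o, 'a) alg" and M :: "('o, 'a) bimod" and w :: 'a and P :: 'o and q p :: 'a
  assumes A_alg: "is_algebra C A" and M_bimod: "is_bimodule C A M"
    and w_Hom: "w \<in> Hom C (alg_obj A \<otimes>\<^sub>o alg_obj A) (bim_obj M)"
    and w_cocycle: "hoch_b2 C A M w = \<zero>\<^sub>a ((alg_obj A \<otimes>\<^sub>o alg_obj A) \<otimes>\<^sub>o alg_obj A) (bim_obj M)"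
    and P_product: "is_product C (bim_obj M) (alg_obj A) P q p"
begin

lemmas typing [simp] = is_algebra_typing[OF A_alg] is_bimodule_typing[OF M_bimod]

lemma w_typing [simp]: "w \<in> Arr C" "Dom C w = alg_obj A \<otimes>\<^sub>o alg_obj A" "Cod C w = bim_obj M"
  using w_Hom by (auto simp: Hom_iff)

lemma product_typing [simp]: "P \<in> Obj C" "q \<in> Arr C" "Dom C q = P" "Cod C q = bim_obj M"
  "p \<in> Arr C" "Dom C p = P" "Cod C p = alg_obj A"
  using P_product by (auto simp: is_product_def Hom_iff)

abbreviation "ml \<equiv> bil (bim_left M)"
abbreviation "mr \<equiv> bil (bim_right M)"
abbreviation "mA \<equiv> bil (alg_mult A)"

lemma bimod_laws:
  assumes "a \<in> Arr C" "b \<in> Arr C" "n \<in> Arr C" "Cod C a = alg_obj A" "Cod C b = alg_obj A"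
    "Cod C n = bim_obj M"
  shows "ml (mA a b) n = ml a (ml b n) \<cdot> \<alpha> (Dom C a) (Dom C b) (Dom C n)"
    "mr (mr n a) b = mr n (mA a b) \<cdot> \<alpha> (Dom C n) (Dom C a) (Dom C b)"
    "mr (ml a n) b = ml a (mr n b) \<cdot> \<alpha> (Dom C a) (Dom C n) (Dom C b)"
proof -
  let ?X = "alg_obj A" and ?Y = "bim_obj M" and ?l = "bim_left M" and ?r = "bim_right M"
  have 1: "?l \<cdot> (alg_mult A \<otimes>\<^sub>a \<i>\<d> ?Y) = ?l \<cdot> (\<i>\<d> ?X \<otimes>\<^sub>a ?l) \<cdot> \<alpha> ?X ?X ?Y"
    and 3: "?r \<cdot> (?r \<otimes>\<^sub>a \<i>\<d> ?X) = ?r \<cdot> (\<i>\<d> ?Y \<otimes>\<^sub>a alg_mult A) \<cdot> \<alpha> ?Y ?X ?X"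
    and 5: "?r \<cdot> (?l \<otimes>\<^sub>a \<i>\<d> ?X) = ?l \<cdot> (\<i>\<d> ?X \<otimes>\<^sub>a ?r) \<cdot> \<alpha> ?X ?Y ?X"
    using M_bimod by (simp_all add: is_bimodule_def Let_def)
  show "ml (mA a b) n = ml a (ml b n) \<cdot> \<alpha> (Dom C a) (Dom C b) (Dom C n)"
    by (rule bil_assoc[OF 1]) (use assms in simp_all)
  show "mr (mr n a) b = mr n (mA a b) \<cdot> \<alpha> (Dom C n) (Dom C a) (Dom C b)"
    by (rule bil_assoc[OF 3]) (use assms in simp_all)
  show "mr (ml a n) b = ml a (mr n b) \<cdot> \<alpha> (Dom C a) (Dom C n) (Dom C b)"
    by (rule bil_assoc[OF 5]) (use assms in simp_all)
qed

lemma bimod_unit: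
  assumes "n \<in> Arr C" "Cod C n = bim_obj M"
  shows "ml (alg_unit A) n = n \<cdot> \<l> (Dom C n)" "mr n (alg_unit A) = n \<cdot> \<r> (Dom C n)"
proof -
  have 1: "bim_left M \<cdot> (alg_unit A \<otimes>\<^sub>a \<i>\<d> (bim_obj M)) = \<l> (bim_obj M)"
    and 2: "bim_right M \<cdot> (\<i>\<d> (bim_obj M) \<otimes>\<^sub>a alg_unit A) = \<r> (bim_obj M)"
    using M_bimod by (simp_all add: is_bimodule_def Let_def)
  show "ml (alg_unit A) n = n \<cdot> \<l> (Dom C n)"
    by (rule bil_lunit[OF 1]) (use assms in simp_all)
  show "mr n (alg_unit A) = n \<cdot> \<r> (Dom C n)"
    by (rule bil_runit[OF 2]) (use assms in simp_all)
qed

lemma cocycle: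
  assumes [simp]: "a \<in> Arr C" "b \<in> Arr C" "c \<in> Arr C" "Cod C a = alg_obj A" "Cod C b = alg_obj A"
    "Cod C c = alg_obj A"
  shows "ml a (bil w b c) \<cdot> \<alpha> (Dom C a) (Dom C b) (Dom C c)
      \<oplus>\<^sub>a bil w a (mA b c) \<cdot> \<alpha> (Dom C a) (Dom C b) (Dom C c)
    = bil w (mA a b) c \<oplus>\<^sub>a mr (bil w a b) c"
proof -
  let ?X = "alg_obj A"
  have "(ml (\<i>\<d> ?X) w \<cdot> \<alpha> ?X ?X ?X \<oplus>\<^sub>a bil w (\<i>\<d> ?X) (alg_mult A) \<cdot> \<alpha> ?X ?X ?X) \<cdot> ((a \<otimes>\<^sub>a b) \<otimes>\<^sub>a c)
    = (bil w (alg_mult A) (\<i>\<d> ?X) \<oplus>\<^sub>a mr w (\<i>\<d> ?X)) \<cdot> ((a \<otimes>\<^sub>a b) \<otimes>\<^sub>a c)"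
    using w_cocycle[unfolded hoch_b2_zero_iff[OF A_alg M_bimod w_Hom]] by simp
  then show ?thesis
    by (simp add: bil_def)
qed

definition pair :: "'a \<Rightarrow> 'a \<Rightarrow> 'a" where
  "pair f g = (THE h. h \<in> Hom C (Dom C f) P \<and> q \<cdot> h = f \<and> p \<cdot> h = g)"

lemma pair_typing [simp]:
  assumes "f \<in> Arr C" "g \<in> Arr C" "Dom C f = Dom C g" "Cod C f = bim_obj M" "Cod C g = alg_obj A"
  shows "pair f g \<in> Arr C" "Dom C (pair f g) = Dom C g" "Cod C (pair f g) = P"
    "q \<cdot> pair f g = f" "p \<cdot> pair f g = g"
proof -
  have "\<exists>!h. h \<in> Hom C (Dom C f) P \<and> q \<cdot> h = f \<and> p \<cdot> h = g"
    using P_product assms unfolding is_product_def by (simp add: Hom_iff)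
  from theI'[OF this] show "pair f g \<in> Arr C" "Dom C (pair f g) = Dom C g" "Cod C (pair f g) = P"
    "q \<cdot> pair f g = f" "p \<cdot> pair f g = g"
    using assms by (auto simp: pair_def Hom_iff)
qed

lemma product_eqI:
  assumes "q \<cdot> h = q \<cdot> k" "p \<cdot> h = p \<cdot> k" "h \<in> Arr C" "k \<in> Arr C" "Cod C h = P" "Cod C k = P"
    "Dom C h = Dom C k"
  shows "h = k"
proof -
  have "q \<cdot> h \<in> Hom C (Dom C h) (bim_obj M)" "p \<cdot> h \<in> Hom C (Dom C h) (alg_obj A)"
    using assms(3-) by (simp_all add: Hom_iff)
  then have "\<exists>!x. x \<in> Hom C (Dom C h) P \<and> q \<cdot> x = q \<cdot> h \<and> p \<cdot> x = p \<cdot> h"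
    using P_product unfolding is_product_def by blast
  moreover have "h \<in> Hom C (Dom C h) P" "k \<in> Hom C (Dom C h) P"
    using assms(3-) by (simp_all add: Hom_iff)
  ultimately show ?thesis
    using assms(1,2) by (metis (no_types, lifting))
qed

lemma pair_comp [simp]:
  assumes "f \<in> Arr C" "g \<in> Arr C" "Dom C f = Dom C g" "Cod C f = bim_obj M" "Cod C g = alg_obj A"
    "x \<in> Arr C" "Cod C x = Dom C g"
  shows "q \<cdot> pair f g \<cdot> x = f \<cdot> x" "p \<cdot> pair f g \<cdot> x = g \<cdot> x"
  using assms by (simp_all add: comp_reassoc)

text \<open>In elements: (m, a)(n, b) = (a n + m b + w(a, b), a b).\<close>

definition mult :: 'a where
  "mult = pair (ml p q \<oplus>\<^sub>a (mr q p \<oplus>\<^sub>a bil w p p)) (mA p p)"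

text \<open>For a cocycle that is not normalized (0, 1) is not neutral, as (0, 1)(0, 1) = (w(1, 1),
  1). The inverse of \<open>\<r> \<I>\<close> transports w(1, 1), which is defined on two copies of
  the unit object, to \<I>.\<close>

definition unit :: 'a where
  "unit = pair (neg (bil w (alg_unit A) (alg_unit A) \<cdot> arr_inv C (\<r> \<I>))) (alg_unit A)"

lemma mult_typing [simp]: "mult \<in> Arr C" "Dom C mult = P \<otimes>\<^sub>o P" "Cod C mult = P"
  by (simp_all add: mult_def)

lemma unit_typing [simp]: "unit \<in> Arr C" "Dom C unit = \<I>" "Cod C unit = P"
  by (simp_all add: unit_def)

lemma mult_components:
  assumes "x \<in> Arr C" "y \<in> Arr C" "Cod C x = P" "Cod C y = P"
  shows "q \<cdot> bil mult x y
      = ml (p \<cdot> x) (q \<cdot> y) \<oplus>\<^sub>a (mr (q \<cdot> x) (p \<cdot> y) \<oplus>\<^sub>a bil w (p \<cdot> x) (p \<cdot> y))"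
    "p \<cdot> bil mult x y = mA (p \<cdot> x) (p \<cdot> y)"
proof -
  show "q \<cdot> bil mult x y
      = ml (p \<cdot> x) (q \<cdot> y) \<oplus>\<^sub>a (mr (q \<cdot> x) (p \<cdot> y) \<oplus>\<^sub>a bil w (p \<cdot> x) (p \<cdot> y))"
    unfolding bil_def[of mult] using assms by (simp add: mult_def bil_comp)
  show "p \<cdot> bil mult x y = mA (p \<cdot> x) (p \<cdot> y)"
    unfolding bil_def[of mult] using assms by (simp add: mult_def bil_comp)
qed

lemma unit_components:
  "q \<cdot> unit = neg (bil w (alg_unit A) (alg_unit A) \<cdot> arr_inv C (\<r> \<I>))" "p \<cdot> unit = alg_unit A"
  by (simp_all add: unit_def)

text \<open>The cocycle condition at \<open>(1, 1, a)\<close> and \<open>(a, 1, 1)\<close> gives \<open>w(1, a) = w(1, 1) a\<close> and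
  \<open>w(a, 1) = a w(1, 1)\<close>.\<close>

lemma cocycle_unit_left:
  assumes [simp]: "a \<in> Arr C" "Cod C a = alg_obj A"
  shows "mr (q \<cdot> unit) a \<oplus>\<^sub>a bil w (alg_unit A) a = \<zero>\<^sub>a (\<I> \<otimes>\<^sub>o Dom C a) (bim_obj M)"
proof -
  let ?u = "alg_unit A" and ?W = "Dom C a"
  have "bil w ?u a \<cdot> \<l> (\<I> \<otimes>\<^sub>o ?W) \<cdot> \<alpha> \<I> \<I> ?W \<oplus>\<^sub>a bil w ?u (a \<cdot> \<l> ?W) \<cdot> \<alpha> \<I> \<I> ?W
      = bil w (?u \<cdot> \<r> \<I>) a \<oplus>\<^sub>a mr (bil w ?u ?u) a"
    using cocycle[of ?u ?u a] by (simp add: bimod_unit alg_lunit[OF A_alg] lunit_unit)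
  also have "bil w ?u (a \<cdot> \<l> ?W) \<cdot> \<alpha> \<I> \<I> ?W = bil w ?u a \<cdot> (\<i>\<d> \<I> \<otimes>\<^sub>a \<l> ?W) \<cdot> \<alpha> \<I> \<I> ?W"
    by (simp add: bil_comp)
  also have "\<dots> = bil w (?u \<cdot> \<r> \<I>) a"
    by (simp add: triangle bil_comp)
  \<comment> \<open>The term w(1 1, a) occurs on both sides of the cocycle equation at (1, 1, a) and
    cancels.\<close>
  finally have "bil w ?u a \<cdot> \<l> (\<I> \<otimes>\<^sub>o ?W) \<cdot> \<alpha> \<I> \<I> ?W = mr (bil w ?u ?u) a"
    by (subst (asm) (2) plus_comm) simp_all
  then have "mr (bil w ?u ?u) a = bil w (?u \<cdot> \<r> \<I>) a"
    by (simp add: lunit_tens lunit_unit bil_comp)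
  then have "mr (bil w ?u ?u) a \<cdot> (arr_inv C (\<r> \<I>) \<otimes>\<^sub>a \<i>\<d> ?W)
      = bil w (?u \<cdot> \<r> \<I>) a \<cdot> (arr_inv C (\<r> \<I>) \<otimes>\<^sub>a \<i>\<d> ?W)"
    by simp
  then have "mr (bil w ?u ?u \<cdot> arr_inv C (\<r> \<I>)) a = bil w ?u a"
    by (simp add: bil_comp)
  then show ?thesis
    by (simp add: unit_components bil_neg)
qed

lemma cocycle_unit_right:
  assumes [simp]: "a \<in> Arr C" "Cod C a = alg_obj A"
  shows "ml a (q \<cdot> unit) \<oplus>\<^sub>a bil w a (alg_unit A) = \<zero>\<^sub>a (Dom C a \<otimes>\<^sub>o \<I>) (bim_obj M)"
proof -
  let ?u = "alg_unit A" and ?W = "Dom C a"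
  have "ml a (bil w ?u ?u) \<cdot> \<alpha> ?W \<I> \<I> \<oplus>\<^sub>a bil w a (?u \<cdot> \<l> \<I>) \<cdot> \<alpha> ?W \<I> \<I>
      = bil w (a \<cdot> \<r> ?W) ?u \<oplus>\<^sub>a bil w a ?u \<cdot> \<r> (?W \<otimes>\<^sub>o \<I>)"
    using cocycle[of a ?u ?u] by (simp add: bimod_unit alg_lunit[OF A_alg] alg_runit[OF A_alg] lunit_unit)
  also have "bil w a (?u \<cdot> \<l> \<I>) \<cdot> \<alpha> ?W \<I> \<I> = bil w a ?u \<cdot> (\<i>\<d> ?W \<otimes>\<^sub>a \<l> \<I>) \<cdot> \<alpha> ?W \<I> \<I>"
    by (simp add: bil_comp)
  also have "\<dots> = bil w (a \<cdot> \<r> ?W) ?u"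
    by (simp add: triangle bil_comp)
  finally have "ml a (bil w ?u ?u) \<cdot> \<alpha> ?W \<I> \<I> = bil w a ?u \<cdot> \<r> (?W \<otimes>\<^sub>o \<I>)"
    by (subst (asm) (1) plus_comm) simp_all
  also have "\<dots> = bil w a ?u \<cdot> (\<i>\<d> ?W \<otimes>\<^sub>a \<r> \<I>) \<cdot> \<alpha> ?W \<I> \<I>"
    by (simp add: runit_tens)
  also have "\<dots> = bil w a (?u \<cdot> \<r> \<I>) \<cdot> \<alpha> ?W \<I> \<I>"
    by (simp add: bil_comp)
  finally have "ml a (bil w ?u ?u) = bil w a (?u \<cdot> \<r> \<I>)"
    by (rule iso_cancel_right[rotated]) simp_all
  then have "ml a (bil w ?u ?u) \<cdot> (\<i>\<d> ?W \<otimes>\<^sub>a arr_inv C (\<r> \<I>))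
      = bil w a (?u \<cdot> \<r> \<I>) \<cdot> (\<i>\<d> ?W \<otimes>\<^sub>a arr_inv C (\<r> \<I>))"
    by simp
  then have "ml a (bil w ?u ?u \<cdot> arr_inv C (\<r> \<I>)) = bil w a ?u"
    by (simp add: bil_comp)
  then show ?thesis
    by (simp add: unit_components bil_neg)
qed

definition cocycle_alg :: "('o, 'a) alg" where
  "cocycle_alg = \<lparr>alg_obj = P, alg_mult = mult, alg_unit = unit\<rparr>"

text \<open>The laws are compared on both projections. Over A they are those of A. Over M the terms
  involving \<open>q\<close> match by the bimodule laws; the terms in \<open>w\<close> match by the
  cocycle condition for associativity, and by its two consequences at the unit for
  neutrality.\<close>

lemma cocycle_alg_algebra: "is_algebra C cocycle_alg"
proof -
  have assoc: "bil mult mult (\<i>\<d> P) = bil mult (\<i>\<d> P) mult \<cdot> \<alpha> P P P"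
  proof (rule product_eqI)
    have qm: "q \<cdot> mult = ml p q \<oplus>\<^sub>a (mr q p \<oplus>\<^sub>a bil w p p)" and pm: "p \<cdot> mult = mA p p"
      by (simp_all add: mult_def)
    show "p \<cdot> bil mult mult (\<i>\<d> P) = p \<cdot> bil mult (\<i>\<d> P) mult \<cdot> \<alpha> P P P"
      by (simp add: mult_components comp_reassoc[OF mult_components(2)] pm alg_assoc[OF A_alg])
    let ?a = "\<alpha> P P P"
    have "q \<cdot> bil mult mult (\<i>\<d> P) = ml (mA p p) q
        \<oplus>\<^sub>a ((mr (ml p q) p \<oplus>\<^sub>a (mr (mr q p) p \<oplus>\<^sub>a mr (bil w p p) p)) \<oplus>\<^sub>a bil w (mA p p) p)"
      by (simp add: mult_components pm qm bil_plus)
    \<comment> \<open>The two terms in \<open>w\<close> are brought together to form the right-hand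
      side of \<open>cocycle\<close> at \<open>p\<close>, \<open>p\<close>,
      \<open>p\<close>.\<close>
    also have "\<dots> = ml (mA p p) q
        \<oplus>\<^sub>a (mr (ml p q) p \<oplus>\<^sub>a (mr (mr q p) p \<oplus>\<^sub>a (bil w (mA p p) p \<oplus>\<^sub>a mr (bil w p p) p)))"
      by (simp add: plus_ac)
    also have "\<dots> = ml p (ml p q) \<cdot> ?a \<oplus>\<^sub>a (ml p (mr q p) \<cdot> ?a \<oplus>\<^sub>a (mr q (mA p p) \<cdot> ?a
        \<oplus>\<^sub>a (ml p (bil w p p) \<cdot> ?a \<oplus>\<^sub>a bil w p (mA p p) \<cdot> ?a)))"
      using cocycle[of p p p] by (simp add: bimod_laws)
    also have "\<dots> = (ml p (ml p q \<oplus>\<^sub>a (mr q p \<oplus>\<^sub>a bil w p p))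
        \<oplus>\<^sub>a (mr q (mA p p) \<oplus>\<^sub>a bil w p (mA p p))) \<cdot> ?a"
      by (simp add: bil_plus plus_ac)
    also have "\<dots> = q \<cdot> bil mult (\<i>\<d> P) mult \<cdot> ?a"
      using comp_reassoc[OF mult_components(1)[of "\<i>\<d> P" mult], of ?a] by (simp add: pm qm)
    finally show "q \<cdot> bil mult mult (\<i>\<d> P) = q \<cdot> bil mult (\<i>\<d> P) mult \<cdot> ?a" .
  qed simp_all
  have lunit: "bil mult unit (\<i>\<d> P) = \<l> P"
  proof (rule product_eqI)
    show "p \<cdot> bil mult unit (\<i>\<d> P) = p \<cdot> \<l> P"
      by (simp add: mult_components unit_components alg_lunit[OF A_alg])
    show "q \<cdot> bil mult unit (\<i>\<d> P) = q \<cdot> \<l> P"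
      using cocycle_unit_left[of p] by (simp add: mult_components unit_components(2) bimod_unit)
  qed simp_all
  have runit: "bil mult (\<i>\<d> P) unit = \<r> P"
  proof (rule product_eqI)
    show "p \<cdot> bil mult (\<i>\<d> P) unit = p \<cdot> \<r> P"
      by (simp add: mult_components unit_components alg_runit[OF A_alg])
    have "q \<cdot> bil mult (\<i>\<d> P) unit
        = mr q (alg_unit A) \<oplus>\<^sub>a (ml p (q \<cdot> unit) \<oplus>\<^sub>a bil w p (alg_unit A))"
      by (simp add: mult_components unit_components(2) plus_ac)
    then show "q \<cdot> bil mult (\<i>\<d> P) unit = q \<cdot> \<r> P"
      using cocycle_unit_right[of p] by (simp add: bimod_unit)
  qed simp_all
  show ?thesis
    using assoc lunit runit by (simp add: is_algebra_def Let_def cocycle_alg_def Hom_iff bil_def)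
qed

text \<open>The section is a -> (0, a). Since \<open>w\<close> sees only the components in A, it
  contributes nothing to a product with some (m, 0); so the kernel has square zero and the induced
  actions are the given ones.\<close>

lemma cocycle_alg_extension:
  "hochschild_extension C A M cocycle_alg p (pair (\<i>\<d> (bim_obj M)) (\<zero>\<^sub>a (bim_obj M) (alg_obj A)))"
proof -
  let ?X = "alg_obj A" and ?Y = "bim_obj M"
  define i where "i = pair (\<i>\<d> ?Y) (\<zero>\<^sub>a ?Y ?X)"
  define s where "s = pair (\<zero>\<^sub>a ?X ?Y) (\<i>\<d> ?X)"
  have [simp]: "i \<in> Arr C" "Dom C i = ?Y" "Cod C i = P" "s \<in> Arr C" "Dom C s = ?X" "Cod C s = P"
    "q \<cdot> i = \<i>\<d> ?Y" "p \<cdot> i = \<zero>\<^sub>a ?Y ?X" "q \<cdot> s = \<zero>\<^sub>a ?X ?Y" "p \<cdot> s = \<i>\<d> ?X"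
    by (simp_all add: i_def s_def)
  have [simp]: "q \<cdot> i \<cdot> x = x" "p \<cdot> i \<cdot> x = \<zero>\<^sub>a (Dom C x) ?X" if "x \<in> Arr C" "Cod C x = ?Y" for x
    using that by (simp_all add: comp_reassoc)
  have hom: "alg_hom C cocycle_alg A p"
    using mult_components(2)[of "\<i>\<d> P" "\<i>\<d> P"]
    by (simp add: alg_hom_def cocycle_alg_def Hom_iff unit_components bil_def)
  have ker: "is_kernel C i p"
    unfolding is_kernel_def
  proof (intro conjI allI ballI impI)
    fix U g
    assume g: "g \<in> Hom C U (Dom C p)" "p \<cdot> g = \<zero>\<^sub>a U (Cod C p)"
    then have [simp]: "g \<in> Arr C" "Dom C g = U" "Cod C g = P"
      by (auto simp: Hom_iff)
    have "i \<cdot> q \<cdot> g = g"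
      by (rule product_eqI) (simp_all add: g(2))
    moreover have "h = q \<cdot> g" if "h \<in> Hom C U (Dom C i)" "i \<cdot> h = g" for h
    proof -
      have "q \<cdot> i \<cdot> h = h"
        using that(1) by (simp add: Hom_iff)
      then show ?thesis
        using that(2) by simp
    qed
    ultimately show "\<exists>!h. h \<in> Hom C U (Dom C i) \<and> i \<cdot> h = g"
      by (intro ex1I[of _ "q \<cdot> g"]) (simp_all add: Hom_iff)
  qed simp_all
  have sq: "bil mult i i = \<zero>\<^sub>a (?Y \<otimes>\<^sub>o ?Y) P"
    by (rule product_eqI) (simp_all add: mult_components bil_zero)
  have l: "i \<cdot> bim_left M = bil mult s i"
    by (rule product_eqI) (simp_all add: mult_components bil_zero bil_ident)
  have r: "i \<cdot> bim_right M = bil mult i s"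
    by (rule product_eqI) (simp_all add: mult_components bil_zero bil_ident)
  show ?thesis
    unfolding hochschild_extension_def i_def[symmetric]
    using M_bimod cocycle_alg_algebra hom ker sq l r
    by (auto simp: Hom_iff cocycle_alg_def bil_def intro!: bexI[of _ s])
qed

text \<open>An algebra section has the form a -> (t a, a). The component in M of its
  multiplicativity reads t(a b) = a t(b) + t(a) b + w(a, b), that is, \<open>w\<close> is the
  coboundary of -t.\<close>

lemma coboundary_if_trivial:
  assumes "trivial_extension C cocycle_alg A p"
  shows "\<exists>t \<in> Hom C (alg_obj A) (bim_obj M). w = hoch_b1 C A M t"
proof -
  let ?X = "alg_obj A" and ?Y = "bim_obj M"
  obtain g where g: "alg_hom C A cocycle_alg g" "p \<cdot> g = \<i>\<d> ?X"
    using assms by (auto simp: trivial_extension_def)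
  have [simp]: "g \<in> Arr C" "Dom C g = ?X" "Cod C g = P"
    using g(1) by (auto simp: alg_hom_def Hom_iff cocycle_alg_def)
  have gm: "g \<cdot> alg_mult A = bil mult g g"
    using g(1) by (simp add: alg_hom_def cocycle_alg_def bil_def)
  define t where "t = q \<cdot> g"
  have [simp]: "t \<in> Arr C" "Dom C t = ?X" "Cod C t = ?Y"
    by (simp_all add: t_def)
  have "t \<cdot> alg_mult A = q \<cdot> bil mult g g"
    by (simp add: t_def gm)
  also have "\<dots> = ml (\<i>\<d> ?X) t \<oplus>\<^sub>a (mr t (\<i>\<d> ?X) \<oplus>\<^sub>a w)"
    by (simp add: mult_components g(2) t_def bil_ident)
  also have "\<dots> = w \<oplus>\<^sub>a (ml (\<i>\<d> ?X) t \<oplus>\<^sub>a mr t (\<i>\<d> ?X))"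
    by (simp add: plus_ac)
  finally have "t \<cdot> alg_mult A \<oplus>\<^sub>a neg (ml (\<i>\<d> ?X) t \<oplus>\<^sub>a mr t (\<i>\<d> ?X)) = w"
    by (subst diff_eq_iff) simp_all
  then have "w = hoch_b1 C A M (neg t)"
    by (simp add: hoch_b1_eq bil_neg plus_ac)
  then show ?thesis
    by (intro bexI[of _ "neg t"]) (simp_all add: Hom_iff)
qed

end

section \<open>From Hochschild extensions to sections and cohomology\<close>

context abelian_monoidal_category
begin

lemma hochschild_extensionE:
  assumes "hochschild_extension C B M E p i" "is_algebra C B"
  obtains s where "square_zero_extension C E B p s i" "Dom C i = bim_obj M"
    "i \<cdot> bim_left M = bil (alg_mult E) s i" "i \<cdot> bim_right M = bil (alg_mult E) i s"
proof -
  have *: "is_algebra C E" "alg_hom C E B p" "is_kernel C i p" "Dom C i = bim_obj M"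
    "alg_mult E \<cdot> (i \<otimes>\<^sub>a i) = \<zero>\<^sub>a (bim_obj M \<otimes>\<^sub>o bim_obj M) (alg_obj E)"
    using assms(1) by (auto simp: hochschild_extension_def Hom_iff)
  obtain s where s: "s \<in> Hom C (alg_obj B) (alg_obj E)" "p \<cdot> s = \<i>\<d> (alg_obj B)"
    "i \<cdot> bim_left M = alg_mult E \<cdot> (s \<otimes>\<^sub>a i)" "i \<cdot> bim_right M = alg_mult E \<cdot> (i \<otimes>\<^sub>a s)"
    using assms(1) unfolding hochschild_extension_def by blast
  have "square_zero_extension C E B p s i"
    by unfold_locales (use * s assms(2) in simp_all)
  then show thesis
    using that *(4) s(3,4) by (simp add: bil_def)
qed

lemma trivial_H2_if_trivial_extensions:
  assumes A: "is_algebra C A" and M: "is_bimodule C A M"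
    and triv: "\<And>E p i. hochschild_extension C A M E p i \<Longrightarrow> trivial_extension C E A p"
  shows "trivial_group (hoch_H2 C A M)"
  unfolding trivial_hoch_H2_iff[OF A M]
proof (intro ballI impI)
  fix w
  assume w: "w \<in> Hom C (alg_obj A \<otimes>\<^sub>o alg_obj A) (bim_obj M)"
    "hoch_b2 C A M w = \<zero>\<^sub>a ((alg_obj A \<otimes>\<^sub>o alg_obj A) \<otimes>\<^sub>o alg_obj A) (bim_obj M)"
  obtain P q p where "is_product C (bim_obj M) (alg_obj A) P q p"
    using ex_product is_algebra_typing(1)[OF A] is_bimodule_typing(1)[OF M] by blast
  then interpret hochschild_cocycle C A M w P q p
    by unfold_locales (use A M w in simp_all)
  show "\<exists>t \<in> Hom C (alg_obj A) (bim_obj M). w = hoch_b1 C A M t"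
    by (rule coboundary_if_trivial[OF triv[OF cocycle_alg_extension]])
qed

end

section \<open>Quotient algebras\<close>

context abelian_monoidal_category
begin

text \<open>By \<open>left\<close> and \<open>right\<close> the arrow \<open>g\<close> generates an
  ideal as far as \<open>p\<close> can see. The multiplication descends one factor at a time, using
  that each one-sided tensor product preserves the cokernel \<open>p\<close>; the algebra laws are
  then checked after composing with tensor powers of \<open>p\<close>, which are epi.\<close>

lemma quot_alg_algebra:
  assumes E: "is_algebra C E" and g: "g \<in> Arr C" "Cod C g = alg_obj E"
    and p: "p = coker_arr C (image_arr C g)"
    and left: "p \<cdot> bil (alg_mult E) g (\<i>\<d> (alg_obj E)) = \<zero>\<^sub>a (Dom C g \<otimes>\<^sub>o alg_obj E) (Cod C p)"
    and right: "p \<cdot> bil (alg_mult E) (\<i>\<d> (alg_obj E)) g = \<zero>\<^sub>a (alg_obj E \<otimes>\<^sub>o Dom C g) (Cod C p)"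
  defines "Q \<equiv> quot_alg C E (image_arr C g)"
  shows "is_cokernel C p g" "is_algebra C Q" "alg_hom C E Q p"
proof -
  note [simp] = g is_algebra_typing[OF E]
  show coker: "is_cokernel C p g"
    unfolding p by (rule coker_image_cokernel) simp
  note [simp] = cokernel_typing[OF coker]
  let ?M = "alg_mult E" and ?Y = "alg_obj E" and ?Q = "Cod C p"
  have "(p \<cdot> ?M) \<cdot> (g \<otimes>\<^sub>a \<i>\<d> ?Y) = \<zero>\<^sub>a (Dom C g \<otimes>\<^sub>o ?Y) ?Q"
    using left by (simp add: bil_def)
  then obtain m' where [simp]: "m' \<in> Arr C" "Dom C m' = ?Q \<otimes>\<^sub>o ?Y" "Cod C m' = ?Q"
    and m': "m' \<cdot> (p \<otimes>\<^sub>a \<i>\<d> ?Y) = p \<cdot> ?M"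
    using cokernel_factor[OF tens_cokernel_left[OF _ coker, of ?Y], of "p \<cdot> ?M"] by auto
  \<comment> \<open>The condition for descending in the second factor; the first factor is already a
    quotient, so it is checked after the epimorphism from \<open>E\<close>.\<close>
  have "m' \<cdot> (\<i>\<d> ?Q \<otimes>\<^sub>a g) = \<zero>\<^sub>a (?Q \<otimes>\<^sub>o Dom C g) ?Q"
  proof (rule epi_cancel[OF cokernel_tens_epi(1)[OF coker]])
    have "(m' \<cdot> (\<i>\<d> ?Q \<otimes>\<^sub>a g)) \<cdot> (p \<otimes>\<^sub>a \<i>\<d> (Dom C g)) = (m' \<cdot> (p \<otimes>\<^sub>a \<i>\<d> ?Y)) \<cdot> (\<i>\<d> ?Y \<otimes>\<^sub>a g)"
      by simp
    also have "\<dots> = \<zero>\<^sub>a (?Y \<otimes>\<^sub>o Dom C g) ?Q"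
      unfolding m' using right by (simp add: bil_def)
    finally show "(m' \<cdot> (\<i>\<d> ?Q \<otimes>\<^sub>a g)) \<cdot> (p \<otimes>\<^sub>a \<i>\<d> (Dom C g))
        = \<zero>\<^sub>a (?Q \<otimes>\<^sub>o Dom C g) ?Q \<cdot> (p \<otimes>\<^sub>a \<i>\<d> (Dom C g))"
      by simp
  qed simp_all
  then obtain m where [simp]: "m \<in> Arr C" "Dom C m = ?Q \<otimes>\<^sub>o ?Q" "Cod C m = ?Q"
    and m: "m \<cdot> (\<i>\<d> ?Q \<otimes>\<^sub>a p) = m'"
    using cokernel_factor[OF tens_cokernel_right[OF _ coker, of ?Q], of m'] by auto
  have mp: "m \<cdot> (p \<otimes>\<^sub>a p) = p \<cdot> ?M"
  proof -
    have "m \<cdot> (p \<otimes>\<^sub>a p) = (m \<cdot> (\<i>\<d> ?Q \<otimes>\<^sub>a p)) \<cdot> (p \<otimes>\<^sub>a \<i>\<d> ?Y)"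
      by simp
    then show ?thesis
      by (simp only: m m')
  qed
  have "(THE m. m \<in> Hom C (?Q \<otimes>\<^sub>o ?Q) ?Q \<and> m \<cdot> (p \<otimes>\<^sub>a p) = p \<cdot> ?M) = m"
  proof (rule the_equality)
    fix n assume "n \<in> Hom C (?Q \<otimes>\<^sub>o ?Q) ?Q \<and> n \<cdot> (p \<otimes>\<^sub>a p) = p \<cdot> ?M"
    then show "n = m"
      using epi_cancel[OF cokernel_tens_epi(3)[OF coker], of n m] by (simp add: Hom_iff mp)
  qed (simp add: Hom_iff mp)
  then have Q: "Q = \<lparr>alg_obj = ?Q, alg_mult = m, alg_unit = p \<cdot> alg_unit E\<rparr>"
    by (simp add: Q_def quot_alg_def Let_def p)
  show "alg_hom C E Q p"
    by (simp add: alg_hom_def Q Hom_iff mp)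
  have bil_m: "bil m (p \<cdot> a) (p \<cdot> b) = p \<cdot> bil ?M a b"
    if "a \<in> Arr C" "b \<in> Arr C" "Cod C a = ?Y" "Cod C b = ?Y" for a b
  proof -
    have "(m \<cdot> (p \<otimes>\<^sub>a p)) \<cdot> (a \<otimes>\<^sub>a b) = (p \<cdot> ?M) \<cdot> (a \<otimes>\<^sub>a b)"
      by (simp only: mp)
    then show ?thesis
      using that by (simp add: bil_def)
  qed
  have bil_m_id: "bil m p p = p \<cdot> ?M" "bil m p (p \<cdot> b) = p \<cdot> bil ?M (\<i>\<d> ?Y) b"
    "bil m (p \<cdot> b) p = p \<cdot> bil ?M b (\<i>\<d> ?Y)"
    if "b \<in> Arr C" "Cod C b = ?Y" for b
    using bil_m[of "\<i>\<d> ?Y" "\<i>\<d> ?Y"] bil_m[of "\<i>\<d> ?Y" b] bil_m[of b "\<i>\<d> ?Y"] that by (simp_all add: bil_ident)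
  have "bil m m (\<i>\<d> ?Q) = bil m (\<i>\<d> ?Q) m \<cdot> \<alpha> ?Q ?Q ?Q"
  proof (rule epi_cancel[OF cokernel_tens3_epi[OF coker]])
    have "bil m m (\<i>\<d> ?Q) \<cdot> ((p \<otimes>\<^sub>a p) \<otimes>\<^sub>a p) = p \<cdot> bil ?M ?M (\<i>\<d> ?Y)"
      by (simp add: bil_comp mp bil_m_id)
    also have "\<dots> = p \<cdot> bil ?M (\<i>\<d> ?Y) ?M \<cdot> \<alpha> ?Y ?Y ?Y"
      using alg_assoc[OF E, of "\<i>\<d> ?Y" "\<i>\<d> ?Y" "\<i>\<d> ?Y"] by (simp add: bil_ident)
    also have "\<dots> = (bil m (\<i>\<d> ?Q) m \<cdot> \<alpha> ?Q ?Q ?Q) \<cdot> ((p \<otimes>\<^sub>a p) \<otimes>\<^sub>a p)"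
      by (simp add: bil_comp mp bil_m_id)
    finally show "bil m m (\<i>\<d> ?Q) \<cdot> ((p \<otimes>\<^sub>a p) \<otimes>\<^sub>a p)
        = (bil m (\<i>\<d> ?Q) m \<cdot> \<alpha> ?Q ?Q ?Q) \<cdot> ((p \<otimes>\<^sub>a p) \<otimes>\<^sub>a p)" .
  qed simp_all
  moreover have "bil m (p \<cdot> alg_unit E) (\<i>\<d> ?Q) = \<l> ?Q"
  proof (rule epi_cancel[OF cokernel_tens_epi(2)[OF coker unit_Obj]])
    show "bil m (p \<cdot> alg_unit E) (\<i>\<d> ?Q) \<cdot> (\<i>\<d> \<I> \<otimes>\<^sub>a p) = \<l> ?Q \<cdot> (\<i>\<d> \<I> \<otimes>\<^sub>a p)"
      by (simp add: bil_comp bil_m_id alg_lunit[OF E])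
  qed simp_all
  moreover have "bil m (\<i>\<d> ?Q) (p \<cdot> alg_unit E) = \<r> ?Q"
  proof (rule epi_cancel[OF cokernel_tens_epi(1)[OF coker unit_Obj]])
    show "bil m (\<i>\<d> ?Q) (p \<cdot> alg_unit E) \<cdot> (p \<otimes>\<^sub>a \<i>\<d> \<I>) = \<r> ?Q \<cdot> (p \<otimes>\<^sub>a \<i>\<d> \<I>)"
      by (simp add: bil_comp bil_m_id alg_runit[OF E])
  qed simp_all
  ultimately show "is_algebra C Q"
    by (simp add: is_algebra_def Q Let_def Hom_iff bil_def)
qed

text \<open>Since \<open>p \<otimes>\<^sub>a p\<close> is epi, multiplicativity of \<open>v\<close>
  may be tested on products of values of \<open>p\<close>.\<close>

lemma alg_hom_cancel_epi:
  assumes "is_cokernel C p g" "alg_hom C E Q p" "is_algebra C E" "is_algebra C Q" "is_algebra C D"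
    and v: "v \<in> Hom C (alg_obj Q) (alg_obj D)" "alg_hom C E D (v \<cdot> p)"
  shows "alg_hom C Q D v"
proof -
  note [simp] = cokernel_typing(1-3)[OF assms(1)] is_algebra_typing[OF assms(3)]
    is_algebra_typing[OF assms(4)] is_algebra_typing[OF assms(5)] alg_hom_typing(2-4)[OF assms(2)]
  have [simp]: "v \<in> Arr C" "Dom C v = alg_obj Q" "Cod C v = alg_obj D"
    using v by (auto simp: Hom_iff)
  have Dg: "Cod C g = alg_obj E"
    using alg_hom_typing(2)[OF assms(2)] by simp
  have "v \<cdot> alg_mult Q = alg_mult D \<cdot> (v \<otimes>\<^sub>a v)"
  proof (rule epi_cancel[OF cokernel_tens_epi(3)[OF assms(1)]])
    have "(v \<cdot> alg_mult Q) \<cdot> (p \<otimes>\<^sub>a p) = v \<cdot> bil (alg_mult Q) p p"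
      by (simp add: bil_def Dg)
    also have "\<dots> = v \<cdot> p \<cdot> alg_mult E"
      using alg_hom_bil[OF assms(2-4), of "\<i>\<d> (alg_obj E)" "\<i>\<d> (alg_obj E)"] by (simp add: bil_ident Dg)
    also have "\<dots> = (v \<cdot> p) \<cdot> alg_mult E"
      by (simp add: Dg)
    also have "\<dots> = alg_mult D \<cdot> ((v \<cdot> p) \<otimes>\<^sub>a (v \<cdot> p))"
      using v(2) unfolding alg_hom_def by blast
    finally show "(v \<cdot> alg_mult Q) \<cdot> (p \<otimes>\<^sub>a p) = (alg_mult D \<cdot> (v \<otimes>\<^sub>a v)) \<cdot> (p \<otimes>\<^sub>a p)"
      by (simp add: Dg)
  qed (simp_all add: Dg)
  moreover have "v \<cdot> alg_unit Q = alg_unit D"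
  proof -
    have "(v \<cdot> p) \<cdot> alg_unit E = alg_unit D"
      using v(2) unfolding alg_hom_def by blast
    then show ?thesis
      by (simp add: Dg)
  qed
  ultimately show ?thesis
    by (simp add: alg_hom_def Hom_iff)
qed

lemma quot_alg_factor:
  assumes "is_cokernel C p g" "alg_hom C E Q p" "is_algebra C E" "is_algebra C Q" "is_algebra C D"
    and v: "alg_hom C E D v" "v \<cdot> g = \<zero>\<^sub>a (Dom C g) (alg_obj D)"
  obtains v' where "alg_hom C Q D v'" "v' \<cdot> p = v"
proof -
  have "Cod C g = alg_obj E"
    using cokernel_typing(3)[OF assms(1)] alg_hom_typing(2)[OF assms(2)] by simp
  then obtain v' where v': "v' \<in> Arr C" "Dom C v' = Cod C p" "Cod C v' = alg_obj D" "v' \<cdot> p = v"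
    using cokernel_factor[OF assms(1), of v] v alg_hom_typing[OF v(1)] by auto
  moreover have "alg_hom C Q D v'"
    by (rule alg_hom_cancel_epi[OF assms(1-5)])
      (use v' v alg_hom_typing[OF assms(2)] in \<open>simp_all add: Hom_iff\<close>)
  ultimately show thesis
    using that by blast
qed

text \<open>The arrow \<open>g\<close> is (x, z) -> x h z. By associativity its product with an
  element of \<open>E\<close>, on either side, factors through \<open>g\<close> again up to
  rebracketing, so it is killed by the cokernel of \<open>g\<close>.\<close>

lemma gen_ideal_quot:
  assumes E: "is_algebra C E" and h: "h \<in> Arr C" "Dom C h = \<I>" "Cod C h = alg_obj E"
  defines "g \<equiv> bil (alg_mult E) (bil (alg_mult E) (\<i>\<d> (alg_obj E)) h) (\<i>\<d> (alg_obj E))"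
    and "p \<equiv> coker_arr C (gen_ideal C E h)" and "Q \<equiv> quot_alg C E (gen_ideal C E h)"
  shows "is_cokernel C p g" "is_algebra C Q" "alg_hom C E Q p"
proof -
  note [simp] = h is_algebra_typing[OF E]
  let ?M = "alg_mult E" and ?Y = "alg_obj E"
  have image: "gen_ideal C E h = image_arr C g"
    by (simp add: gen_ideal_def g_def bil_def Let_def)
  have [simp]: "g \<in> Arr C" "Dom C g = (?Y \<otimes>\<^sub>o \<I>) \<otimes>\<^sub>o ?Y" "Cod C g = ?Y"
    by (simp_all add: g_def)
  have p: "p = coker_arr C (image_arr C g)"
    by (simp add: p_def image)
  have coker: "is_cokernel C p g"
    unfolding p by (rule coker_image_cokernel) simp
  note [simp] = cokernel_typing[OF coker]
  have pg: "p \<cdot> g \<cdot> w = \<zero>\<^sub>a (Dom C w) (Cod C p)" if "w \<in> Arr C" "Cod C w = (?Y \<otimes>\<^sub>o \<I>) \<otimes>\<^sub>o ?Y" for w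
    using that by (simp add: comp_reassoc)
  have "bil ?M g (\<i>\<d> ?Y) = bil ?M (bil ?M (\<i>\<d> ?Y) h) ?M \<cdot> \<alpha> (?Y \<otimes>\<^sub>o \<I>) ?Y ?Y"
    by (simp add: g_def alg_assoc[OF E, of "bil ?M (\<i>\<d> ?Y) h"] bil_ident)
  also have "\<dots> = g \<cdot> (\<i>\<d> (?Y \<otimes>\<^sub>o \<I>) \<otimes>\<^sub>a ?M) \<cdot> \<alpha> (?Y \<otimes>\<^sub>o \<I>) ?Y ?Y"
    by (simp add: g_def bil_comp)
  finally have left: "p \<cdot> bil ?M g (\<i>\<d> ?Y) = \<zero>\<^sub>a (Dom C g \<otimes>\<^sub>o ?Y) (Cod C p)"
    by (simp add: pg)
  \<comment> \<open>For products from the left the associators stand on the other side, so the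
    identity is shown after this rebracketing isomorphism, which is cancelled later.\<close>
  let ?a = "\<alpha> ?Y (?Y \<otimes>\<^sub>o \<I>) ?Y \<cdot> (\<alpha> ?Y ?Y \<I> \<otimes>\<^sub>a \<i>\<d> ?Y)"
  have "bil ?M (\<i>\<d> ?Y) g \<cdot> ?a
      = bil ?M (bil ?M (\<i>\<d> ?Y) (bil ?M (\<i>\<d> ?Y) h)) (\<i>\<d> ?Y) \<cdot> (\<alpha> ?Y ?Y \<I> \<otimes>\<^sub>a \<i>\<d> ?Y)"
    using alg_assoc[OF E, of "\<i>\<d> ?Y" "bil ?M (\<i>\<d> ?Y) h" "\<i>\<d> ?Y"] by (simp add: g_def)
  also have "\<dots> = bil ?M (bil ?M (\<i>\<d> ?Y) (bil ?M (\<i>\<d> ?Y) h) \<cdot> \<alpha> ?Y ?Y \<I>) (\<i>\<d> ?Y)"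
    by (simp add: bil_comp)
  also have "bil ?M (\<i>\<d> ?Y) (bil ?M (\<i>\<d> ?Y) h) \<cdot> \<alpha> ?Y ?Y \<I> = bil ?M ?M h"
    using alg_assoc[OF E, of "\<i>\<d> ?Y" "\<i>\<d> ?Y" h] by (simp add: bil_ident)
  also have "bil ?M (bil ?M ?M h) (\<i>\<d> ?Y) = g \<cdot> ((?M \<otimes>\<^sub>a \<i>\<d> \<I>) \<otimes>\<^sub>a \<i>\<d> ?Y)"
    by (simp add: g_def bil_comp)
  finally have "(p \<cdot> bil ?M (\<i>\<d> ?Y) g) \<cdot> ?a = \<zero>\<^sub>a (?Y \<otimes>\<^sub>o Dom C g) (Cod C p) \<cdot> ?a"
    by (simp add: pg)
  then have right: "p \<cdot> bil ?M (\<i>\<d> ?Y) g = \<zero>\<^sub>a (?Y \<otimes>\<^sub>o Dom C g) (Cod C p)"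
    by (rule iso_cancel_right[rotated]) (simp_all add: iso_comp tens_iso)
  show "is_cokernel C p g" "is_algebra C Q" "alg_hom C E Q p"
    unfolding Q_def image by (rule quot_alg_algebra[OF E _ _ p left right]; simp)+
qed

text \<open>A kernel of an algebra map absorbs products: \<open>x\<close> and \<open>y\<close>
  express those with an element of \<open>E\<close> on the right and on the left through
  \<open>e\<close>. Moving the brackets, the product of such an element with a product of two kernel
  elements again factors through \<open>g\<close>.\<close>

lemma ideal_square_quot:
  assumes E: "is_algebra C E" and B: "is_algebra C B" and f: "alg_hom C E B f" and e: "is_kernel C e f"
  defines "g \<equiv> bil (alg_mult E) e e"
    and "p \<equiv> coker_arr C (ideal_square C E e)" and "Q \<equiv> quot_alg C E (ideal_square C E e)"
  shows "is_cokernel C p g" "is_algebra C Q" "alg_hom C E Q p"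
proof -
  note [simp] = is_algebra_typing[OF E] is_algebra_typing[OF B] alg_hom_typing[OF f]
    kernel_typing[OF e, simplified alg_hom_typing[OF f]]
  let ?M = "alg_mult E" and ?Y = "alg_obj E"
  have image: "ideal_square C E e = image_arr C g"
    by (simp add: ideal_square_def g_def bil_def)
  have [simp]: "g \<in> Arr C" "Dom C g = Dom C e \<otimes>\<^sub>o Dom C e" "Cod C g = ?Y"
    by (simp_all add: g_def)
  have p: "p = coker_arr C (image_arr C g)"
    by (simp add: p_def image)
  have coker: "is_cokernel C p g"
    unfolding p by (rule coker_image_cokernel) simp
  note [simp] = cokernel_typing[OF coker]
  have pg: "p \<cdot> g \<cdot> w = \<zero>\<^sub>a (Dom C w) (Cod C p)" if "w \<in> Arr C" "Cod C w = Dom C e \<otimes>\<^sub>o Dom C e" for w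
    using that by (simp add: comp_reassoc)
  have zero: "f \<cdot> bil ?M e (\<i>\<d> ?Y) = \<zero>\<^sub>a (Dom C e \<otimes>\<^sub>o ?Y) (alg_obj B)"
    "f \<cdot> bil ?M (\<i>\<d> ?Y) e = \<zero>\<^sub>a (?Y \<otimes>\<^sub>o Dom C e) (alg_obj B)"
    by (simp_all add: alg_hom_bil[OF f E B] bil_zero)
  obtain x where [simp]: "x \<in> Arr C" "Dom C x = Dom C e \<otimes>\<^sub>o ?Y" "Cod C x = Dom C e"
    and x: "e \<cdot> x = bil ?M e (\<i>\<d> ?Y)"
    using kernel_factor[OF e, of "bil ?M e (\<i>\<d> ?Y)"] zero(1) by auto
  obtain y where [simp]: "y \<in> Arr C" "Dom C y = ?Y \<otimes>\<^sub>o Dom C e" "Cod C y = Dom C e"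
    and y: "e \<cdot> y = bil ?M (\<i>\<d> ?Y) e"
    using kernel_factor[OF e, of "bil ?M (\<i>\<d> ?Y) e"] zero(2) by auto
  have "bil ?M g (\<i>\<d> ?Y) = g \<cdot> (\<i>\<d> (Dom C e) \<otimes>\<^sub>a x) \<cdot> \<alpha> (Dom C e) (Dom C e) ?Y"
    by (simp add: g_def alg_assoc[OF E] bil_comp x)
  then have left: "p \<cdot> bil ?M g (\<i>\<d> ?Y) = \<zero>\<^sub>a (Dom C g \<otimes>\<^sub>o ?Y) (Cod C p)"
    by (simp add: pg)
  have "bil ?M (\<i>\<d> ?Y) g \<cdot> \<alpha> ?Y (Dom C e) (Dom C e) = g \<cdot> (y \<otimes>\<^sub>a \<i>\<d> (Dom C e))"
    using alg_assoc[OF E, of "\<i>\<d> ?Y" e e] by (simp add: g_def bil_comp y)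
  then have "(p \<cdot> bil ?M (\<i>\<d> ?Y) g) \<cdot> \<alpha> ?Y (Dom C e) (Dom C e)
      = \<zero>\<^sub>a (?Y \<otimes>\<^sub>o Dom C g) (Cod C p) \<cdot> \<alpha> ?Y (Dom C e) (Dom C e)"
    by (simp add: pg)
  then have right: "p \<cdot> bil ?M (\<i>\<d> ?Y) g = \<zero>\<^sub>a (?Y \<otimes>\<^sub>o Dom C g) (Cod C p)"
    by (rule iso_cancel_right[rotated]) simp_all
  show "is_cokernel C p g" "is_algebra C Q" "alg_hom C E Q p"
    unfolding Q_def image by (rule quot_alg_algebra[OF E _ _ p left right]; simp)+
qed

end

section \<open>The tensor algebra\<close>

locale tensor_algebra_category = abelian_monoidal_category C
  for C :: "('o, 'a, 'z) mon_cat_scheme" (structure) +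
  assumes denumerable_coproducts: "tensor_denumerable_coproducts C"
begin

lemma coproduct_tens:
  assumes "is_seq_coproduct C F S j" "X \<in> Obj C" "\<And>n. F n \<in> Obj C"
  shows "is_seq_coproduct C (\<lambda>n. X \<otimes>\<^sub>o F n) (X \<otimes>\<^sub>o S) (\<lambda>n. \<i>\<d> X \<otimes>\<^sub>a j n)"
    "is_seq_coproduct C (\<lambda>n. F n \<otimes>\<^sub>o X) (S \<otimes>\<^sub>o X) (\<lambda>n. j n \<otimes>\<^sub>a \<i>\<d> X)"
  using denumerable_coproducts assms unfolding tensor_denumerable_coproducts_def by blast+

lemma coproduct_ex1:
  assumes "is_seq_coproduct C F S j" "W \<in> Obj C" "\<And>n. f n \<in> Hom C (F n) W"
  shows "\<exists>!h. h \<in> Hom C S W \<and> (\<forall>n. h \<cdot> j n = f n)"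
  using assms by (simp add: is_seq_coproduct_def)

lemma coproduct_factor:
  assumes "is_seq_coproduct C F S j" "W \<in> Obj C"
    "\<And>n. f n \<in> Arr C" "\<And>n. Dom C (f n) = F n" "\<And>n. Cod C (f n) = W"
  obtains h where "h \<in> Arr C" "Dom C h = S" "Cod C h = W" "\<And>n. h \<cdot> j n = f n"
proof -
  have "\<exists>!h. h \<in> Hom C S W \<and> (\<forall>n. h \<cdot> j n = f n)"
    by (rule coproduct_ex1[OF assms(1,2)]) (simp add: Hom_iff assms(3-5))
  then show thesis
    using that by (auto simp: Hom_iff)
qed

lemma coproduct_cancel:
  assumes "is_seq_coproduct C F S j" "\<And>n. h \<cdot> j n = k \<cdot> j n" "h \<in> Arr C" "k \<in> Arr C"
    "Dom C h = S" "Dom C k = S" "Cod C h = Cod C k"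
  shows "h = k"
proof -
  have j: "j n \<in> Arr C" "Dom C (j n) = F n" "Cod C (j n) = S" for n
    using assms(1) by (auto simp: is_seq_coproduct_def Hom_iff)
  have "\<exists>!x. x \<in> Hom C S (Cod C h) \<and> (\<forall>n. x \<cdot> j n = h \<cdot> j n)"
    by (rule coproduct_ex1[OF assms(1)]) (use assms(3-) in \<open>simp_all add: Hom_iff j\<close>)
  moreover have "h \<in> Hom C S (Cod C h)" "k \<in> Hom C S (Cod C h)"
    using assms(3-) by (simp_all add: Hom_iff)
  ultimately show ?thesis
    using assms(2) by (metis (no_types, lifting))
qed

section \<open>The tensor algebra of a fixed object\<close>

context
  fixes X :: 'o
  assumes X_Obj [simp]: "X \<in> Obj C"
begin

lemma tens_pow_Obj [simp]: "tens_pow C X n \<in> Obj C"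
  by (induction n) simp_all

lemma tens_pow_cat_typing [simp]:
  "tens_pow_cat C X p q \<in> Arr C" "Dom C (tens_pow_cat C X p q) = tens_pow C X p \<otimes>\<^sub>o tens_pow C X q"
  "Cod C (tens_pow_cat C X p q) = tens_pow C X (p + q)"
  by (induction p) simp_all

text \<open>Induction on \<open>p\<close>: the base case is Kelly's law \<open>lunit_tens\<close>,
  and the step is the pentagon at \<open>X\<close> and the three tensor powers.\<close>

lemma tens_pow_cat_assoc:
  "tens_pow_cat C X (p + q) r \<cdot> (tens_pow_cat C X p q \<otimes>\<^sub>a \<i>\<d> (tens_pow C X r))
    = tens_pow_cat C X p (q + r) \<cdot> (\<i>\<d> (tens_pow C X p) \<otimes>\<^sub>a tens_pow_cat C X q r)
      \<cdot> \<alpha> (tens_pow C X p) (tens_pow C X q) (tens_pow C X r)"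
proof (induction p)
  case 0
  show ?case
    by (simp add: lunit_tens)
next
  case (Suc p)
  let ?F = "tens_pow C X" and ?c = "tens_pow_cat C X"
  have "?c (Suc p + q) r \<cdot> (?c (Suc p) q \<otimes>\<^sub>a \<i>\<d> (?F r))
      = (\<i>\<d> X \<otimes>\<^sub>a ?c (p + q) r) \<cdot> \<alpha> X (?F (p + q)) (?F r) \<cdot> ((\<i>\<d> X \<otimes>\<^sub>a ?c p q) \<otimes>\<^sub>a \<i>\<d> (?F r))
        \<cdot> (\<alpha> X (?F p) (?F q) \<otimes>\<^sub>a \<i>\<d> (?F r))"
    by (simp add: tens_merge(1)[of "\<alpha> X (?F p) (?F q)"])
  also have "\<dots> = (\<i>\<d> X \<otimes>\<^sub>a (?c (p + q) r \<cdot> (?c p q \<otimes>\<^sub>a \<i>\<d> (?F r))))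
        \<cdot> \<alpha> X (?F p \<otimes>\<^sub>o ?F q) (?F r) \<cdot> (\<alpha> X (?F p) (?F q) \<otimes>\<^sub>a \<i>\<d> (?F r))"
    by (subst assoc_nat(2)) simp_all
  also have "\<dots> = (\<i>\<d> X \<otimes>\<^sub>a (?c p (q + r) \<cdot> (\<i>\<d> (?F p) \<otimes>\<^sub>a ?c q r)))
        \<cdot> (\<i>\<d> X \<otimes>\<^sub>a \<alpha> (?F p) (?F q) (?F r)) \<cdot> \<alpha> X (?F p \<otimes>\<^sub>o ?F q) (?F r)
        \<cdot> (\<alpha> X (?F p) (?F q) \<otimes>\<^sub>a \<i>\<d> (?F r))"
    unfolding Suc.IH by (simp add: add.assoc)
  also have "\<dots> = (\<i>\<d> X \<otimes>\<^sub>a (?c p (q + r) \<cdot> (\<i>\<d> (?F p) \<otimes>\<^sub>a ?c q r)))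
        \<cdot> \<alpha> X (?F p) (?F q \<otimes>\<^sub>o ?F r) \<cdot> \<alpha> (X \<otimes>\<^sub>o ?F p) (?F q) (?F r)"
    by (simp only: pentagon[symmetric] X_Obj tens_pow_Obj)
  also have "\<dots> = (\<i>\<d> X \<otimes>\<^sub>a ?c p (q + r)) \<cdot> ((\<i>\<d> X \<otimes>\<^sub>a (\<i>\<d> (?F p) \<otimes>\<^sub>a ?c q r))
        \<cdot> \<alpha> X (?F p) (?F q \<otimes>\<^sub>o ?F r)) \<cdot> \<alpha> (X \<otimes>\<^sub>o ?F p) (?F q) (?F r)"
    by simp
  \<comment> \<open>Naturality of the associator, read against its rewriting direction to expose
    \<open>?c (Suc p) (q + r)\<close>. The next step therefore disables the rules that would reverse
    it.\<close>
  also have "(\<i>\<d> X \<otimes>\<^sub>a (\<i>\<d> (?F p) \<otimes>\<^sub>a ?c q r)) \<cdot> \<alpha> X (?F p) (?F q \<otimes>\<^sub>o ?F r)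
      = \<alpha> X (?F p) (?F (q + r)) \<cdot> (\<i>\<d> (X \<otimes>\<^sub>o ?F p) \<otimes>\<^sub>a ?c q r)"
    by simp
  also have "(\<i>\<d> X \<otimes>\<^sub>a ?c p (q + r)) \<cdot> (\<alpha> X (?F p) (?F (q + r)) \<cdot> (\<i>\<d> (X \<otimes>\<^sub>o ?F p) \<otimes>\<^sub>a ?c q r))
        \<cdot> \<alpha> (X \<otimes>\<^sub>o ?F p) (?F q) (?F r)
      = ?c (Suc p) (q + r) \<cdot> (\<i>\<d> (?F (Suc p)) \<otimes>\<^sub>a ?c q r) \<cdot> \<alpha> (?F (Suc p)) (?F q) (?F r)"
    by (simp del: assoc_nat assoc_nat_ident)
  finally show ?case .
qed

lemma tens_pow_cat_unit: "tens_pow_cat C X p 0 = \<r> (tens_pow C X p)"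
  by (induction p) (simp_all add: lunit_unit runit_tens)

abbreviation "tobj \<equiv> alg_obj (tens_alg C X)"
abbreviation "tinj \<equiv> tens_alg_inj C X"
abbreviation "tmul \<equiv> alg_mult (tens_alg C X)"

lemma tens_alg_coproduct: "is_seq_coproduct C (tens_pow C X) tobj tinj"
proof -
  have "\<exists>z. case z of (S, j) \<Rightarrow> is_seq_coproduct C (tens_pow C X) S j"
    using denumerable_coproducts tens_pow_Obj unfolding tensor_denumerable_coproducts_def by fastforce
  then have "case tens_alg_coprod C X of (S, j) \<Rightarrow> is_seq_coproduct C (tens_pow C X) S j"
    unfolding tens_alg_coprod_def by (rule someI_ex)
  then show ?thesis
    by (simp add: tens_alg_inj_def tens_alg_def Let_def case_prod_beta)
qed

lemma tinj_typing [simp]: "tobj \<in> Obj C" "tinj n \<in> Arr C" "Dom C (tinj n) = tens_pow C X n"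
  "Cod C (tinj n) = tobj"
  using tens_alg_coproduct by (auto simp: is_seq_coproduct_def Hom_iff)

lemmas tens2_coproduct =
  coproduct_tens(1)[OF tens_alg_coproduct tens_pow_Obj tens_pow_Obj]
  coproduct_tens(2)[OF tens_alg_coproduct tinj_typing(1) tens_pow_Obj]

text \<open>Tensoring preserves the coproduct in each variable, so the square of the tensor algebra
  is an iterated coproduct of products of tensor powers.\<close>

lemma tens2_cancel:
  assumes "\<And>p q. h \<cdot> (tinj p \<otimes>\<^sub>a tinj q) = k \<cdot> (tinj p \<otimes>\<^sub>a tinj q)"
    and [simp]: "h \<in> Arr C" "k \<in> Arr C" "Dom C h = tobj \<otimes>\<^sub>o tobj" "Dom C k = tobj \<otimes>\<^sub>o tobj"
      "Cod C h = Cod C k"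
  shows "h = k"
proof (rule coproduct_cancel[OF tens2_coproduct(2)])
  fix p
  show "h \<cdot> (tinj p \<otimes>\<^sub>a \<i>\<d> tobj) = k \<cdot> (tinj p \<otimes>\<^sub>a \<i>\<d> tobj)"
    by (rule coproduct_cancel[OF tens2_coproduct(1)]) (simp_all add: assms(1))
qed simp_all

lemma tens3_cancel:
  assumes "\<And>p q r. h \<cdot> ((tinj p \<otimes>\<^sub>a tinj q) \<otimes>\<^sub>a tinj r) = k \<cdot> ((tinj p \<otimes>\<^sub>a tinj q) \<otimes>\<^sub>a tinj r)"
    and [simp]: "h \<in> Arr C" "k \<in> Arr C" "Dom C h = (tobj \<otimes>\<^sub>o tobj) \<otimes>\<^sub>o tobj"
      "Dom C k = (tobj \<otimes>\<^sub>o tobj) \<otimes>\<^sub>o tobj" "Cod C h = Cod C k"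
  shows "h = k"
proof (rule coproduct_cancel[OF coproduct_tens(1)[OF tens_alg_coproduct, of "tobj \<otimes>\<^sub>o tobj"]])
  fix r
  show "h \<cdot> (\<i>\<d> (tobj \<otimes>\<^sub>o tobj) \<otimes>\<^sub>a tinj r) = k \<cdot> (\<i>\<d> (tobj \<otimes>\<^sub>o tobj) \<otimes>\<^sub>a tinj r)"
  proof (rule coproduct_cancel[OF coproduct_tens(2)[OF tens2_coproduct(2), of "tens_pow C X r"]])
    fix p
    show "(h \<cdot> (\<i>\<d> (tobj \<otimes>\<^sub>o tobj) \<otimes>\<^sub>a tinj r)) \<cdot> ((tinj p \<otimes>\<^sub>a \<i>\<d> tobj) \<otimes>\<^sub>a \<i>\<d> (tens_pow C X r))
        = (k \<cdot> (\<i>\<d> (tobj \<otimes>\<^sub>o tobj) \<otimes>\<^sub>a tinj r)) \<cdot> ((tinj p \<otimes>\<^sub>a \<i>\<d> tobj) \<otimes>\<^sub>a \<i>\<d> (tens_pow C X r))"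
      by (rule coproduct_cancel[OF coproduct_tens(2)[OF tens2_coproduct(1), of "tens_pow C X r"]])
        (simp_all add: assms(1))
  qed simp_all
qed simp_all

lemma tens2_factor:
  assumes W: "W \<in> Obj C" and f: "\<And>p q. f p q \<in> Arr C"
    "\<And>p q. Dom C (f p q) = tens_pow C X p \<otimes>\<^sub>o tens_pow C X q" "\<And>p q. Cod C (f p q) = W"
  obtains h where "h \<in> Arr C" "Dom C h = tobj \<otimes>\<^sub>o tobj" "Cod C h = W"
    "\<And>p q. h \<cdot> (tinj p \<otimes>\<^sub>a tinj q) = f p q"
proof -
  have "\<exists>h. h \<in> Arr C \<and> Dom C h = tens_pow C X p \<otimes>\<^sub>o tobj \<and> Cod C h = W \<and>
      (\<forall>q. h \<cdot> (\<i>\<d> (tens_pow C X p) \<otimes>\<^sub>a tinj q) = f p q)" for p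
    using coproduct_factor[OF tens2_coproduct(1)[of p] W, of "f p"] f by metis
  then obtain g where g: "\<And>p. g p \<in> Arr C" "\<And>p. Dom C (g p) = tens_pow C X p \<otimes>\<^sub>o tobj"
      "\<And>p. Cod C (g p) = W" "\<And>p q. g p \<cdot> (\<i>\<d> (tens_pow C X p) \<otimes>\<^sub>a tinj q) = f p q"
    by metis
  obtain h where h: "h \<in> Arr C" "Dom C h = tobj \<otimes>\<^sub>o tobj" "Cod C h = W"
      "\<And>p. h \<cdot> (tinj p \<otimes>\<^sub>a \<i>\<d> tobj) = g p"
    using coproduct_factor[OF tens2_coproduct(2) W, of g] g by metis
  have "h \<cdot> (tinj p \<otimes>\<^sub>a tinj q) = f p q" for p q
  proof -
    have "h \<cdot> (tinj p \<otimes>\<^sub>a tinj q) = (h \<cdot> (tinj p \<otimes>\<^sub>a \<i>\<d> tobj)) \<cdot> (\<i>\<d> (tens_pow C X p) \<otimes>\<^sub>a tinj q)"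
      using h(1-3) by simp
    then show ?thesis
      by (simp only: h(4) g(4))
  qed
  then show thesis
    using that h by blast
qed

text \<open>The description of the multiplication by \<open>THE\<close> is legitimate:
  \<open>tens2_factor\<close> gives existence, \<open>tens2_cancel\<close> uniqueness.\<close>

lemma tmul_typing [simp]: "tmul \<in> Arr C" "Dom C tmul = tobj \<otimes>\<^sub>o tobj" "Cod C tmul = tobj"
  and tmul_tinj: "bil tmul (tinj p) (tinj q) = tinj (p + q) \<cdot> tens_pow_cat C X p q"
proof -
  let ?P = "\<lambda>m. m \<in> Hom C (tobj \<otimes>\<^sub>o tobj) tobj \<and>
    (\<forall>p q. m \<cdot> (tinj p \<otimes>\<^sub>a tinj q) = tinj (p + q) \<cdot> tens_pow_cat C X p q)"
  obtain m where "m \<in> Arr C" "Dom C m = tobj \<otimes>\<^sub>o tobj" "Cod C m = tobj"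
    "\<And>p q. m \<cdot> (tinj p \<otimes>\<^sub>a tinj q) = tinj (p + q) \<cdot> tens_pow_cat C X p q"
    by (rule tens2_factor[of tobj "\<lambda>p q. tinj (p + q) \<cdot> tens_pow_cat C X p q"]) simp_all
  then have m: "?P m"
    by (simp add: Hom_iff)
  have uniq: "n = m" if "?P n" for n
    by (rule tens2_cancel) (use m that in \<open>simp_all add: Hom_iff\<close>)
  have "tmul = (THE m. ?P m)"
    by (simp add: tens_alg_def Let_def)
  also have "\<dots> = m"
    using m uniq by (rule the_equality)
  finally have "?P tmul"
    using m by simp
  then show "tmul \<in> Arr C" "Dom C tmul = tobj \<otimes>\<^sub>o tobj" "Cod C tmul = tobj"
    "bil tmul (tinj p) (tinj q) = tinj (p + q) \<cdot> tens_pow_cat C X p q"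
    by (auto simp: Hom_iff bil_def)
qed

lemma tens_alg_unit: "alg_unit (tens_alg C X) = tinj 0"
  by (simp add: tens_alg_def Let_def)

lemma tens_alg_algebra: "is_algebra C (tens_alg C X)"
proof -
  let ?F = "tens_pow C X" and ?c = "tens_pow_cat C X"
  have "bil tmul tmul (\<i>\<d> tobj) = bil tmul (\<i>\<d> tobj) tmul \<cdot> \<alpha> tobj tobj tobj"
  proof (rule tens3_cancel)
    fix p q r
    have "bil tmul tmul (\<i>\<d> tobj) \<cdot> ((tinj p \<otimes>\<^sub>a tinj q) \<otimes>\<^sub>a tinj r)
        = bil tmul (bil tmul (tinj p) (tinj q)) (tinj r)"
      by (simp add: bil_def)
    also have "\<dots> = bil tmul (tinj (p + q)) (tinj r) \<cdot> (?c p q \<otimes>\<^sub>a \<i>\<d> (?F r))"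
      by (simp add: tmul_tinj[of p q] bil_comp)
    also have "\<dots> = tinj (p + q + r) \<cdot> ?c p (q + r) \<cdot> (\<i>\<d> (?F p) \<otimes>\<^sub>a ?c q r) \<cdot> \<alpha> (?F p) (?F q) (?F r)"
      by (simp add: tmul_tinj tens_pow_cat_assoc)
    also have "\<dots> = (bil tmul (tinj p) (tinj (q + r)) \<cdot> (\<i>\<d> (?F p) \<otimes>\<^sub>a ?c q r)) \<cdot> \<alpha> (?F p) (?F q) (?F r)"
      by (simp add: tmul_tinj add.assoc)
    also have "\<dots> = bil tmul (tinj p) (bil tmul (tinj q) (tinj r)) \<cdot> \<alpha> (?F p) (?F q) (?F r)"
      by (simp add: tmul_tinj[of q r] bil_comp)
    also have "\<dots> = (bil tmul (\<i>\<d> tobj) tmul \<cdot> \<alpha> tobj tobj tobj) \<cdot> ((tinj p \<otimes>\<^sub>a tinj q) \<otimes>\<^sub>a tinj r)"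
      by (simp add: bil_def)
    finally show "bil tmul tmul (\<i>\<d> tobj) \<cdot> ((tinj p \<otimes>\<^sub>a tinj q) \<otimes>\<^sub>a tinj r)
        = (bil tmul (\<i>\<d> tobj) tmul \<cdot> \<alpha> tobj tobj tobj) \<cdot> ((tinj p \<otimes>\<^sub>a tinj q) \<otimes>\<^sub>a tinj r)" .
  qed simp_all
  moreover have "bil tmul (tinj 0) (\<i>\<d> tobj) = \<l> tobj"
  proof (rule coproduct_cancel[OF coproduct_tens(1)[OF tens_alg_coproduct unit_Obj]])
    show "bil tmul (tinj 0) (\<i>\<d> tobj) \<cdot> (\<i>\<d> \<I> \<otimes>\<^sub>a tinj n) = \<l> tobj \<cdot> (\<i>\<d> \<I> \<otimes>\<^sub>a tinj n)" for n
      by (simp add: bil_comp tmul_tinj)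
  qed simp_all
  moreover have "bil tmul (\<i>\<d> tobj) (tinj 0) = \<r> tobj"
  proof (rule coproduct_cancel[OF coproduct_tens(2)[OF tens_alg_coproduct unit_Obj]])
    show "bil tmul (\<i>\<d> tobj) (tinj 0) \<cdot> (tinj n \<otimes>\<^sub>a \<i>\<d> \<I>) = \<r> tobj \<cdot> (tinj n \<otimes>\<^sub>a \<i>\<d> \<I>)" for n
      by (simp add: bil_comp tmul_tinj tens_pow_cat_unit)
  qed simp_all
  ultimately show ?thesis
    by (simp add: is_algebra_def Let_def Hom_iff tens_alg_unit bil_def)
qed

abbreviation "tgen \<equiv> tens_alg_gen C X"

lemma tgen_typing [simp]: "tgen \<in> Arr C" "Dom C tgen = X" "Cod C tgen = tobj"
  by (simp_all add: tens_alg_gen_def)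

text \<open>Degree n + 1 is reached from degree n by multiplying with a generator, so algebra maps
  that agree on generators agree in each degree by induction.\<close>

lemma tgen_tinj: "bil tmul tgen (tinj n) = tinj (Suc n)"
proof -
  have "bil tmul tgen (tinj n)
      = bil tmul (tinj 1) (tinj n) \<cdot> (arr_inv C (\<r> X) \<otimes>\<^sub>a \<i>\<d> (tens_pow C X n))"
    by (simp add: tens_alg_gen_def bil_comp)
  also have "\<dots> = tinj (Suc n) \<cdot> (\<r> X \<otimes>\<^sub>a \<i>\<d> (tens_pow C X n)) \<cdot> (arr_inv C (\<r> X) \<otimes>\<^sub>a \<i>\<d> (tens_pow C X n))"
    unfolding tmul_tinj by (simp add: triangle del: tens_merge)
  also have "\<dots> = tinj (Suc n)"
    by simp
  finally show ?thesis .
qed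

lemma tens_alg_hom_unique:
  assumes B: "is_algebra C B" and v: "alg_hom C (tens_alg C X) B v" and w: "alg_hom C (tens_alg C X) B w"
    and eq: "v \<cdot> tgen = w \<cdot> tgen"
  shows "v = w"
proof (rule coproduct_cancel[OF tens_alg_coproduct])
  note [simp] = alg_hom_typing(1-3)[OF v] alg_hom_typing(1-3)[OF w]
  show "v \<cdot> tinj n = w \<cdot> tinj n" for n
  proof (induction n)
    case 0
    show ?case
      using alg_hom_typing(4)[OF v] alg_hom_typing(4)[OF w] by (simp add: tens_alg_unit)
  next
    case (Suc n)
    then show ?case
      unfolding tgen_tinj[symmetric]
      by (simp add: alg_hom_bil[OF v tens_alg_algebra B] alg_hom_bil[OF w tens_alg_algebra B] eq)
  qed
qed (use alg_hom_typing[OF v] alg_hom_typing[OF w] in simp_all)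

lemma tens_alg_hom_ex:
  assumes B: "is_algebra C B" and f: "f \<in> Hom C X (alg_obj B)"
  obtains v where "alg_hom C (tens_alg C X) B v" "v \<cdot> tgen = f"
proof -
  note [simp] = is_algebra_typing[OF B]
  let ?m = "alg_mult B" and ?F = "tens_pow C X" and ?c = "tens_pow_cat C X"
  have [simp]: "f \<in> Arr C" "Dom C f = X" "Cod C f = alg_obj B"
    using f by (auto simp: Hom_iff)
  \<comment> \<open>\<open>\<phi> n\<close> sends x1, ..., xn to f x1 (f x2 (... (f xn 1))),
    bracketed to the right and ending in the unit exactly like \<open>tens_pow\<close>.\<close>
  define \<phi> where "\<phi> = rec_nat (alg_unit B) (\<lambda>_. bil ?m f)"
  have \<phi>_0: "\<phi> 0 = alg_unit B" and \<phi>_Suc: "\<phi> (Suc n) = bil ?m f (\<phi> n)" for n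
    by (simp_all add: \<phi>_def)
  have \<phi> [simp]: "\<phi> n \<in> Arr C" "Cod C (\<phi> n) = alg_obj B" "Dom C (\<phi> n) = ?F n" for n
    by (induction n) (simp_all add: \<phi>_0 \<phi>_Suc)
  have \<phi>_mult: "bil ?m (\<phi> p) (\<phi> q) = \<phi> (p + q) \<cdot> ?c p q" for p q
  proof (induction p)
    case 0
    show ?case
      by (simp add: \<phi>_0 alg_lunit[OF B])
  next
    case (Suc p)
    then show ?case
      by (simp add: \<phi>_Suc alg_assoc[OF B] bil_comp)
  qed
  obtain v where v [simp]: "v \<in> Arr C" "Dom C v = tobj" "Cod C v = alg_obj B"
      and vj: "\<And>n. v \<cdot> tinj n = \<phi> n"
    using coproduct_factor[OF tens_alg_coproduct, of "alg_obj B" \<phi>] by auto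
  have "v \<cdot> tmul = bil ?m v v"
  proof (rule tens2_cancel)
    fix p q
    have "(v \<cdot> tmul) \<cdot> (tinj p \<otimes>\<^sub>a tinj q) = v \<cdot> bil tmul (tinj p) (tinj q)"
      by (simp add: bil_def)
    also have "\<dots> = (v \<cdot> tinj (p + q)) \<cdot> ?c p q"
      by (simp add: tmul_tinj)
    also have "\<dots> = bil ?m v v \<cdot> (tinj p \<otimes>\<^sub>a tinj q)"
      by (simp add: vj \<phi>_mult bil_comp)
    finally show "(v \<cdot> tmul) \<cdot> (tinj p \<otimes>\<^sub>a tinj q) = bil ?m v v \<cdot> (tinj p \<otimes>\<^sub>a tinj q)" .
  qed simp_all
  then have "alg_hom C (tens_alg C X) B v"
    by (simp add: alg_hom_def Hom_iff tens_alg_unit vj \<phi>_0 bil_def)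
  moreover have "v \<cdot> tgen = f"
  proof -
    have "v \<cdot> tgen = (v \<cdot> tinj (Suc 0)) \<cdot> arr_inv C (\<r> X)"
      by (simp add: tens_alg_gen_def)
    then show ?thesis
      by (simp add: vj \<phi>_Suc \<phi>_0 alg_runit[OF B])
  qed
  ultimately show thesis
    using that by blast
qed

end

end

section \<open>The universal Hochschild extension\<close>

context tensor_algebra_category
begin

context
  fixes A :: "('o, 'a) alg"
  assumes A_alg: "is_algebra C A"
begin

private lemmas A_typing [simp] = is_algebra_typing[OF A_alg]

abbreviation "univ_T \<equiv> tens_alg C (alg_obj A)"

private lemmas univ_T_alg = tens_alg_algebra[OF A_typing(1)]
private lemmas univ_T_typing [simp] = is_algebra_typing[OF univ_T_alg] tgen_typing[OF A_typing(1)]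

definition unit_rel :: 'a where
  "unit_rel = alg_unit univ_T \<oplus>\<^sub>a neg (tens_alg_gen C (alg_obj A) \<cdot> alg_unit A)"

lemma unit_rel_typing [simp]: "unit_rel \<in> Arr C" "Dom C unit_rel = \<I>" "Cod C unit_rel = alg_obj univ_T"
  by (simp_all add: unit_rel_def)

lemma univ_ideal_eq: "univ_ideal C A = gen_ideal C univ_T unit_rel"
  by (simp add: univ_ideal_def Let_def unit_rel_def arr_diff_eq)

abbreviation "unit_rel_ideal \<equiv> bil (alg_mult univ_T) (bil (alg_mult univ_T) (\<i>\<d> (alg_obj univ_T)) unit_rel) (\<i>\<d> (alg_obj univ_T))"
abbreviation "univ_proj \<equiv> coker_arr C (univ_ideal C A)"

lemma univ_E_quot:
  "is_cokernel C univ_proj unit_rel_ideal" "is_algebra C (univ_E C A)" "alg_hom C univ_T (univ_E C A) univ_proj"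
  unfolding univ_E_def univ_ideal_eq by (rule gen_ideal_quot[OF univ_T_alg]; simp)+

private lemmas univ_E_typing [simp] = cokernel_typing(1)[OF univ_E_quot(1)]
  is_algebra_typing[OF univ_E_quot(2)] alg_hom_typing(2-4)[OF univ_E_quot(3)]

lemma univ_rho_typing [simp]: "univ_rho C A \<in> Arr C" "Dom C (univ_rho C A) = alg_obj A"
  "Cod C (univ_rho C A) = alg_obj (univ_E C A)"
  by (simp_all add: univ_rho_def)

text \<open>The extension of \<open>f\<close> to the tensor algebra takes \<open>unit_rel\<close> to
  the difference between the unit of \<open>B\<close> and \<open>f 1\<close>. Unitality of
  \<open>f\<close> makes this zero, and then the whole generated ideal is killed.\<close>

lemma univ_E_hom_ex:
  assumes B: "is_algebra C B" and f: "f \<in> Hom C (alg_obj A) (alg_obj B)" "f \<cdot> alg_unit A = alg_unit B"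
  obtains v where "alg_hom C (univ_E C A) B v" "v \<cdot> univ_rho C A = f"
proof -
  note [simp] = is_algebra_typing[OF B]
  obtain v0 where v0: "alg_hom C univ_T B v0" "v0 \<cdot> tens_alg_gen C (alg_obj A) = f"
    using tens_alg_hom_ex[OF A_typing(1) B f(1)] .
  note [simp] = alg_hom_typing[OF v0(1)]
  have "v0 \<cdot> unit_rel = \<zero>\<^sub>a \<I> (alg_obj B)"
    using comp_reassoc[OF v0(2), of "alg_unit A"] f(2) by (simp add: unit_rel_def diff_zero_iff)
  then have "v0 \<cdot> unit_rel_ideal = \<zero>\<^sub>a (Dom C unit_rel_ideal) (alg_obj B)"
    by (simp add: alg_hom_bil[OF v0(1) univ_T_alg B] bil_zero)
  then obtain v where v: "alg_hom C (univ_E C A) B v" "v \<cdot> univ_proj = v0"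
    using quot_alg_factor[OF univ_E_quot(1,3) univ_T_alg univ_E_quot(2) B v0(1)] by blast
  have "v \<cdot> univ_rho C A = (v \<cdot> univ_proj) \<cdot> tens_alg_gen C (alg_obj A)"
    using alg_hom_typing[OF v(1)] by (simp add: univ_rho_def)
  then show thesis
    using that v v0(2) by simp
qed

lemma univ_E_hom_unique:
  assumes B: "is_algebra C B" and v: "alg_hom C (univ_E C A) B v" and w: "alg_hom C (univ_E C A) B w"
    and eq: "v \<cdot> univ_rho C A = w \<cdot> univ_rho C A"
  shows "v = w"
proof (rule epi_cancel[OF cokernel_epi[OF univ_E_quot(1)]])
  note [simp] = alg_hom_typing(1-3)[OF v] alg_hom_typing(1-3)[OF w]
  show "v \<cdot> univ_proj = w \<cdot> univ_proj"
  proof (rule tens_alg_hom_unique[OF A_typing(1) B])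
    show "alg_hom C univ_T B (v \<cdot> univ_proj)" "alg_hom C univ_T B (w \<cdot> univ_proj)"
      using alg_hom_comp[OF univ_E_quot(3) _ univ_T_alg univ_E_quot(2) B] v w by blast+
    show "(v \<cdot> univ_proj) \<cdot> tens_alg_gen C (alg_obj A) = (w \<cdot> univ_proj) \<cdot> tens_alg_gen C (alg_obj A)"
      using eq by (simp add: univ_rho_def)
  qed
qed (use alg_hom_typing[OF v] alg_hom_typing[OF w] in simp_all)

lemma univ_pi: "alg_hom C (univ_E C A) A (univ_pi C A)" "univ_pi C A \<cdot> univ_rho C A = \<i>\<d> (alg_obj A)"
proof -
  obtain v where v: "alg_hom C (univ_E C A) A v" "v \<cdot> univ_rho C A = \<i>\<d> (alg_obj A)"
    using univ_E_hom_ex[OF A_alg, of "\<i>\<d> (alg_obj A)"] by (auto simp: Hom_iff)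
  have "univ_pi C A = v"
    unfolding univ_pi_def
  proof (rule the_equality)
    show "w = v" if "alg_hom C (univ_E C A) A w \<and> w \<cdot> univ_rho C A = \<i>\<d> (alg_obj A)" for w
      using univ_E_hom_unique[OF A_alg, of w v] v that by simp
  qed (use v in simp)
  then show "alg_hom C (univ_E C A) A (univ_pi C A)" "univ_pi C A \<cdot> univ_rho C A = \<i>\<d> (alg_obj A)"
    using v by simp_all
qed

lemma univ_e_kernel: "is_kernel C (univ_e C A) (univ_pi C A)"
  unfolding univ_e_def by (rule ker_arr_kernel) (rule alg_hom_typing(1)[OF univ_pi(1)])

private lemmas univ_pi_typing [simp] = alg_hom_typing[OF univ_pi(1)]
  kernel_typing[OF univ_e_kernel, unfolded alg_hom_typing[OF univ_pi(1)]]

abbreviation "univ_sq \<equiv> bil (alg_mult (univ_E C A)) (univ_e C A) (univ_e C A)"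
abbreviation "hoch_proj \<equiv> coker_arr C (ideal_square C (univ_E C A) (univ_e C A))"

lemma univ_hoch_alg_quot:
  "is_cokernel C hoch_proj univ_sq" "is_algebra C (univ_hoch_alg C A)" "alg_hom C (univ_E C A) (univ_hoch_alg C A) hoch_proj"
  unfolding univ_hoch_alg_def
  by (rule ideal_square_quot[OF univ_E_quot(2) A_alg univ_pi(1) univ_e_kernel])+

private lemmas univ_hoch_alg_typing [simp] = cokernel_typing(1)[OF univ_hoch_alg_quot(1)]
  is_algebra_typing[OF univ_hoch_alg_quot(2)] alg_hom_typing(2-4)[OF univ_hoch_alg_quot(3)]

lemma hoch_proj_univ_sq: "hoch_proj \<cdot> univ_sq = \<zero>\<^sub>a (Dom C (univ_e C A) \<otimes>\<^sub>o Dom C (univ_e C A)) (alg_obj (univ_hoch_alg C A))"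
  using cokernel_typing(4)[OF univ_hoch_alg_quot(1)] by simp

lemma univ_hoch_map: "alg_hom C (univ_hoch_alg C A) A (univ_hoch_map C A)"
  "univ_hoch_map C A \<cdot> hoch_proj = univ_pi C A"
proof -
  have "univ_pi C A \<cdot> univ_sq = \<zero>\<^sub>a (Dom C univ_sq) (alg_obj A)"
    by (simp add: alg_hom_bil[OF univ_pi(1) univ_E_quot(2) A_alg] bil_zero)
  then obtain q where q: "alg_hom C (univ_hoch_alg C A) A q" "q \<cdot> hoch_proj = univ_pi C A"
    using quot_alg_factor[OF univ_hoch_alg_quot(1,3) univ_E_quot(2) univ_hoch_alg_quot(2) A_alg univ_pi(1)]
    by blast
  have "univ_hoch_map C A = q"
    unfolding univ_hoch_map_def
  proof (rule the_equality)
    show "w = q" if "w \<in> Hom C (alg_obj (univ_hoch_alg C A)) (alg_obj A) \<and> w \<cdot> hoch_proj = univ_pi C A" for w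
      using epi_cancel[OF cokernel_epi[OF univ_hoch_alg_quot(1)], of w q] q that alg_hom_typing[OF q(1)]
      by (simp add: Hom_iff)
  qed (use q alg_hom_typing[OF q(1)] in \<open>simp add: Hom_iff\<close>)
  then show "alg_hom C (univ_hoch_alg C A) A (univ_hoch_map C A)"
    "univ_hoch_map C A \<cdot> hoch_proj = univ_pi C A"
    using q by simp_all
qed

private lemmas univ_hoch_map_typing [simp] = alg_hom_typing[OF univ_hoch_map(1)]

text \<open>Splitting \<open>E\<^sub>A = e\<^sub>A \<oplus> \<rho>\<^sub>A A\<close>, the projection of \<open>E\<^sub>A / e\<^sub>A\<^sup>2\<close> onto the kernel of its map to \<open>A\<close> is
  \<open>d\<close>, and \<open>d \<circ> hoch_proj\<close> factors through \<open>e\<^sub>A\<close>; hence products of values of \<open>d\<close> vanish.\<close>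

lemma univ_hoch_square_zero:
  "square_zero_extension C (univ_hoch_alg C A) A (univ_hoch_map C A) (hoch_proj \<cdot> univ_rho C A)
    (ker_arr C (univ_hoch_map C A))"
proof -
  let ?Q = "univ_hoch_alg C A" and ?q = "univ_hoch_map C A" and ?e = "univ_e C A"
    and ?E = "univ_E C A" and ?\<pi> = "univ_pi C A" and ?\<rho> = "univ_rho C A"
  define s where "s = hoch_proj \<cdot> ?\<rho>"
  have [simp]: "s \<in> Arr C" "Dom C s = alg_obj A" "Cod C s = alg_obj ?Q"
    by (simp_all add: s_def)
  have qs: "?q \<cdot> s = \<i>\<d> (alg_obj A)"
    by (simp add: s_def comp_reassoc[OF univ_hoch_map(2)] univ_pi(2))
  define k where "k = ker_arr C ?q"
  have k: "is_kernel C k ?q"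
    unfolding k_def by (rule ker_arr_kernel) simp
  note [simp] = kernel_typing[OF k, unfolded alg_hom_typing[OF univ_hoch_map(1)]]
  define d where "d = \<i>\<d> (alg_obj ?Q) \<oplus>\<^sub>a neg (s \<cdot> ?q)"
  have [simp]: "d \<in> Arr C" "Dom C d = alg_obj ?Q" "Cod C d = alg_obj ?Q"
    by (simp_all add: d_def)
  have dk: "d \<cdot> k = k"
    by (simp add: d_def)
  have "?\<pi> \<cdot> (\<i>\<d> (alg_obj ?E) \<oplus>\<^sub>a neg (?\<rho> \<cdot> ?\<pi>)) = \<zero>\<^sub>a (alg_obj ?E) (alg_obj A)"
    by (simp add: comp_reassoc[OF univ_pi(2)])
  then obtain y where [simp]: "y \<in> Arr C" "Dom C y = alg_obj ?E" "Cod C y = Dom C ?e"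
      and y: "?e \<cdot> y = \<i>\<d> (alg_obj ?E) \<oplus>\<^sub>a neg (?\<rho> \<cdot> ?\<pi>)"
    using kernel_factor[OF univ_e_kernel, of "\<i>\<d> (alg_obj ?E) \<oplus>\<^sub>a neg (?\<rho> \<cdot> ?\<pi>)"] by auto
  have dp: "d \<cdot> hoch_proj = hoch_proj \<cdot> ?e \<cdot> y"
    unfolding y by (simp add: d_def s_def univ_hoch_map(2))
  \<comment> \<open>Tested on pairs of values of the quotient map, where \<open>dp\<close> turns the
    product into the image of an element of e_A^2.\<close>
  have dd: "bil (alg_mult ?Q) d d = \<zero>\<^sub>a (alg_obj ?Q \<otimes>\<^sub>o alg_obj ?Q) (alg_obj ?Q)"
  proof (rule epi_cancel[OF cokernel_tens_epi(3)[OF univ_hoch_alg_quot(1)]])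
    have "bil (alg_mult ?Q) d d \<cdot> (hoch_proj \<otimes>\<^sub>a hoch_proj) = bil (alg_mult ?Q) (hoch_proj \<cdot> ?e \<cdot> y) (hoch_proj \<cdot> ?e \<cdot> y)"
      by (simp add: bil_comp dp)
    also have "\<dots> = hoch_proj \<cdot> bil (alg_mult ?E) (?e \<cdot> y) (?e \<cdot> y)"
      by (simp add: alg_hom_bil[OF univ_hoch_alg_quot(3) univ_E_quot(2) univ_hoch_alg_quot(2)])
    also have "\<dots> = hoch_proj \<cdot> univ_sq \<cdot> (y \<otimes>\<^sub>a y)"
      by (simp add: bil_comp)
    also have "\<dots> = \<zero>\<^sub>a (alg_obj ?E \<otimes>\<^sub>o alg_obj ?E) (alg_obj ?Q)"
      by (simp add: comp_reassoc[OF hoch_proj_univ_sq])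
    finally show "bil (alg_mult ?Q) d d \<cdot> (hoch_proj \<otimes>\<^sub>a hoch_proj)
        = \<zero>\<^sub>a (alg_obj ?Q \<otimes>\<^sub>o alg_obj ?Q) (alg_obj ?Q) \<cdot> (hoch_proj \<otimes>\<^sub>a hoch_proj)"
      by simp
  qed simp_all
  have "bil (alg_mult ?Q) k k = bil (alg_mult ?Q) d d \<cdot> (k \<otimes>\<^sub>a k)"
    by (simp add: bil_comp dk)
  also have "\<dots> = \<zero>\<^sub>a (Dom C k \<otimes>\<^sub>o Dom C k) (alg_obj ?Q)"
    by (simp add: dd)
  finally have kk: "bil (alg_mult ?Q) k k = \<zero>\<^sub>a (Dom C k \<otimes>\<^sub>o Dom C k) (alg_obj ?Q)" .
  show ?thesis
    unfolding s_def[symmetric] k_def[symmetric]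
    by (unfold_locales)
      (use univ_hoch_alg_quot(2) A_alg univ_hoch_map(1) qs k kk in \<open>simp_all add: Hom_iff bil_def\<close>)
qed

lemma univ_hoch_lift:
  assumes ext: "square_zero_extension C E B p s i" and f: "alg_hom C A B f"
  obtains v where "alg_hom C (univ_hoch_alg C A) E v" "p \<cdot> v = f \<cdot> univ_hoch_map C A"
proof -
  interpret ext: square_zero_extension C E B p s i
    by (rule ext)
  note [simp] = alg_hom_typing[OF f]
  obtain r where r: "r \<in> Hom C (alg_obj B) (alg_obj E)" "p \<cdot> r = \<i>\<d> (alg_obj B)"
      "r \<cdot> alg_unit B = alg_unit E"
    using ext.ex_unital_section .
  have [simp]: "r \<in> Arr C" "Dom C r = alg_obj B" "Cod C r = alg_obj E"
    using r(1) by (auto simp: Hom_iff)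
  obtain v where v: "alg_hom C (univ_E C A) E v" "v \<cdot> univ_rho C A = r \<cdot> f"
    using univ_E_hom_ex[OF ext.E_alg, of "r \<cdot> f"] r(3) by (auto simp: Hom_iff)
  note [simp] = alg_hom_typing[OF v(1)]
  \<comment> \<open>Both sides are algebra maps out of \<open>E_A\<close> that restrict to
    \<open>f\<close> along \<open>univ_rho\<close>: on the left because \<open>r\<close> is a
    section of \<open>p\<close>, on the right by the definition of \<open>univ_pi\<close>.\<close>
  have pv: "p \<cdot> v = f \<cdot> univ_pi C A"
  proof (rule univ_E_hom_unique[OF ext.B_alg])
    show "alg_hom C (univ_E C A) B (p \<cdot> v)"
      by (rule alg_hom_comp[OF v(1) ext.p_hom univ_E_quot(2) ext.E_alg ext.B_alg])
    show "alg_hom C (univ_E C A) B (f \<cdot> univ_pi C A)"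
      by (rule alg_hom_comp[OF univ_pi(1) f univ_E_quot(2) A_alg ext.B_alg])
    show "(p \<cdot> v) \<cdot> univ_rho C A = (f \<cdot> univ_pi C A) \<cdot> univ_rho C A"
      by (simp add: v(2) univ_pi(2) comp_reassoc[OF r(2)])
  qed
  have "p \<cdot> v \<cdot> univ_e C A = \<zero>\<^sub>a (Dom C (univ_e C A)) (alg_obj B)"
    using comp_reassoc[OF pv, of "univ_e C A"] by simp
  then have "bil (alg_mult E) (v \<cdot> univ_e C A) (v \<cdot> univ_e C A)
      = \<zero>\<^sub>a (Dom C (univ_e C A) \<otimes>\<^sub>o Dom C (univ_e C A)) (alg_obj E)"
    using ext.kernel_mul_zero[of "v \<cdot> univ_e C A" "v \<cdot> univ_e C A"] by simp
  then have "v \<cdot> univ_sq = \<zero>\<^sub>a (Dom C univ_sq) (alg_obj E)"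
    by (simp add: alg_hom_bil[OF v(1) univ_E_quot(2) ext.E_alg])
  then obtain v' where v': "alg_hom C (univ_hoch_alg C A) E v'" "v' \<cdot> hoch_proj = v"
    using quot_alg_factor[OF univ_hoch_alg_quot(1,3) univ_E_quot(2) univ_hoch_alg_quot(2) ext.E_alg v(1)]
    by blast
  note [simp] = alg_hom_typing[OF v'(1)]
  have "p \<cdot> v' = f \<cdot> univ_hoch_map C A"
    by (rule epi_cancel[OF cokernel_epi[OF univ_hoch_alg_quot(1)]])
      (simp_all add: v'(2) pv univ_hoch_map(2))
  then show thesis
    using that v'(1) by blast
qed

end

end

section \<open>Equivalence of the lifting, extension and cohomological conditions\<close>

theorem theorem2p32:
  fixes C :: "('o, 'a, 'z) mon_cat_scheme" (structure)
    and A :: "('o, 'a) alg"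
  assumes "abelian_monoidal_category C"
    and "tensor_denumerable_coproducts C"
    and "is_algebra C A"
  defines "cond_a \<equiv> trivial_extension C (univ_hoch_alg C A) A (univ_hoch_map C A)"
    and "cond_b \<equiv> (\<forall>E B p. is_algebra C E \<and> is_algebra C B \<and> alg_hom C E B p \<and>
          (\<exists>s \<in> Hom C (alg_obj B) (alg_obj E). p \<cdot> s = \<i>\<d> (alg_obj B)) \<and>
          (\<exists>i. is_kernel C i p \<and>
            alg_mult E \<cdot> (i \<otimes>\<^sub>a i) = \<zero>\<^sub>a (Dom C i \<otimes>\<^sub>o Dom C i) (alg_obj E)) \<longrightarrow>
          (\<forall>f. alg_hom C A B f \<longrightarrow> (\<exists>g. alg_hom C A E g \<and> p \<cdot> g = f)))"
    and "cond_c \<equiv> (\<forall>B f s. is_algebra C B \<and> alg_hom C A B f \<and> alg_hom C B A s \<and>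
          f \<cdot> s = \<i>\<d> (alg_obj B) \<longrightarrow>
          (\<forall>M E p i. hochschild_extension C B M E p i \<longrightarrow> trivial_extension C E B p))"
    and "cond_d \<equiv> (\<forall>M E p i. hochschild_extension C A M E p i \<longrightarrow> trivial_extension C E A p)"
    and "cond_e \<equiv> (\<forall>M. is_bimodule C A M \<longrightarrow> trivial_group (hoch_H2 C A M))"
    and "cond_f \<equiv> (\<forall>B f s. is_algebra C B \<and> alg_hom C A B f \<and> alg_hom C B A s \<and>
          f \<cdot> s = \<i>\<d> (alg_obj B) \<longrightarrow>
          trivial_extension C (univ_hoch_alg C B) B (univ_hoch_map C B))"
  shows "(cond_a \<longleftrightarrow> cond_b) \<and> (cond_b \<longleftrightarrow> cond_c) \<and> (cond_c \<longleftrightarrow> cond_d) \<and>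
         (cond_d \<longleftrightarrow> cond_e) \<and> (cond_e \<longleftrightarrow> cond_f)"
proof -
  interpret tensor_algebra_category C
    using assms(1,2) by (simp add: tensor_algebra_category_def tensor_algebra_category_axioms_def)
  note A = assms(3)
  \<comment> \<open>Stated for every algebra \<open>B\<close>, since it is used for \<open>A\<close>
    in (d) to (a) and for the retracts of \<open>A\<close> in (c) to (f).\<close>
  have univ: "trivial_extension C (univ_hoch_alg C B) B (univ_hoch_map C B)"
    if "is_algebra C B" and "\<And>M E p i. hochschild_extension C B M E p i \<Longrightarrow> trivial_extension C E B p" for B
    using square_zero_extension.ex_kernel_bimodule[OF univ_hoch_square_zero[OF that(1)]] that(2) by blast
  have id: "alg_hom C A A (\<i>\<d> (alg_obj A))" "\<i>\<d> (alg_obj A) \<cdot> \<i>\<d> (alg_obj A) = \<i>\<d> (alg_obj A)"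
    using is_algebra_typing[OF A] by (simp_all add: alg_hom_def Hom_iff)
  have ab: cond_b if cond_a
    unfolding cond_b_def
  proof (intro allI impI, elim conjE exE bexE)
    fix E B p f s i
    assume E: "is_algebra C E" and B: "is_algebra C B" and p: "alg_hom C E B p"
      and s: "s \<in> Hom C (alg_obj B) (alg_obj E)" "p \<cdot> s = \<i>\<d> (alg_obj B)"
      and i: "is_kernel C i p" "alg_mult E \<cdot> (i \<otimes>\<^sub>a i) = \<zero>\<^sub>a (Dom C i \<otimes>\<^sub>o Dom C i) (alg_obj E)"
      and f: "alg_hom C A B f"
    have "square_zero_extension C E B p s i"
      by unfold_locales (use E B p s i in simp_all)
    then obtain v where v: "alg_hom C (univ_hoch_alg C A) E v" "p \<cdot> v = f \<cdot> univ_hoch_map C A"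
      using univ_hoch_lift[OF A _ f] by blast
    obtain g where g: "alg_hom C A (univ_hoch_alg C A) g" "univ_hoch_map C A \<cdot> g = \<i>\<d> (alg_obj A)"
      using \<open>cond_a\<close> by (auto simp: cond_a_def trivial_extension_def)
    note [simp] = alg_hom_typing(1-3)[OF v(1)] alg_hom_typing(1-3)[OF g(1)] alg_hom_typing(1-3)[OF p]
      alg_hom_typing(1-3)[OF f] alg_hom_typing(1-3)[OF univ_hoch_map(1)[OF A]]
    have "p \<cdot> v \<cdot> g = f"
      using comp_reassoc[OF v(2), of g] by (simp add: g(2))
    then show "\<exists>g. alg_hom C A E g \<and> p \<cdot> g = f"
      using alg_hom_comp[OF g(1) v(1) A univ_hoch_alg_quot(2)[OF A] E] by blast
  qed
  have bc: cond_c if cond_b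
    unfolding cond_c_def
  proof (intro allI impI, elim conjE)
    fix B f s M E p i
    assume B: "is_algebra C B" and f: "alg_hom C A B f" and s: "alg_hom C B A s"
      and fs: "f \<cdot> s = \<i>\<d> (alg_obj B)" and ext: "hochschild_extension C B M E p i"
    obtain t where t: "square_zero_extension C E B p t i"
      using hochschild_extensionE[OF ext B] by blast
    interpret ext: square_zero_extension C E B p t i
      by (rule t)
    obtain g where g: "alg_hom C A E g" "p \<cdot> g = f"
      using \<open>cond_b\<close> f ext.E_alg B ext.p_hom ext.s_Hom ext.p_s ext.i_ker ext.i_sq
      unfolding cond_b_def by blast
    note [simp] = alg_hom_typing(1-3)[OF g(1)] alg_hom_typing(1-3)[OF s]
    \<comment> \<open>The lift \<open>g\<close> of the retraction \<open>f\<close>, restricted along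
      the algebra section \<open>s\<close> of \<open>f\<close>, is the desired section of
      \<open>p\<close>.\<close>
    have "p \<cdot> g \<cdot> s = \<i>\<d> (alg_obj B)"
      using comp_reassoc[OF g(2), of s] by (simp add: fs)
    then show "trivial_extension C E B p"
      using alg_hom_comp[OF s g(1) B A ext.E_alg] by (auto simp: trivial_extension_def)
  qed
  have cd: cond_d if cond_c
    using that A id unfolding cond_c_def cond_d_def by blast
  have da: cond_a if cond_d
    using that univ[OF A] unfolding cond_a_def cond_d_def by blast
  have de: cond_e if cond_d
    using that trivial_H2_if_trivial_extensions[OF A] unfolding cond_d_def cond_e_def by blast
  have ed: cond_d if cond_e
    unfolding cond_d_def
  proof (intro allI impI)
    fix M E p i
    assume ext: "hochschild_extension C A M E p i"
    obtain s where s: "square_zero_extension C E A p s i" "Dom C i = bim_obj M"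
      "i \<cdot> bim_left M = bil (alg_mult E) s i" "i \<cdot> bim_right M = bil (alg_mult E) i s"
      using hochschild_extensionE[OF ext A] .
    have M: "is_bimodule C A M"
      using ext by (simp add: hochschild_extension_def)
    show "trivial_extension C E A p"
      by (rule square_zero_extension.trivial_if_trivial_H2[OF s(1) M s(2-4)])
        (use \<open>cond_e\<close> M in \<open>simp add: cond_e_def\<close>)
  qed
  have cf: cond_f if cond_c
    using that univ unfolding cond_c_def cond_f_def by blast
  have fa: cond_a if cond_f
    using that A id unfolding cond_f_def cond_a_def by blast
  show ?thesis
    using ab bc cd da de ed cf fa by blast
qed

end
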